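(* Let $\alpha>(2\pi)^{1/3}$. Then for every $m>0$ the minimization problem $$e_\alpha(m)=\inf\{\mathcal F_\alpha(E): E\subset\mathbb R^3 \text{ a set of finite perimeter},\ |E|=m\}$$ admits a solution (i.e. the infimum is attained). Moreover, the function $m\mapsto m^{-1}e_\alpha(m)$ is strictly decreasing on $(0,\infty)$.
   Context: For $\alpha\ge 0$ and a set of finite perimeter $E\subset\mathbb R^3$ with $|E|<\infty$ (where $|\cdot|$ is Lebesgue measure), $$\mathcal F_\alpha(E)=\mathcal P(E)+\mathcal N_\alpha(E),\qquad \mathcal N_\alpha(E)=\int_E\int_E \frac{e^{-\alpha|x-y|}}{|x-y|}\,dx\,dy,$$ where $\mathcal P(E)$ is the perimeter of $E$ in the De Giorgi sense. *)

theory Defs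
  imports "HOL-Analysis.Analysis"
begin

definition C1_field :: "(real^3 \<Rightarrow> real^3) \<Rightarrow> bool" where
  "C1_field \<phi> \<longleftrightarrow>
     (\<exists>\<phi>' :: real^3 \<Rightarrow> ((real^3) \<Rightarrow>\<^sub>L (real^3)).
        (\<forall>x. (\<phi> has_derivative blinfun_apply (\<phi>' x)) (at x)) \<and> continuous_on UNIV \<phi>')"

definition divergence :: "(real^3 \<Rightarrow> real^3) \<Rightarrow> real^3 \<Rightarrow> real" where
  "divergence \<phi> x = (\<Sum>i\<in>UNIV. frechet_derivative \<phi> (at x) (axis i 1) $ i)"

definition test_fields :: "(real^3 \<Rightarrow> real^3) set" where
  "test_fields =
     {\<phi>. C1_field \<phi> \<and> compact (closure {x. \<phi> x \<noteq> 0}) \<and> (\<forall>x. norm (\<phi> x) \<le> 1)}"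

text \<open>
  The De Giorgi perimeter, meaningful for Lebesgue measurable \<open>E\<close>. Since the zero field is a
  test field, the supremum of the real integrals is nonnegative, so truncating negative values
  to \<open>0\<close> by \<open>ennreal\<close> does not change it.
\<close>

definition perimeter :: "(real^3) set \<Rightarrow> ennreal" where
  "perimeter E = (SUP \<phi>\<in>test_fields. ennreal (LINT x:E|lebesgue. divergence \<phi> x))"

definition finite_perimeter :: "(real^3) set \<Rightarrow> bool" where
  "finite_perimeter E \<longleftrightarrow> E \<in> sets lebesgue \<and> perimeter E < \<infinity>"

text \<open>
  On the diagonal \<open>x = y\<close> the kernel has the value \<open>0\<close> instead of being singular; for each \<open>x\<close> this
  changes the inner integrand only on a null set.
\<close>

definition yukawa_energy :: "real \<Rightarrow> (real^3) set \<Rightarrow> ennreal" where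
  "yukawa_energy \<alpha> E =
     (\<integral>\<^sup>+x\<in>E. (\<integral>\<^sup>+y\<in>E. ennreal (exp (- \<alpha> * norm (x - y)) / norm (x - y)) \<partial>lebesgue) \<partial>lebesgue)"

definition total_energy :: "real \<Rightarrow> (real^3) set \<Rightarrow> ennreal" where
  "total_energy \<alpha> E = perimeter E + yukawa_energy \<alpha> E"

definition admissible :: "real \<Rightarrow> (real^3) set set" where
  "admissible m = {E. finite_perimeter E \<and> emeasure lebesgue E = ennreal m}"

definition min_energy :: "real \<Rightarrow> real \<Rightarrow> ennreal" where
  "min_energy \<alpha> m = (INF E\<in>admissible m. total_energy \<alpha> E)"

end

theory Submission
  imports Defs "HOL-Probability.Distributions" "HOL-Real_Asymp.Real_Asymp" "HOL-Library.Diagonal_Subsequence"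
begin

text \<open>
  Write $K(z) = e^{-\alpha|z|}/|z|$ and $\kappa = 2\pi/\alpha^3 < 1$. The key estimate is
  $\int K(z)\,|E \setminus (E + tz)|\,dz \le t \kappa P(E)$ for $t \ge 0$: by mollification it reduces to
  $\int K(z)\,|z \cdot u|\,dz = 4\pi/\alpha^3$ for unit vectors $u$. Since
  $N(\lambda E)/\lambda^3 = \int K(z)\,|E \cap (E + z/\lambda)|\,dz$, it yields
  $F(\lambda E)/\lambda^3 \le F(E) - (1 - 1/\lambda)(1 - \kappa) P(E)$ for $\lambda \ge 1$, so $e(m)/m$ is strictly
  decreasing by the isoperimetric inequality. Strict monotonicity gives $e(a) + e(m - a) > e(m)$,
  uniformly for $a$ in compact subsets of $(0, m)$. Cutting with a ball whose sphere carries little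
  area of $E$ therefore shows that a minimizing sequence, suitably translated, loses no mass at
  infinity; a subsequence then converges in $L^1$, and the energy is lower semicontinuous.
\<close>

section \<open>Moments of radial kernels\<close>

text \<open>The perimeter is available only as a supremum over C^1 test fields. Translation
  estimates therefore go through a mollified indicator, whose gradient g satisfies \<integral>|g|
  \<le> P(E). For a shift h they keep |g . h| instead of |g||h|: the mean of |z . u| over the
  directions of z is |z|/2, which halves the constant. It is halved again because the L1 distance
  between E and E + h counts |E minus (E + h)| twice; the result is \<kappa>. The area of E on a
  sphere is likewise replaced by the lower right slope of r -> |E \<inter> B_r|, which a
  monotonicity argument makes small at some radius. The translation estimate is proved for a general
  kernel. The Yukawa kernel gives the scaling inequality. The indicator of a ball gives a weak
  isoperimetric inequality, of which only a positive lower bound at fixed mass is used, and the L1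
  approximation of sets by ball averages behind compactness. Strict monotonicity concerns infima not
  yet known to be attained, so the perimeter bound has to be uniform over near-minimizers.\<close>

lemma nn_integral_lborel_affine:
  fixes f :: "'a::euclidean_space \<Rightarrow> ennreal" and t :: 'a
  assumes [measurable]: "f \<in> borel_measurable borel" and c: "c \<noteq> 0"
  shows "(\<integral>\<^sup>+x. f x \<partial>lborel) = ennreal (\<bar>c\<bar> ^ DIM('a)) * (\<integral>\<^sup>+x. f (t + c *\<^sub>R x) \<partial>lborel)"
  by (subst lborel_affine[OF c, of t])
     (simp add: nn_integral_density nn_integral_distr nn_integral_cmult)

lemma nn_integral_lborel_translate:
  fixes f :: "'a::euclidean_space \<Rightarrow> ennreal"
  assumes [measurable]: "f \<in> borel_measurable borel"
  shows "(\<integral>\<^sup>+x. f (x - t) \<partial>lborel) = (\<integral>\<^sup>+x. f x \<partial>lborel)"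
  using nn_integral_lborel_affine[of f 1 "- t"] by (simp add: algebra_simps)

lemma nn_integral_lborel_reflect:
  fixes f :: "'a::euclidean_space \<Rightarrow> ennreal"
  assumes [measurable]: "f \<in> borel_measurable borel"
  shows "(\<integral>\<^sup>+x. f (t - x) \<partial>lborel) = (\<integral>\<^sup>+x. f x \<partial>lborel)"
  using nn_integral_lborel_affine[of f "-1" t] by simp

text \<open>Layer cake: the radial weight is the integral of \<open>q\<close> over the radii s >
  |z|. Exchanging the integrals leaves the integral of \<open>g\<close> over the ball of radius s,
  which homogeneity reduces to the unit ball. All radial weights thus share one ball integral, which
  can be computed from the most convenient of them.\<close>

lemma nn_integral_radial_homogeneous:
  fixes g :: "'a::euclidean_space \<Rightarrow> ennreal" and q :: "real \<Rightarrow> ennreal"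
  assumes [measurable]: "g \<in> borel_measurable borel" "q \<in> borel_measurable borel"
    and hom: "\<And>s z. s > 0 \<Longrightarrow> g (s *\<^sub>R z) = ennreal (s ^ d) * g z"
  shows "(\<integral>\<^sup>+z. (\<integral>\<^sup>+s. q s * indicator {norm z<..} s \<partial>lborel) * g z \<partial>lborel)
    = (\<integral>\<^sup>+z. g z * indicator (ball 0 1) z \<partial>lborel)
      * (\<integral>\<^sup>+s. q s * ennreal (s ^ (d + DIM('a))) * indicator {0<..} s \<partial>lborel)"
proof -
  define I where "I = (\<integral>\<^sup>+z. g z * indicator (ball 0 1) z \<partial>lborel)"
  have [measurable]: "Measurable.pred (borel \<Otimes>\<^sub>M borel) (\<lambda>x. norm (fst x :: 'a) < (snd x :: real))" 
    by measurable
  have [measurable]: "\<And>s. ball (0::'a) s \<in> sets borel" by simp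
  have inner: "(\<integral>\<^sup>+z. g z * indicator (ball 0 s) z \<partial>lborel) = ennreal (s ^ (d + DIM('a))) * I" if s: "s > 0" for s
  proof -
    have "(\<integral>\<^sup>+z. g z * indicator (ball 0 s) z \<partial>lborel)
      = ennreal (s ^ DIM('a)) * (\<integral>\<^sup>+z. g (s *\<^sub>R z) * indicator (ball 0 s) (s *\<^sub>R z) \<partial>lborel)"
      using s by (subst nn_integral_lborel_affine[of _ s 0]) auto
    also have "(\<integral>\<^sup>+z. g (s *\<^sub>R z) * indicator (ball 0 s) (s *\<^sub>R z) \<partial>lborel)
      = (\<integral>\<^sup>+z. ennreal (s ^ d) * (g z * indicator (ball 0 1) z) \<partial>lborel)"
      using s by (intro nn_integral_cong) (auto simp: hom indicator_def mult.assoc)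
    also have "\<dots> = ennreal (s ^ d) * I" by (simp add: nn_integral_cmult I_def)
    finally show ?thesis using s by (simp add: power_add ennreal_mult mult_ac)
  qed
  have "(\<integral>\<^sup>+z. (\<integral>\<^sup>+s. q s * indicator {norm z<..} s \<partial>lborel) * g z \<partial>lborel)
     = (\<integral>\<^sup>+z. (\<integral>\<^sup>+s. q s * g z * (if norm z < s then 1 else 0) \<partial>lborel) \<partial>lborel)"
    by (subst nn_integral_multc[symmetric]) 
       (auto intro!: nn_integral_cong simp: indicator_def mult_ac)
  also have "\<dots> = (\<integral>\<^sup>+s. (\<integral>\<^sup>+z. q s * g z * (if norm z < s then 1 else 0) \<partial>lborel) \<partial>lborel)"
    by (rule lborel_pair.Fubini') (auto simp: case_prod_beta')
  also have "\<dots> = (\<integral>\<^sup>+s. I * (q s * ennreal (s ^ (d + DIM('a))) * indicator {0<..} s) \<partial>lborel)"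
  proof (intro nn_integral_cong)
    fix s :: real
    have "(\<integral>\<^sup>+z. q s * g z * (if norm z < s then 1 else 0) \<partial>lborel)
      = q s * (\<integral>\<^sup>+z. g z * indicator (ball 0 s) z \<partial>lborel)"
      by (subst nn_integral_cmult[symmetric]) (auto intro!: nn_integral_cong simp: indicator_def mult_ac)
    then show "(\<integral>\<^sup>+z. q s * g z * (if norm z < s then 1 else 0) \<partial>lborel)
      = I * (q s * ennreal (s ^ (d + DIM('a))) * indicator {0<..} s)"
      using inner[of s] by (cases "s > 0") (auto simp: mult_ac ball_empty)
  qed
  also have "\<dots> = I * (\<integral>\<^sup>+s. q s * ennreal (s ^ (d + DIM('a))) * indicator {0<..} s \<partial>lborel)"
    by (rule nn_integral_cmult) auto
  finally show ?thesis by (simp add: I_def)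
qed

text \<open>Volumes of boxes determine \<open>lborel\<close>, and the preimage of a box under
  \<open>T\<close> is its image under the inverse orthogonal map, which has the Lebesgue measure of
  the box.\<close>

lemma nn_integral_lborel_orthogonal:
  fixes f :: "(real^('n::{finite,wellorder})) \<Rightarrow> ennreal" and T :: "(real^('n::{finite,wellorder})) \<Rightarrow> (real^('n::{finite,wellorder}))"
  assumes T: "orthogonal_transformation T" and [measurable]: "f \<in> borel_measurable borel"
  shows "(\<integral>\<^sup>+x. f (T x) \<partial>lborel) = (\<integral>\<^sup>+x. f x \<partial>lborel)"
proof -
  have lin: "linear T" using T by (simp add: orthogonal_transformation_linear)
  then have [measurable]: "T \<in> borel_measurable borel"
    by (intro borel_measurable_continuous_onI linear_continuous_on linear_conv_bounded_linear[THEN iffD1])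
  have "distr lborel borel T = (lborel :: (real^('n::{finite,wellorder})) measure)"
  proof (rule lborel_eqI[symmetric])
    fix l u :: "real^('n::{finite,wellorder})" assume lu: "\<And>b. b \<in> Basis \<Longrightarrow> l \<bullet> b \<le> u \<bullet> b"
    define S where "S = inv T"
    have S: "orthogonal_transformation S" unfolding S_def by (rule orthogonal_transformation_inv[OF T])
    have bij: "bij T" by (rule orthogonal_transformation_bij[OF T])
    have "T -` box l u = S ` box l u"
      unfolding S_def by (rule bij_vimage_eq_inv_image[OF bij])
    then have "emeasure (distr lborel borel T) (box l u) = emeasure lborel (S ` box l u)"
      by (simp add: emeasure_distr)
    also have "\<dots> = ennreal (measure lebesgue (S ` box l u))"
    proof -
      have m: "S ` box l u \<in> lmeasurable" by (rule measurable_orthogonal_image[OF S]) simp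
      have b: "S ` box l u \<in> sets borel"
        using \<open>T -` box l u = S ` box l u\<close> by (metis \<open>T \<in> borel_measurable borel\<close> borel_open measurable_sets_borel open_box)
      have "emeasure lborel (S ` box l u) = emeasure lebesgue (S ` box l u)" using b by simp
      also have "\<dots> = ennreal (measure lebesgue (S ` box l u))" by (rule emeasure_eq_measure2[OF m])
      finally show ?thesis .
    qed
    also have "measure lebesgue (S ` box l u) = measure lebesgue (box l u)"
      by (rule measure_orthogonal_image[OF S]) simp
    also have "ennreal \<dots> = (\<Prod>b\<in>Basis. (u - l) \<bullet> b)"
      using lu by (simp add: measure_lborel_box_eq)
    finally show "emeasure (distr lborel borel T) (box l u) = (\<Prod>b\<in>Basis. (u - l) \<bullet> b)" .
  qed simp
  then have "(\<integral>\<^sup>+x. f x \<partial>lborel) = (\<integral>\<^sup>+x. f x \<partial>distr lborel borel T)" by simp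
  then show ?thesis by (simp add: nn_integral_distr)
qed


lemma nn_integral_FTC_greaterThan:
  fixes f :: "real \<Rightarrow> real"
  assumes "f \<in> borel_measurable borel"
    and "\<And>x. a \<le> x \<Longrightarrow> DERIV F x :> f x" "\<And>x. a \<le> x \<Longrightarrow> 0 \<le> f x" "(F \<longlongrightarrow> T) at_top"
  shows "(\<integral>\<^sup>+x. ennreal (f x) * indicator {a<..} x \<partial>lborel) = ennreal (T - F a)"
proof -
  have "(\<integral>\<^sup>+x. ennreal (f x) * indicator {a<..} x \<partial>lborel) = (\<integral>\<^sup>+x. ennreal (f x) * indicator {a..} x \<partial>lborel)"
    by (rule nn_integral_cong_AE) (use AE_lborel_singleton[of a] in eventually_elim, auto simp: indicator_def)
  then show ?thesis using nn_integral_FTC_atLeast[OF assms] by simp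
qed

text \<open>
  The Gaussian moment factorizes over the coordinates once $u$ is rotated to a basis vector;
  the layer-cake formula above then transfers it to the unit ball and from there to the Yukawa kernel.
\<close>

lemma nn_integral_gaussian_abs_inner:
  fixes u :: "real^3"
  assumes u: "norm u = 1"
  shows "(\<integral>\<^sup>+z. ennreal (exp (- (norm z)\<^sup>2)) * ennreal \<bar>z \<bullet> u\<bar> \<partial>lborel) = ennreal pi"
proof -
  define e :: "real^3" where "e = axis 1 1"
  have e: "e \<in> Basis" "norm e = 1" by (auto simp: e_def axis_in_Basis_iff)
  obtain T where T: "orthogonal_transformation T" "T e = u"
    using orthogonal_transformation_exists_1[OF e(2) u] .
  have "(\<integral>\<^sup>+z. ennreal (exp (- (norm z)\<^sup>2)) * ennreal \<bar>z \<bullet> u\<bar> \<partial>lborel)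
    = (\<integral>\<^sup>+z. ennreal (exp (- (norm (T z))\<^sup>2)) * ennreal \<bar>T z \<bullet> u\<bar> \<partial>lborel)"
    by (rule nn_integral_lborel_orthogonal[OF T(1), symmetric]) measurable
  also have "\<dots> = (\<integral>\<^sup>+z. ennreal (exp (- (norm z)\<^sup>2)) * ennreal \<bar>z \<bullet> e\<bar> \<partial>lborel)"
    unfolding T(2)[symmetric] using T(1) 
    by (simp add: orthogonal_transformation_norm orthogonal_transformation_def)
  also have "\<dots> = (\<integral>\<^sup>+z. (\<Prod>b\<in>Basis. ennreal (exp (- (z \<bullet> b)\<^sup>2) * (if b = e then \<bar>z \<bullet> b\<bar> else 1))) \<partial>lborel)"
  proof (intro nn_integral_cong)
    fix z :: "real^3"
    have "(\<Prod>b\<in>Basis. ennreal (exp (- (z \<bullet> b)\<^sup>2) * (if b = e then \<bar>z \<bullet> b\<bar> else 1)))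
      = ennreal (\<Prod>b\<in>Basis. (exp (- (z \<bullet> b)\<^sup>2) * (if b = e then \<bar>z \<bullet> b\<bar> else 1)))"
      by (rule prod_ennreal) auto
    also have "(\<Prod>b\<in>Basis. (exp (- (z \<bullet> b)\<^sup>2) * (if b = e then \<bar>z \<bullet> b\<bar> else 1)))
      = (\<Prod>b\<in>Basis. exp (- (z \<bullet> b)\<^sup>2)) * \<bar>z \<bullet> e\<bar>"
      using e by (simp add: prod.distrib prod.delta)
    also have "(\<Prod>b\<in>Basis. exp (- (z \<bullet> b)\<^sup>2)) = exp (- (norm z)\<^sup>2)"
      by (simp add: exp_sum[symmetric] sum_negf power2_norm_eq_inner euclidean_inner[of z z])
         (simp add: power2_eq_square)
    finally show "ennreal (exp (- (norm z)\<^sup>2)) * ennreal \<bar>z \<bullet> e\<bar> = 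
      (\<Prod>b\<in>Basis. ennreal (exp (- (z \<bullet> b)\<^sup>2) * (if b = e then \<bar>z \<bullet> b\<bar> else 1)))"
      by (simp add: ennreal_mult)
  qed
  also have "\<dots> = (\<Prod>b\<in>Basis. \<integral>\<^sup>+x. ennreal (exp (- x\<^sup>2) * (if b = e then \<bar>x\<bar> else 1)) \<partial>lborel)"
    by (rule nn_integral_lborel_prod) auto
  also have "\<dots> = (\<Prod>b\<in>(Basis :: (real^3) set). if b = e then 1 else ennreal (sqrt pi))"
  proof (intro prod.cong refl)
    fix b :: "real^3"
    have 0: "has_bochner_integral lborel (\<lambda>x::real. exp (- x\<^sup>2)) (2 *\<^sub>R (sqrt pi / 2))"
      by (rule has_bochner_integral_even_function[OF gaussian_moment_0]) simp
    have "has_bochner_integral lborel (\<lambda>x::real. indicator {0..} x *\<^sub>R (exp (- x\<^sup>2) * \<bar>x\<bar>)) (1 / 2)"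
      by (rule has_bochner_integral_cong[THEN iffD1, OF refl _ refl gaussian_moment_1])
         (auto simp: indicator_def)
    then have 1: "has_bochner_integral lborel (\<lambda>x::real. exp (- x\<^sup>2) * \<bar>x\<bar>) (2 *\<^sub>R (1 / 2))"
      by (rule has_bochner_integral_even_function) simp
    show "(\<integral>\<^sup>+x. ennreal (exp (- x\<^sup>2) * (if b = e then \<bar>x\<bar> else 1)) \<partial>lborel) = (if b = e then 1 else ennreal (sqrt pi))"
      using nn_integral_eq_integral[of lborel "\<lambda>x::real. exp (- x\<^sup>2)"] nn_integral_eq_integral[of lborel "\<lambda>x::real. exp (- x\<^sup>2) * \<bar>x\<bar>"]
        0 1 by (auto simp: has_bochner_integral_iff)
  qed
  also have "\<dots> = ennreal (sqrt pi) ^ card (Basis - {e})"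
    using e by (subst prod.remove[of _ e]) auto
  also have "\<dots> = ennreal pi"
    using e by (simp add: card_Diff_singleton ennreal_power)
  finally show ?thesis .
qed

text \<open>The layer-cake identity is solved for its ball factor: the Gaussian moment on the left
  is pi, and the radial factor, the integral of 2 s^5 exp(- s^2) over s > 0, equals 2.\<close>

lemma nn_integral_ball_abs_inner:
  fixes u :: "real^3"
  assumes u: "norm u = 1"
  shows "(\<integral>\<^sup>+z. ennreal \<bar>z \<bullet> u\<bar> * indicator (ball 0 1) z \<partial>lborel) = ennreal (pi / 2)"
proof -
  let ?I = "\<integral>\<^sup>+z. ennreal \<bar>z \<bullet> u\<bar> * indicator (ball 0 1) z \<partial>lborel"
  \<comment> \<open>Minus the derivative of exp(- s^2), so that its integral over s > |z| is the
    Gaussian weight.\<close>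
  define q :: "real \<Rightarrow> real" where "q s = 2 * s * exp (- s\<^sup>2)" for s
  have [measurable]: "q \<in> borel_measurable borel" unfolding q_def by measurable
  have "ennreal pi = (\<integral>\<^sup>+z. (\<integral>\<^sup>+s. ennreal (q s) * indicator {norm z<..} s \<partial>lborel) * ennreal \<bar>z \<bullet> u\<bar> \<partial>lborel)"
  proof (subst nn_integral_gaussian_abs_inner[OF u, symmetric], intro nn_integral_cong)
    fix z :: "real^3"
    have "(\<integral>\<^sup>+s. ennreal (q s) * indicator {norm z<..} s \<partial>lborel) = ennreal (0 - (- exp (- (norm z)\<^sup>2)))"
    proof (rule nn_integral_FTC_greaterThan)
      show "((\<lambda>x::real. - exp (- x\<^sup>2)) \<longlongrightarrow> 0) at_top" by real_asymp
      fix x assume "norm z \<le> x"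
      then have "0 \<le> x" using norm_ge_zero order_trans by blast
      then show "0 \<le> q x" by (simp add: q_def)
    qed (auto simp: q_def intro!: derivative_eq_intros)
    then show "ennreal (exp (- (norm z)\<^sup>2)) * ennreal \<bar>z \<bullet> u\<bar>
      = (\<integral>\<^sup>+s. ennreal (q s) * indicator {norm z<..} s \<partial>lborel) * ennreal \<bar>z \<bullet> u\<bar>"
      by simp
  qed
  also have "\<dots> = ?I * (\<integral>\<^sup>+s. ennreal (q s) * ennreal (s ^ (1 + DIM(real^3))) * indicator {0<..} s \<partial>lborel)"
    by (rule nn_integral_radial_homogeneous) (auto simp: abs_mult ennreal_mult)
  also have "(\<integral>\<^sup>+s. ennreal (q s) * ennreal (s ^ (1 + DIM(real^3))) * indicator {0<..} s \<partial>lborel)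
    = (\<integral>\<^sup>+s. ennreal (2 * s ^ 5 * exp (- s\<^sup>2)) * indicator {0<..} s \<partial>lborel)"
    by (intro nn_integral_cong) (auto simp: q_def indicator_def power_numeral_reduce mult_ac simp flip: ennreal_mult)
  also have "\<dots> = ennreal (0 - (- (0 ^ 4 + 2 * 0\<^sup>2 + 2) * exp (- 0\<^sup>2)))"
  proof (rule nn_integral_FTC_greaterThan)
    show "((\<lambda>x::real. - (x ^ 4 + 2 * x\<^sup>2 + 2) * exp (- x\<^sup>2)) \<longlongrightarrow> 0) at_top" by real_asymp
    show "DERIV (\<lambda>x::real. - (x ^ 4 + 2 * x\<^sup>2 + 2) * exp (- x\<^sup>2)) x :> 2 * x ^ 5 * exp (- x\<^sup>2)" for x
      by (auto intro!: derivative_eq_intros simp: algebra_simps power_numeral_reduce)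
  qed auto
  finally have *: "?I * ennreal 2 = ennreal pi" by simp
  then have "?I = ennreal pi / ennreal 2"
    using ennreal_mult_divide_eq[of "ennreal 2" ?I] by simp
  then show ?thesis using divide_ennreal[of pi 2] by simp
qed

section \<open>The Yukawa kernel and its moments\<close>

definition yukawa_kernel :: "real \<Rightarrow> real^3 \<Rightarrow> ennreal" where
  "yukawa_kernel \<alpha> z = ennreal (exp (- \<alpha> * norm z) / norm z)"

lemma yukawa_kernel_measurable [measurable]: "yukawa_kernel \<alpha> \<in> borel_measurable borel"
  unfolding yukawa_kernel_def by measurable

lemma nn_integral_yukawa_kernel_homogeneous:
  fixes g :: "real^3 \<Rightarrow> ennreal"
  assumes a: "\<alpha> > 0" and [measurable]: "g \<in> borel_measurable borel"
    and hom: "\<And>s z. s > 0 \<Longrightarrow> g (s *\<^sub>R z) = ennreal (s ^ d) * g z"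
  shows "(\<integral>\<^sup>+z. yukawa_kernel \<alpha> z * g z \<partial>lborel) = (\<integral>\<^sup>+z. g z * indicator (ball 0 1) z \<partial>lborel)
     * (\<integral>\<^sup>+s. ennreal ((\<alpha> * s ^ (d + 2) + s ^ (d + 1)) * exp (- \<alpha> * s)) * indicator {0<..} s \<partial>lborel)"
proof -
  \<comment> \<open>Minus the derivative of exp(- \<alpha> s) / s, so that its integral over s > |z|
    is the kernel at z.\<close>
  define q :: "real \<Rightarrow> real" where "q s = (\<alpha> / s + 1 / s\<^sup>2) * exp (- \<alpha> * s)" for s
  have [measurable]: "q \<in> borel_measurable borel" unfolding q_def by measurable
  have "(\<integral>\<^sup>+z. yukawa_kernel \<alpha> z * g z \<partial>lborel) = 
      (\<integral>\<^sup>+z. (\<integral>\<^sup>+s. ennreal (q s) * indicator {norm z<..} s \<partial>lborel) * g z \<partial>lborel)"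
  proof (rule nn_integral_cong_AE)
    \<comment> \<open>At the origin the integral of \<open>q\<close> diverges while the kernel has
      the value 0, so the identity holds only off this null set.\<close>
    have "AE z in lborel. z \<noteq> (0::real^3)" by (rule AE_lborel_singleton)
    then show "AE z in lborel. yukawa_kernel \<alpha> z * g z = (\<integral>\<^sup>+s. ennreal (q s) * indicator {norm z<..} s \<partial>lborel) * g z"
    proof eventually_elim
      fix z :: "real^3" assume z: "z \<noteq> 0"
      have "(\<integral>\<^sup>+s. ennreal (q s) * indicator {norm z<..} s \<partial>lborel) = ennreal (0 - (- (exp (- \<alpha> * norm z) / norm z)))"
      proof (rule nn_integral_FTC_greaterThan)
        show "((\<lambda>x::real. - (exp (- \<alpha> * x) / x)) \<longlongrightarrow> 0) at_top" using a by real_asymp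
        fix x assume "norm z \<le> x"
        then have x: "0 < x" using z by (meson less_le_trans zero_less_norm_iff)
        then show "0 \<le> q x" using a by (simp add: q_def)
        show "DERIV (\<lambda>x::real. - (exp (- \<alpha> * x) / x)) x :> q x"
          using x by (auto intro!: derivative_eq_intros simp: q_def field_simps power2_eq_square)
      qed auto
      then show "yukawa_kernel \<alpha> z * g z = (\<integral>\<^sup>+s. ennreal (q s) * indicator {norm z<..} s \<partial>lborel) * g z"
        by (simp add: yukawa_kernel_def)
    qed
  qed
  also have "\<dots> = (\<integral>\<^sup>+z. g z * indicator (ball 0 1) z \<partial>lborel)
    * (\<integral>\<^sup>+s. ennreal (q s) * ennreal (s ^ (d + DIM(real^3))) * indicator {0<..} s \<partial>lborel)"
    by (rule nn_integral_radial_homogeneous) (use hom in auto)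
  also have "(\<integral>\<^sup>+s. ennreal (q s) * ennreal (s ^ (d + DIM(real^3))) * indicator {0<..} s \<partial>lborel)
    = (\<integral>\<^sup>+s. ennreal ((\<alpha> * s ^ (d + 2) + s ^ (d + 1)) * exp (- \<alpha> * s)) * indicator {0<..} s \<partial>lborel)"
  proof (intro nn_integral_cong)
    fix s :: real
    have "q s * s ^ (d + 3) = (\<alpha> * s ^ (d + 2) + s ^ (d + 1)) * exp (- \<alpha> * s)" if "s > 0"
      using that by (simp add: q_def field_simps power_add power_numeral_reduce)
    moreover have "q s \<ge> 0" if "s > 0" using that a by (simp add: q_def)
    ultimately show "ennreal (q s) * ennreal (s ^ (d + DIM(real^3))) * indicator {0<..} s
      = ennreal ((\<alpha> * s ^ (d + 2) + s ^ (d + 1)) * exp (- \<alpha> * s)) * indicator {0<..} s"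
      by (auto simp: indicator_def simp flip: ennreal_mult)
  qed
  finally show ?thesis .
qed

text \<open>For d = 1 the radial factor is 8 / \<alpha>^3, and the ball integral contributes pi / 2.
  This is the origin of the threshold: half of the product is below 1 exactly when \<alpha>^3 > 2
  pi.\<close>

lemma nn_integral_yukawa_kernel_abs_inner:
  assumes a: "\<alpha> > 0" and u: "norm u = 1"
  shows "(\<integral>\<^sup>+z. yukawa_kernel \<alpha> z * ennreal \<bar>z \<bullet> u\<bar> \<partial>lborel) = ennreal (4 * pi / \<alpha> ^ 3)"
proof -
  have "(\<integral>\<^sup>+s. ennreal ((\<alpha> * s ^ (1 + 2) + s ^ (1 + 1)) * exp (- \<alpha> * s)) * indicator {0<..} s \<partial>lborel)
     = ennreal (0 - (- (0 ^ 3 + 4 * 0\<^sup>2 / \<alpha> + 8 * 0 / \<alpha>\<^sup>2 + 8 / \<alpha> ^ 3) * exp (- \<alpha> * 0)))"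
  proof (rule nn_integral_FTC_greaterThan)
    show "((\<lambda>s::real. - (s ^ 3 + 4 * s\<^sup>2 / \<alpha> + 8 * s / \<alpha>\<^sup>2 + 8 / \<alpha> ^ 3) * exp (- \<alpha> * s)) \<longlongrightarrow> 0) at_top"
      using a by real_asymp
    show "DERIV (\<lambda>s::real. - (s ^ 3 + 4 * s\<^sup>2 / \<alpha> + 8 * s / \<alpha>\<^sup>2 + 8 / \<alpha> ^ 3) * exp (- \<alpha> * s)) s :>
       (\<alpha> * s ^ (1 + 2) + s ^ (1 + 1)) * exp (- \<alpha> * s)" for s
      using a by (auto intro!: derivative_eq_intros simp: field_simps power_numeral_reduce)
  qed (use a in auto)
  then show ?thesis
    using a by (subst nn_integral_yukawa_kernel_homogeneous[where d=1])
      (auto simp: abs_mult ennreal_mult nn_integral_ball_abs_inner[OF u] simp flip: ennreal_mult)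
qed

text \<open>The case d = 0, with radial factor 3 / \<alpha>^2. Finite kernel mass makes uniformly
  small errors in translation gaps or overlaps small after integration against the kernel.\<close>

lemma nn_integral_yukawa_kernel_finite:
  assumes a: "\<alpha> > 0"
  shows "(\<integral>\<^sup>+z. yukawa_kernel \<alpha> z \<partial>lborel) < \<infinity>"
proof -
  have "(\<integral>\<^sup>+s. ennreal ((\<alpha> * s ^ (0 + 2) + s ^ (0 + 1)) * exp (- \<alpha> * s)) * indicator {0<..} s \<partial>lborel)
     = ennreal (0 - (- (0\<^sup>2 + 3 * 0 / \<alpha> + 3 / \<alpha>\<^sup>2) * exp (- \<alpha> * 0)))"
  proof (rule nn_integral_FTC_greaterThan)
    show "((\<lambda>s::real. - (s\<^sup>2 + 3 * s / \<alpha> + 3 / \<alpha>\<^sup>2) * exp (- \<alpha> * s)) \<longlongrightarrow> 0) at_top"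
      using a by real_asymp
    show "DERIV (\<lambda>s::real. - (s\<^sup>2 + 3 * s / \<alpha> + 3 / \<alpha>\<^sup>2) * exp (- \<alpha> * s)) s :>
       (\<alpha> * s ^ (0 + 2) + s ^ (0 + 1)) * exp (- \<alpha> * s)" for s
      using a by (auto intro!: derivative_eq_intros simp: field_simps power_numeral_reduce)
  qed (use a in auto)
  then show ?thesis
    using nn_integral_yukawa_kernel_homogeneous[OF a, of "\<lambda>_. 1" 0] emeasure_lborel_ball_finite[of "0::real^3" 1]
    by (auto simp: ennreal_mult_less_top)
qed

section \<open>Test fields, perimeter and translations\<close>

lemma integrable_indicator_ball:
  "integrable lborel (indicator (ball x r) :: 'a::euclidean_space \<Rightarrow> real)"
  "integrable lborel (indicator (cball x r) :: 'a::euclidean_space \<Rightarrow> real)"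
  by (auto intro!: integrable_real_indicator emeasure_lborel_ball_finite emeasure_lborel_cball_finite)

text \<open>Divergence integrals may be negative, so \<open>a\<close> has no sign here; truncation
  at 0 can only increase the left summand.\<close>

lemma ennreal_add_le: "0 \<le> c \<Longrightarrow> ennreal (a + c) \<le> ennreal a + ennreal c"
  by (cases "0 \<le> a") (auto simp: ennreal_neg intro: ennreal_leI)

lemma has_derivative_zero_outside:
  assumes f: "(f has_derivative D) (at x)" "\<And>y. norm y > R \<Longrightarrow> f y = 0" and x: "norm x > R"
  shows "D = (\<lambda>_. 0)"
proof -
  have "eventually (\<lambda>y. y \<in> - cball 0 R) (nhds x)"
    by (rule eventually_nhds_in_open) (use x in auto)
  then have "eventually (\<lambda>y. f y = 0) (nhds x)"
    by (rule eventually_mono) (use f in auto)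
  then have "eventually (\<lambda>y. f y = 0) (at x)"
    by (auto simp: eventually_at_filter elim: eventually_mono)
  then have "((\<lambda>_. 0) has_derivative D) (at x)"
    using has_derivative_transform_eventually[OF f(1), of "\<lambda>_. 0"] f(2)[OF x] by simp
  then show ?thesis by (metis has_derivative_const has_derivative_unique)
qed

text \<open>In finite dimension, continuity of \<open>D x h\<close> in x for each fixed h already
  gives continuity of the derivative in operator norm, so the derivatives of test fields can be
  handled as ordinary functions.\<close>

lemma C1_fieldI:
  assumes "\<And>x. (\<phi> has_derivative D x) (at x)" "\<And>h. continuous_on UNIV (\<lambda>x. D x h)"
  shows "C1_field \<phi>"
proof -
  have bl: "bounded_linear (D x)" for x using assms(1) by (rule has_derivative_bounded_linear)
  have "continuous_on UNIV (\<lambda>x. Blinfun (D x))"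
    by (rule continuous_on_blinfun_componentwise) (use assms(2) bl in \<open>simp add: bounded_linear_Blinfun_apply\<close>)
  then show ?thesis unfolding C1_field_def
    using assms(1) bl by (intro exI[of _ "\<lambda>x. Blinfun (D x)"]) (simp add: bounded_linear_Blinfun_apply)
qed

lemma test_fieldsI:
  assumes "\<And>x. (\<phi> has_derivative D x) (at x)" "\<And>h. continuous_on UNIV (\<lambda>x. D x h)"
    and supp: "\<And>x. norm x > R \<Longrightarrow> \<phi> x = 0" and "\<And>x. norm (\<phi> x) \<le> 1"
  shows "\<phi> \<in> test_fields"
proof -
  have "closure {x. \<phi> x \<noteq> 0} \<subseteq> cball 0 R"
    by (rule closure_minimal) (use supp in \<open>auto intro: leI\<close>, metis leI)
  then have "compact (closure {x. \<phi> x \<noteq> 0})"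
    by (meson bounded_cball bounded_subset closed_closure compact_eq_bounded_closed)
  with assms C1_fieldI[of \<phi> D] show ?thesis by (auto simp: test_fields_def)
qed

lemma test_fieldsE:
  assumes "\<phi> \<in> test_fields"
  obtains D R where "\<And>x. (\<phi> has_derivative D x) (at x)" "\<And>h. continuous_on UNIV (\<lambda>x. D x h)"
    and "R > 0" "\<And>x. norm x > R \<Longrightarrow> \<phi> x = 0" "\<And>x. norm (\<phi> x) \<le> 1"
proof -
  from assms obtain \<phi>' where D: "\<And>x. (\<phi> has_derivative blinfun_apply (\<phi>' x)) (at x)" "continuous_on UNIV \<phi>'"
    and c: "compact (closure {x. \<phi> x \<noteq> 0})" and n: "\<And>x. norm (\<phi> x) \<le> 1"
    unfolding test_fields_def C1_field_def by blast
  from c obtain R where "R > 0" "\<And>x. x \<in> closure {x. \<phi> x \<noteq> 0} \<Longrightarrow> norm x \<le> R"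
    by (meson bounded_pos compact_imp_bounded)
  then have "\<phi> x = 0" if "norm x > R" for x
    using that closure_subset[of "{x. \<phi> x \<noteq> 0}"] by force
  moreover have "continuous_on UNIV (\<lambda>x. blinfun_apply (\<phi>' x) h)" for h
    by (intro continuous_intros D)
  ultimately show thesis using that[of "\<lambda>x. blinfun_apply (\<phi>' x)" R] D n \<open>R > 0\<close> by blast
qed

lemma divergence_eq:
  assumes "(\<phi> has_derivative D) (at x)"
  shows "divergence \<phi> x = (\<Sum>i\<in>UNIV. D (axis i 1) $ i)"
  unfolding divergence_def using frechet_derivative_at[OF assms] by simp

lemma test_fields_divergence:
  assumes "\<phi> \<in> test_fields"
  shows divergence_continuous: "continuous_on UNIV (divergence \<phi>)"
    and divergence_bounded: "\<exists>B>0. \<exists>R>0. \<forall>x. \<bar>divergence \<phi> x\<bar> \<le> B \<and> (norm x > R \<longrightarrow> divergence \<phi> x = 0)"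
proof -
  from assms obtain D R where D: "\<And>x. (\<phi> has_derivative D x) (at x)" "\<And>h. continuous_on UNIV (\<lambda>x. D x h)"
    and R: "R > 0" "\<And>x. norm x > R \<Longrightarrow> \<phi> x = 0" "\<And>x. norm (\<phi> x) \<le> 1"
    by (erule test_fieldsE)
  have div: "divergence \<phi> = (\<lambda>x. \<Sum>i\<in>UNIV. D x (axis i 1) $ i)"
    using D(1) divergence_eq by blast
  show c: "continuous_on UNIV (divergence \<phi>)"
    unfolding div by (intro continuous_intros D)
  have z: "divergence \<phi> x = 0" if "norm x > R" for x
    using has_derivative_zero_outside[OF D(1) R(2) that] by (simp add: div)
  have "bounded (divergence \<phi> ` cball 0 R)"
    by (intro compact_imp_bounded compact_continuous_image continuous_on_subset[OF c]) auto
  then obtain B where B: "B > 0" "\<And>x. x \<in> cball 0 R \<Longrightarrow> \<bar>divergence \<phi> x\<bar> \<le> B"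
    unfolding bounded_pos by auto
  have "\<bar>divergence \<phi> x\<bar> \<le> B" for x
    using B z[of x] by (cases "norm x > R") auto
  with B(1) R(1) z show "\<exists>B>0. \<exists>R>0. \<forall>x. \<bar>divergence \<phi> x\<bar> \<le> B \<and> (norm x > R \<longrightarrow> divergence \<phi> x = 0)"
    by (intro exI[of _ B] conjI exI[of _ R] allI impI)
qed

lemma divergence_measurable: "\<phi> \<in> test_fields \<Longrightarrow> divergence \<phi> \<in> borel_measurable borel"
  by (intro borel_measurable_continuous_onI divergence_continuous)

lemma divergence_integrable:
  assumes "\<phi> \<in> test_fields"
  shows "integrable lborel (divergence \<phi>)"
proof -
  obtain B R where BR: "\<forall>x. \<bar>divergence \<phi> x\<bar> \<le> B \<and> (norm x > R \<longrightarrow> divergence \<phi> x = 0)" "B > 0"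
    using divergence_bounded[OF assms] by auto
  have "integrable lborel (\<lambda>x. B * indicator (cball 0 R) x :: real)"
    by (intro integrable_mult_right integrable_indicator_ball)
  then show ?thesis
    by (rule Bochner_Integration.integrable_bound)
       (use divergence_measurable[OF assms] BR in \<open>auto simp: indicator_def not_le\<close>)
qed

lemma perimeter_eq:
  assumes [measurable]: "E \<in> sets borel"
  shows "perimeter E = (SUP \<phi>\<in>test_fields. ennreal (LINT x:E|lborel. divergence \<phi> x))"
  unfolding perimeter_def set_lebesgue_integral_def
  by (intro SUP_cong refl arg_cong[where f=ennreal] integral_completion)
     (use divergence_measurable in measurable)

lemma perimeter_ge:
  assumes "E \<in> sets borel" "\<phi> \<in> test_fields"
  shows "ennreal (LINT x:E|lborel. divergence \<phi> x) \<le> perimeter E"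
  unfolding perimeter_eq[OF assms(1)] by (rule SUP_upper[OF assms(2)])

lemma perimeter_le:
  assumes "E \<in> sets borel" "\<And>\<phi>. \<phi> \<in> test_fields \<Longrightarrow> ennreal (LINT x:E|lborel. divergence \<phi> x) \<le> c"
  shows "perimeter E \<le> c"
  unfolding perimeter_eq[OF assms(1)] by (rule SUP_least[OF assms(2)])

section \<open>Measure of a set outside its translate\<close>

definition translation_gap :: "'a::euclidean_space set \<Rightarrow> 'a \<Rightarrow> ennreal" where
  "translation_gap E h = emeasure lborel {x \<in> E. x - h \<notin> E}"

lemma emeasure_lborel_translate:
  fixes E :: "'a::euclidean_space set"
  assumes [measurable]: "E \<in> sets borel"
  shows "emeasure lborel {x. x - h \<in> E} = emeasure lborel E"
proof -
  have "emeasure lborel {x. x - h \<in> E} = (\<integral>\<^sup>+x. indicator {x. x - h \<in> E} x \<partial>lborel)"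
    by simp
  also have "\<dots> = (\<integral>\<^sup>+x. indicator E (x - h) \<partial>lborel)"
    by (intro nn_integral_cong) (simp add: indicator_def)
  finally show ?thesis by (subst (asm) nn_integral_lborel_translate[where f="indicator E"]) auto
qed

lemma translation_gap_eq_nn_integral:
  assumes [measurable]: "E \<in> sets borel"
  shows "translation_gap E h = (\<integral>\<^sup>+x. indicator E x * indicator (- E) (x - h) \<partial>lborel)"
proof -
  have [measurable]: "{x \<in> E. x - h \<notin> E} \<in> sets borel" by measurable
  have "translation_gap E h = (\<integral>\<^sup>+x. indicator {x \<in> E. x - h \<notin> E} x \<partial>lborel)"
    by (simp add: translation_gap_def)
  also have "\<dots> = (\<integral>\<^sup>+x. indicator E x * indicator (- E) (x - h) \<partial>lborel)"
    by (intro nn_integral_cong) (simp add: indicator_def)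
  finally show ?thesis .
qed

lemma translation_gap_measurable [measurable]:
  assumes [measurable]: "E \<in> sets borel"
  shows "translation_gap E \<in> borel_measurable borel"
  unfolding translation_gap_eq_nn_integral[OF assms, abs_def] by measurable

text \<open>E and E + h have the same finite measure; cancelling their intersection leaves equal
  remainders.\<close>

lemma translation_gap_uminus:
  fixes E :: "'a::euclidean_space set"
  assumes [measurable]: "E \<in> sets borel" and fin: "emeasure lborel E < \<infinity>"
  shows "emeasure lborel {x. x \<notin> E \<and> x - h \<in> E} = translation_gap E h"
proof -
  have [measurable]: "{x. x - h \<in> E} \<in> sets borel" "{x \<in> E. x - h \<in> E} \<in> sets borel" by measurable
  have "emeasure lborel {x. x - h \<in> E} = emeasure lborel {x \<in> E. x - h \<in> E} + emeasure lborel {x. x \<notin> E \<and> x - h \<in> E}"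
    by (subst plus_emeasure) (auto intro!: arg_cong[where f="emeasure lborel"])
  moreover have "emeasure lborel E = emeasure lborel {x \<in> E. x - h \<in> E} + translation_gap E h"
    unfolding translation_gap_def
    by (subst plus_emeasure) (auto intro!: arg_cong[where f="emeasure lborel"])
  ultimately have "emeasure lborel {x \<in> E. x - h \<in> E} + emeasure lborel {x. x \<notin> E \<and> x - h \<in> E}
      = emeasure lborel {x \<in> E. x - h \<in> E} + translation_gap E h"
    by (metis emeasure_lborel_translate[OF assms(1)])
  moreover have "emeasure lborel {x \<in> E. x - h \<in> E} < \<infinity>"
    using fin by (rule le_less_trans[rotated]) (auto intro!: emeasure_mono)
  ultimately show ?thesis by (auto simp: ennreal_add_left_cancel)
qed

lemma nn_integral_translation_difference:
  fixes E :: "'a::euclidean_space set"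
  assumes [measurable]: "E \<in> sets borel" and fin: "emeasure lborel E < \<infinity>"
  shows "(\<integral>\<^sup>+x. ennreal \<bar>indicator E x - indicator E (x - h)\<bar> \<partial>lborel) = 2 * translation_gap E h"
proof -
  have [measurable]: "{x \<in> E. x - h \<notin> E} \<in> sets borel" "{x. x \<notin> E \<and> x - h \<in> E} \<in> sets borel" by measurable
  have "(\<integral>\<^sup>+x. ennreal \<bar>indicator E x - indicator E (x - h)\<bar> \<partial>lborel)
    = (\<integral>\<^sup>+x. indicator {x \<in> E. x - h \<notin> E} x + indicator {x. x \<notin> E \<and> x - h \<in> E} x \<partial>lborel)"
    by (intro nn_integral_cong) (auto simp: indicator_def)
  also have "\<dots> = translation_gap E h + emeasure lborel {x. x \<notin> E \<and> x - h \<in> E}"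
    by (subst nn_integral_add) (auto simp: translation_gap_def)
  finally show ?thesis by (simp add: translation_gap_uminus[OF assms] mult_2)
qed

text \<open>Continuity of translations in L1. With K compact, U open, K \<subseteq> E \<subseteq> U
  and |U - K| \<le> \<eta>, a shift h shorter than the distance from K to the complement of U keeps
  K + h inside U. Then E minus (E + h) lies in U minus (K + h), whose measure is |U| - |K|.\<close>

lemma translation_gap_tendsto_0:
  fixes E :: "'a::euclidean_space set"
  assumes E[measurable]: "E \<in> sets borel" and fin: "emeasure lborel E < \<infinity>" and \<eta>: "\<eta> > 0"
  shows "\<exists>d>0. \<forall>h. norm h < d \<longrightarrow> translation_gap E h \<le> ennreal \<eta>"
proof -
  have L: "E \<in> sets lebesgue" using E by simp
  have \<eta>3: "\<eta> / 3 > 0" using \<eta> by simp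
  obtain C where C: "closed C" "C \<subseteq> E" "emeasure lebesgue (E - C) < ennreal (\<eta> / 3)"
    by (rule sets_lebesgue_inner_closed[OF L \<eta>3])
  obtain U where U: "open U" "E \<subseteq> U" "emeasure lebesgue (U - E) < ennreal (\<eta> / 3)"
    by (rule sets_lebesgue_outer_open[OF L \<eta>3])
  have [measurable]: "C \<in> sets borel" "U \<in> sets borel" using C U by auto
  \<comment> \<open>The inner approximation is only closed; cutting it with large balls makes it
    compact at the price of another \<eta> / 3.\<close>
  define K where "K n = C \<inter> cball 0 (real n)" for n
  have K[measurable]: "K n \<in> sets borel" for n unfolding K_def by measurable
  have "(\<lambda>n. emeasure lborel (C - K n)) \<longlonglongrightarrow> emeasure lborel (\<Inter>n. C - K n)"
  proof (rule Lim_emeasure_decseq)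
    show "decseq (\<lambda>n. C - K n)" by (force simp: decseq_def K_def)
    show "emeasure lborel (C - K i) \<noteq> \<infinity>" for i
    proof -
      have "emeasure lborel (C - K i) \<le> emeasure lborel E" using C by (intro emeasure_mono) auto
      then show ?thesis using fin by (auto simp: top_unique)
    qed
  qed auto
  also have "(\<Inter>n. C - K n) = {}"
    using real_arch_simple by (force simp: K_def)
  finally have "(\<lambda>n. emeasure lborel (C - K n)) \<longlonglongrightarrow> 0" by simp
  then have "eventually (\<lambda>n. emeasure lborel (C - K n) < ennreal (\<eta> / 3)) sequentially"
    by (rule order_tendstoD) (use \<eta> in auto)
  then obtain n where n: "emeasure lborel (C - K n) < ennreal (\<eta> / 3)"
    by (meson eventually_sequentially order_refl)
  have "compact (K n)" unfolding K_def using C by (simp add: compact_Int_closed closed_Int_compact)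
  moreover have "K n \<inter> - U = {}" using C U by (auto simp: K_def)
  ultimately obtain d where d: "d > 0" "\<And>x y. x \<in> K n \<Longrightarrow> y \<in> - U \<Longrightarrow> d \<le> dist x y"
    using separate_compact_closed[of "K n" "- U"] U by (metis closed_Compl)
  have sub: "translation_gap E h \<le> ennreal \<eta>" if h: "norm h < d" for h
  proof -
    let ?S = "{x \<in> U. x - h \<notin> K n}" and ?T = "{x. x - h \<in> K n}"
    have [measurable]: "?S \<in> sets borel" "?T \<in> sets borel" by measurable
    have "?T \<subseteq> U"
    proof
      fix x assume "x \<in> ?T"
      then show "x \<in> U" using d(2)[of "x - h" x] h by (auto simp: dist_norm)
    qed
    then have "emeasure lborel U = emeasure lborel ?S + emeasure lborel ?T"
      by (subst plus_emeasure) (auto intro!: arg_cong[where f="emeasure lborel"])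
    moreover have "emeasure lborel ?T = emeasure lborel (K n)" by (rule emeasure_lborel_translate) simp
    moreover have "emeasure lborel U = emeasure lborel (U - E) + (emeasure lborel (E - C) + (emeasure lborel (C - K n) + emeasure lborel (K n)))"
    proof -
      have "emeasure lborel (C - K n) + emeasure lborel (K n) = emeasure lborel C"
        by (subst plus_emeasure) (auto simp: K_def intro: arg_cong[where f="emeasure lborel"])
      moreover have "emeasure lborel (E - C) + emeasure lborel C = emeasure lborel E"
        using C(2) by (subst plus_emeasure) (auto simp: Un_absorb2)
      moreover have "emeasure lborel (U - E) + emeasure lborel E = emeasure lborel U"
        using U(2) by (subst plus_emeasure) (auto simp: Un_absorb2)
      ultimately show ?thesis by simp
    qed
    moreover have "emeasure lborel (K n) < \<infinity>"
    proof -
      have "emeasure lborel (K n) \<le> emeasure lborel E" using C by (intro emeasure_mono) (auto simp: K_def)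
      then show ?thesis using fin by simp
    qed
    ultimately have "emeasure lborel ?S = emeasure lborel (U - E) + (emeasure lborel (E - C) + emeasure lborel (C - K n))"
      by (auto simp: ennreal_add_left_cancel add_ac)
    also have "\<dots> \<le> ennreal (\<eta> / 3) + (ennreal (\<eta> / 3) + ennreal (\<eta> / 3))"
      using U C n by (intro add_mono) auto
    also have "\<dots> = ennreal \<eta>" using \<eta> by (simp flip: ennreal_plus)
    finally have "emeasure lborel ?S \<le> ennreal \<eta>" .
    moreover have "translation_gap E h \<le> emeasure lborel ?S"
      unfolding translation_gap_def using C U by (intro emeasure_mono) (auto simp: K_def)
    ultimately show ?thesis by simp
  qed
  with d show ?thesis by blast
qed

section \<open>Mollification\<close>

text \<open>Derivatives are read off from quadratic remainder bounds, which survive integration;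
  this serves both the squared positive part and convolutions.\<close>

lemma has_derivative_quadratic:
  fixes f :: "'a::real_normed_vector \<Rightarrow> 'b::real_normed_vector"
  assumes bl: "bounded_linear D" and q: "\<And>h. norm (f (x + h) - f x - D h) \<le> K * (norm h)\<^sup>2"
  shows "(f has_derivative D) (at x)"
proof (rule has_derivativeI_sandwich[of 1])
  show "norm ((f y - f x) - D (y - x)) / norm (y - x) \<le> K * norm (y - x)" if "y \<in> UNIV" "y \<noteq> x" for y
    using q[of "y - x"] that by (simp add: divide_le_eq power2_eq_square mult.assoc)
  show "((\<lambda>y. K * norm (y - x)) \<longlongrightarrow> 0) (at x)"
    by (rule tendsto_eq_intros refl)+ simp
qed (use bl in auto)

text \<open>The building block of the mollifier and of the cutoff. Test fields are C^1, so this
  function can replace the usual exponential bump. When \<open>a\<close> and \<open>a + h\<close>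
  have opposite signs, |a| and |a + h| are both at most |h|, which bounds the remainder by
  h^2.\<close>

lemma DERIV_pos_part_square: "DERIV (\<lambda>a::real. (max 0 a)\<^sup>2) a :> 2 * max 0 a"
proof -
  have "\<bar>(max 0 (a + h))\<^sup>2 - (max 0 a)\<^sup>2 - 2 * max 0 a * h\<bar> \<le> 1 * \<bar>h\<bar>\<^sup>2" for h
  proof -
    consider "a \<ge> 0" "a + h \<ge> 0" | "a \<ge> 0" "a + h < 0" | "a < 0" "a + h \<ge> 0" | "a < 0" "a + h < 0" by linarith
    then show ?thesis
    proof cases
      case 2
      then have "(max 0 (a + h))\<^sup>2 - (max 0 a)\<^sup>2 - 2 * max 0 a * h = a * (- a - 2 * h)" 
        by (simp add: power2_eq_square algebra_simps)
      moreover have "\<bar>a * (- a - 2 * h)\<bar> \<le> h\<^sup>2"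
      proof -
        have "0 \<le> (a + h)\<^sup>2" by simp
        moreover have "0 \<le> a * (- a - 2 * h)" using 2 by (intro mult_nonneg_nonneg) auto
        ultimately show ?thesis by (simp add: power2_eq_square algebra_simps)
      qed
      ultimately show ?thesis by simp
    next
      case 3
      then have "(a + h)\<^sup>2 \<le> h\<^sup>2" by (intro power_mono) auto
      with 3 show ?thesis by simp
    qed (auto simp: power2_eq_square algebra_simps)
  qed
  then have "((\<lambda>a::real. (max 0 a)\<^sup>2) has_derivative (*) (2 * max 0 a)) (at a)"
    by (intro has_derivative_quadratic[where K=1]) (auto intro: bounded_linear_mult_right)
  then show ?thesis by (simp add: has_field_derivative_def)
qed

text \<open>\<open>G\<close> is the gradient of \<open>\<rho>\<close>. Its Lipschitz bound makes the
  Taylor remainder of \<open>\<rho>\<close> uniformly quadratic; its oddness is the trace of an even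
  \<open>\<rho>\<close> and lets a convolution be moved from the field onto the set.\<close>

definition mollifier :: "real \<Rightarrow> (real^3 \<Rightarrow> real) \<Rightarrow> (real^3 \<Rightarrow> real^3) \<Rightarrow> bool" where
  "mollifier \<epsilon> \<rho> G \<longleftrightarrow> (\<forall>w. \<rho> w \<ge> 0) \<and> (\<forall>w. G (- w) = - G w)
    \<and> (\<forall>w. (\<rho> has_derivative (\<lambda>h. G w \<bullet> h)) (at w)) \<and> (\<exists>L>0. \<forall>v w. norm (G v - G w) \<le> L * norm (v - w))
    \<and> (\<exists>B>0. \<forall>w. \<rho> w \<le> B \<and> norm (G w) \<le> B)
    \<and> (\<forall>w. norm w \<ge> \<epsilon> \<longrightarrow> \<rho> w = 0) \<and> (\<integral>\<^sup>+w. ennreal (\<rho> w) \<partial>lborel) = 1"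

text \<open>The bump is the square of the positive part of \<epsilon>^2 - |w|^2, divided by its
  integral. Its gradient before normalization is -4 \<open>c w\<close> times w, which is Lipschitz
  because \<open>c\<close> is Lipschitz and vanishes outside the ball.\<close>

lemma mollifier_exists:
  assumes e: "\<epsilon> > 0"
  shows "\<exists>\<rho> G. mollifier \<epsilon> \<rho> G"
proof -
  define c :: "real^3 \<Rightarrow> real" where "c w = max 0 (\<epsilon>\<^sup>2 - w \<bullet> w)" for w
  define b where "b w = (c w)\<^sup>2" for w
  define H where "H w = (- 4 * c w) *\<^sub>R w" for w
  \<comment> \<open>Written with min \<epsilon> |w|, \<open>c\<close> is visibly a difference of
    squares of a bounded 1-Lipschitz function.\<close>
  have c_eq: "c w = \<epsilon>\<^sup>2 - (min \<epsilon> (norm w))\<^sup>2" for w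
  proof (cases "norm w \<le> \<epsilon>")
    case True
    then have "(norm w)\<^sup>2 \<le> \<epsilon>\<^sup>2" by (intro power_mono) auto
    with True show ?thesis by (simp add: c_def power2_norm_eq_inner)
  next
    case False
    then have "\<epsilon>\<^sup>2 \<le> (norm w)\<^sup>2" using e by (intro power_mono) auto
    with False show ?thesis by (simp add: c_def power2_norm_eq_inner)
  qed
  have c0: "0 \<le> c w" "c w \<le> \<epsilon>\<^sup>2" for w by (auto simp: c_def)
  have c_out: "c w = 0" if "norm w \<ge> \<epsilon>" for w using that by (simp add: c_eq)
  have c_lip: "\<bar>c v - c w\<bar> \<le> 2 * \<epsilon> * norm (v - w)" for v w
  proof -
    let ?m = "\<lambda>w. min \<epsilon> (norm w)"
    have "c v - c w = (?m w + ?m v) * (?m w - ?m v)" by (simp add: c_eq power2_eq_square algebra_simps)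
    then have "\<bar>c v - c w\<bar> = \<bar>?m w + ?m v\<bar> * \<bar>?m w - ?m v\<bar>" by (simp add: abs_mult)
    also have "\<dots> \<le> (2 * \<epsilon>) * norm (v - w)"
    proof (rule mult_mono)
      show "\<bar>?m w + ?m v\<bar> \<le> 2 * \<epsilon>" using e norm_ge_zero[of w] norm_ge_zero[of v] by linarith
      show "\<bar>?m w - ?m v\<bar> \<le> norm (v - w)" using norm_triangle_ineq3[of v w] by linarith
    qed (use e in auto)
    finally show ?thesis .
  qed
  have cw: "norm (c w *\<^sub>R w) \<le> \<epsilon> ^ 3" for w
  proof (cases "norm w \<ge> \<epsilon>")
    case False
    then have "c w * norm w \<le> \<epsilon>\<^sup>2 * \<epsilon>" using c0 e by (intro mult_mono) auto
    then show ?thesis using c0[of w] by (simp add: power_numeral_reduce)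
  qed (use c_out e in auto)
  \<comment> \<open>The product estimate needs |w| \<le> \<epsilon> for one of the two points only;
    by symmetry the remaining case is that of two points outside, where both products
    vanish.\<close>
  have cw_lip': "norm (c v *\<^sub>R v - c w *\<^sub>R w) \<le> 3 * \<epsilon>\<^sup>2 * norm (v - w)" if w: "norm w \<le> \<epsilon>" for v w
  proof -
    have "c v *\<^sub>R v - c w *\<^sub>R w = c v *\<^sub>R (v - w) + (c v - c w) *\<^sub>R w" by (simp add: algebra_simps)
    then have "norm (c v *\<^sub>R v - c w *\<^sub>R w) \<le> c v * norm (v - w) + \<bar>c v - c w\<bar> * norm w"
      using norm_triangle_ineq[of "c v *\<^sub>R (v - w)" "(c v - c w) *\<^sub>R w"] c0[of v] by simp
    also have "\<dots> \<le> \<epsilon>\<^sup>2 * norm (v - w) + (2 * \<epsilon> * norm (v - w)) * \<epsilon>"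
      using c0 c_lip w e by (intro add_mono mult_mono) auto
    finally show ?thesis by (simp add: power2_eq_square algebra_simps)
  qed
  have cw_lip: "norm (c v *\<^sub>R v - c w *\<^sub>R w) \<le> 3 * \<epsilon>\<^sup>2 * norm (v - w)" for v w
  proof (cases "norm w \<le> \<epsilon>")
    case False
    show ?thesis
    proof (cases "norm v \<le> \<epsilon>")
      case True
      then show ?thesis using cw_lip'[of v w] by (simp add: norm_minus_commute)
    qed (use False e in \<open>simp add: c_out\<close>)
  qed (use cw_lip' in auto)
  have H_lip: "norm (H v - H w) \<le> 12 * \<epsilon>\<^sup>2 * norm (v - w)" for v w
  proof -
    have "H v - H w = (- 4) *\<^sub>R (c v *\<^sub>R v - c w *\<^sub>R w)" by (simp add: H_def algebra_simps)
    then have "norm (H v - H w) = 4 * norm (c v *\<^sub>R v - c w *\<^sub>R w)" by (metis norm_scaleR abs_minus_cancel abs_numeral)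
    then show ?thesis using cw_lip[of v w] by (simp add: mult_ac)
  qed
  have H_bd: "norm (H w) \<le> 4 * \<epsilon> ^ 3" for w
    using cw[of w] c0[of w] by (simp add: H_def)
  have b_bd: "b w \<le> \<epsilon> ^ 4" for w
    using power_mono[OF c0(2) c0(1), of w 2] by (simp add: b_def flip: power_mult)
  have b_der: "(b has_derivative (\<lambda>h. H w \<bullet> h)) (at w)" for w
  proof -
    have "((\<lambda>w. \<epsilon>\<^sup>2 - w \<bullet> w) has_derivative (\<lambda>h. - (2 * (w \<bullet> h)))) (at w)"
      by (auto intro!: derivative_eq_intros simp: inner_commute)
    from has_derivative_compose[OF this DERIV_pos_part_square[THEN has_field_derivative_imp_has_derivative]]
    have "(b has_derivative (\<lambda>x. 2 * max 0 (\<epsilon>\<^sup>2 - w \<bullet> w) * - (2 * (w \<bullet> x)))) (at w)"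
      unfolding b_def c_def .
    then show ?thesis by (rule has_derivative_eq_rhs) (simp add: H_def c_def fun_eq_iff)
  qed
  have b_cont: "continuous_on UNIV b"
    using b_der by (meson continuous_at_imp_continuous_on has_derivative_continuous)
  then have [measurable]: "b \<in> borel_measurable borel" by (rule borel_measurable_continuous_onI)
  define I where "I = (\<integral>\<^sup>+w. ennreal (b w) \<partial>lborel)"
  have "I \<le> (\<integral>\<^sup>+w. ennreal (\<epsilon> ^ 4) * indicator (ball (0::real^3) \<epsilon>) w \<partial>lborel)"
    unfolding I_def using b_bd c_out by (intro nn_integral_mono) (auto simp: indicator_def b_def not_less ennreal_leI)
  also have "\<dots> < \<infinity>" using emeasure_lborel_ball_finite[of "0::real^3" \<epsilon>] 
    by (subst nn_integral_cmult_indicator) (auto simp: ennreal_mult_less_top)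
  finally have I_fin: "I < \<infinity>" .
  \<comment> \<open>The bump is positive on the open ball, which has positive volume.\<close>
  have "I \<noteq> 0"
  proof
    assume "I = 0"
    then have "AE w in lborel. b w \<le> 0" unfolding I_def by (subst (asm) nn_integral_0_iff_AE) (auto simp: ennreal_eq_0_iff)
    then have "AE w in lborel. w \<notin> ball (0::real^3) \<epsilon>"
    proof eventually_elim
      case (elim w)
      then have "c w = 0" using c0[of w] by (simp add: b_def)
      show ?case
      proof
        assume "w \<in> ball 0 \<epsilon>"
        then have "(norm w)\<^sup>2 < \<epsilon>\<^sup>2" by (intro power_strict_mono) auto
        then show False using \<open>c w = 0\<close> by (simp add: c_def power2_norm_eq_inner)
      qed
    qed
    then have "emeasure lborel (ball (0::real^3) \<epsilon>) = 0"
      by (subst (asm) AE_iff_measurable[of "ball 0 \<epsilon>"]) auto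
    then show False using e unit_ball_vol_pos[of 3] by (simp add: emeasure_ball)
  qed
  then obtain a where a: "a > 0" "I = ennreal a"
    using I_fin by (metis ennreal_cases ennreal_0 infinity_ennreal_def less_irrefl order_le_less)
  have "mollifier \<epsilon> (\<lambda>w. b w / a) (\<lambda>w. H w /\<^sub>R a)"
    unfolding mollifier_def
  proof (intro conjI allI impI)
    show "\<exists>L>0. \<forall>v w. norm (H v /\<^sub>R a - H w /\<^sub>R a) \<le> L * norm (v - w)"
    proof (intro exI[of _ "12 * \<epsilon>\<^sup>2 / a"] conjI allI)
      fix v w
      have "norm (H v /\<^sub>R a - H w /\<^sub>R a) = norm (H v - H w) / a"
        using a by (simp add: divide_inverse_commute flip: scaleR_diff_right)
      then show "norm (H v /\<^sub>R a - H w /\<^sub>R a) \<le> 12 * \<epsilon>\<^sup>2 / a * norm (v - w)"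
        using H_lip[of v w] a by (simp add: divide_right_mono)
    qed (use e a in auto)
    have "b w / a \<le> (\<epsilon> ^ 4 + 4 * \<epsilon> ^ 3) / a" "norm (H w /\<^sub>R a) \<le> (\<epsilon> ^ 4 + 4 * \<epsilon> ^ 3) / a" for w
      using b_bd[of w] H_bd[of w] a e by (auto simp: divide_right_mono divide_inverse_commute[symmetric] add_increasing add_increasing2)
    moreover have "(\<epsilon> ^ 4 + 4 * \<epsilon> ^ 3) / a > 0" using a e by (intro divide_pos_pos add_pos_pos) auto
    ultimately show "\<exists>B>0. \<forall>w. b w / a \<le> B \<and> norm (H w /\<^sub>R a) \<le> B" by blast
    show "((\<lambda>w. b w / a) has_derivative (\<lambda>h. (H w /\<^sub>R a) \<bullet> h)) (at w)" for w
      using has_derivative_mult_left[OF b_der[of w], of "inverse a"] by (simp add: divide_inverse mult.commute)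
    have "(\<integral>\<^sup>+w. ennreal (b w / a) \<partial>lborel) = (\<integral>\<^sup>+w. ennreal (1 / a) * ennreal (b w) \<partial>lborel)"
      using a by (intro nn_integral_cong) (simp add: b_def flip: ennreal_mult)
    also have "\<dots> = ennreal (1 / a) * I" unfolding I_def by (rule nn_integral_cmult) simp
    finally show "(\<integral>\<^sup>+w. ennreal (b w / a) \<partial>lborel) = 1" using a by (simp flip: ennreal_mult)
  qed (use a c_out in \<open>auto simp: b_def H_def c_def\<close>)
  then show ?thesis by blast
qed

lemma mollifierD:
  assumes "mollifier \<epsilon> \<rho> G"
  shows mollifier_nonneg: "\<rho> w \<ge> 0" and mollifier_grad_odd: "G (- w) = - G w"
    and mollifier_deriv: "(\<rho> has_derivative (\<lambda>h. G w \<bullet> h)) (at w)"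
    and mollifier_support: "norm w \<ge> \<epsilon> \<Longrightarrow> \<rho> w = 0"
    and mollifier_mass: "(\<integral>\<^sup>+w. ennreal (\<rho> w) \<partial>lborel) = 1"
  using assms by (auto simp: mollifier_def)

lemma mollifier_lipschitz:
  assumes "mollifier \<epsilon> \<rho> G"
  obtains L where "L > 0" "\<And>v w. norm (G v - G w) \<le> L * norm (v - w)"
  using assms unfolding mollifier_def by blast

lemma mollifier_bounded:
  assumes "mollifier \<epsilon> \<rho> G"
  obtains B where "B > 0" "\<And>w. \<rho> w \<le> B" "\<And>w. norm (G w) \<le> B"
  using assms unfolding mollifier_def by blast

lemma mollifier_measurable [measurable_dest]:
  assumes "mollifier \<epsilon> \<rho> G"
  shows "\<rho> \<in> borel_measurable borel" "G \<in> borel_measurable borel"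
proof -
  show "\<rho> \<in> borel_measurable borel"
    by (intro borel_measurable_continuous_onI continuous_at_imp_continuous_on ballI has_derivative_continuous)
       (rule mollifier_deriv[OF assms])
  obtain L where L: "L > 0" "\<And>v w. norm (G v - G w) \<le> L * norm (v - w)"
    by (rule mollifier_lipschitz[OF assms]) blast
  then have "L-lipschitz_on UNIV G" by (auto simp: lipschitz_on_def dist_norm)
  then show "G \<in> borel_measurable borel"
    by (intro borel_measurable_continuous_onI lipschitz_on_continuous_on)
qed

lemma mollifier_taylor:
  fixes \<rho> :: "real^3 \<Rightarrow> real"
  assumes d: "\<And>w. (\<rho> has_derivative (\<lambda>h. G w \<bullet> h)) (at w)" 
    and L: "\<And>v w. norm (G v - G w) \<le> L * norm (v - w)" and L0: "L \<ge> 0"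
  shows "\<bar>\<rho> (w + h) - \<rho> w - G w \<bullet> h\<bar> \<le> L * (norm h)\<^sup>2"
proof -
  define f where "f t = \<rho> (w + t *\<^sub>R h)" for t
  have f: "(f has_derivative (\<lambda>t. G (w + s *\<^sub>R h) \<bullet> (t *\<^sub>R h))) (at s)" for s
    unfolding f_def
    by (rule has_derivative_compose[of "\<lambda>t. w + t *\<^sub>R h" "\<lambda>t. t *\<^sub>R h", OF _ d])
       (auto intro!: derivative_eq_intros)
  have "\<exists>s\<in>{0<..<1}. f 1 - f 0 = (\<lambda>t. G (w + s *\<^sub>R h) \<bullet> (t *\<^sub>R h)) (1 - 0)"
    by (rule mvt_simple) (use f in \<open>auto intro: has_derivative_at_withinI\<close>)
  then obtain s where s: "0 < s" "s < 1" "f 1 - f 0 = G (w + s *\<^sub>R h) \<bullet> h" by auto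
  have "\<rho> (w + h) - \<rho> w - G w \<bullet> h = (G (w + s *\<^sub>R h) - G w) \<bullet> h"
    using s by (simp add: f_def inner_diff_left)
  also have "\<bar>\<dots>\<bar> \<le> norm (G (w + s *\<^sub>R h) - G w) * norm h" by (rule Cauchy_Schwarz_ineq2)
  also have "\<dots> \<le> (L * norm (s *\<^sub>R h)) * norm h"
    using L[of "w + s *\<^sub>R h" w] by (intro mult_right_mono) auto
  also have "\<dots> \<le> (L * norm h) * norm h"
    using s L0 by (intro mult_right_mono mult_left_mono) (auto simp: mult_left_le_one_le)
  finally show ?thesis by (simp add: power2_eq_square mult.assoc)
qed

lemma integrable_bounded_scaleR:
  fixes f :: "'a::euclidean_space \<Rightarrow> 'b::euclidean_space" and k :: "'a \<Rightarrow> real"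
  assumes [measurable]: "k \<in> borel_measurable borel" and f: "integrable lborel f" and B: "\<And>x. \<bar>k x\<bar> \<le> B"
  shows "integrable lborel (\<lambda>x. k x *\<^sub>R f x)"
proof (rule Bochner_Integration.integrable_bound)
  show "integrable lborel (\<lambda>x. B * norm (f x))" using f by auto
  have "B \<ge> 0" using B[of undefined] by linarith
  then show "AE x in lborel. norm (k x *\<^sub>R f x) \<le> norm (B * norm (f x))"
    using B by (auto intro!: mult_right_mono simp: abs_mult)
  show "(\<lambda>x. k x *\<^sub>R f x) \<in> borel_measurable lborel" using f by measurable
qed

text \<open>Integrating the quadratic Taylor remainder of \<open>\<rho>\<close> against f bounds the
  remainder of the convolution by L times the L1 norm of f times |h|^2, so the derivative passes
  under the integral without a limit theorem. The function f is vector-valued when test fields are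
  built and scalar when a set is smoothed.\<close>

lemma mollify_has_derivative:
  fixes f :: "real^3 \<Rightarrow> 'b::euclidean_space"
  assumes m: "mollifier \<epsilon> \<rho> G" and f: "integrable lborel f"
  defines "D \<equiv> \<lambda>y h. \<integral>x. (G (y - x) \<bullet> h) *\<^sub>R f x \<partial>lborel"
  shows "((\<lambda>y. \<integral>x. \<rho> (y - x) *\<^sub>R f x \<partial>lborel) has_derivative D y) (at y)"
    and "continuous_on UNIV (\<lambda>y. D y h)"
proof -
  note [measurable] = mollifier_measurable[OF m]
  obtain L where L: "L > 0" "\<And>v w. norm (G v - G w) \<le> L * norm (v - w)"
    by (rule mollifier_lipschitz[OF m]) blast
  obtain B where B: "B > 0" "\<And>w. \<rho> w \<le> B" "\<And>w. norm (G w) \<le> B"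
    by (rule mollifier_bounded[OF m]) blast
  define N where "N = (\<integral>x. norm (f x) \<partial>lborel)"
  have i1: "integrable lborel (\<lambda>x. \<rho> (y - x) *\<^sub>R f x)" for y
    using B mollifier_nonneg[OF m] by (intro integrable_bounded_scaleR[OF _ f, of _ B]) auto
  have Gh: "\<bar>G w \<bullet> h\<bar> \<le> B * norm h" for w h
    using Cauchy_Schwarz_ineq2[of "G w" h] mult_right_mono[OF B(3)[of w] norm_ge_zero[of h]] by linarith
  have i2: "integrable lborel (\<lambda>x. (G (y - x) \<bullet> h) *\<^sub>R f x)" for y h
    using Gh by (intro integrable_bounded_scaleR[OF _ f]) auto
  have D_lip: "norm (D y h - D z h) \<le> L * norm h * N * norm (y - z)" for y z h
  proof -
    have "D y h - D z h = (\<integral>x. ((G (y - x) - G (z - x)) \<bullet> h) *\<^sub>R f x \<partial>lborel)"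
      unfolding D_def by (subst Bochner_Integration.integral_diff[symmetric])
        (use i2 in \<open>auto simp: algebra_simps inner_diff_left\<close>)
    also have "norm \<dots> \<le> (\<integral>x. (L * norm h * norm (y - z)) * norm (f x) \<partial>lborel)"
    proof (rule Bochner_Integration.integral_norm_bound_integral)
      show "integrable lborel (\<lambda>x. ((G (y - x) - G (z - x)) \<bullet> h) *\<^sub>R f x)"
        using Bochner_Integration.integrable_diff[OF i2[of y h] i2[of z h]] by (simp add: algebra_simps inner_diff_left)
      fix x
      have "\<bar>(G (y - x) - G (z - x)) \<bullet> h\<bar> \<le> norm (G (y - x) - G (z - x)) * norm h" by (rule Cauchy_Schwarz_ineq2)
      also have "\<dots> \<le> (L * norm (y - z)) * norm h" 
        using L(2)[of "y - x" "z - x"] by (intro mult_right_mono) auto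
      finally have "\<bar>(G (y - x) - G (z - x)) \<bullet> h\<bar> * norm (f x) \<le> ((L * norm (y - z)) * norm h) * norm (f x)"
        by (rule mult_right_mono) simp
      then show "norm (((G (y - x) - G (z - x)) \<bullet> h) *\<^sub>R f x) \<le> (L * norm h * norm (y - z)) * norm (f x)"
        by (simp add: mult_ac)
    qed (use f in auto)
    also have "\<dots> = L * norm h * N * norm (y - z)" by (simp add: N_def mult_ac)
    finally show ?thesis .
  qed
  have N: "N \<ge> 0" by (simp add: N_def)
  show "continuous_on UNIV (\<lambda>y. D y h)"
  proof (rule lipschitz_on_continuous_on)
    show "(L * norm h * N)-lipschitz_on UNIV (\<lambda>y. D y h)"
      using D_lip N L(1) by (auto simp: lipschitz_on_def dist_norm)
  qed
  have Dadd: "D y (h + k) = D y h + D y k" for h k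
    unfolding D_def by (subst Bochner_Integration.integral_add[symmetric]) (use i2 in \<open>auto simp: inner_add_right algebra_simps\<close>)
  have Dscale: "D y (r *\<^sub>R h) = r *\<^sub>R D y h" for r h
    unfolding D_def by (subst integral_scaleR_right[symmetric]) simp
  have Dbound: "norm (D y h) \<le> norm h * (B * N)" for h
  proof -
    have "norm (D y h) \<le> (\<integral>x. (B * norm h) * norm (f x) \<partial>lborel)"
      unfolding D_def by (rule Bochner_Integration.integral_norm_bound_integral) (use i2 f Gh in \<open>auto intro: mult_right_mono\<close>)
    then show ?thesis by (simp add: N_def mult_ac)
  qed
  show "((\<lambda>y. \<integral>x. \<rho> (y - x) *\<^sub>R f x \<partial>lborel) has_derivative D y) (at y)"
  proof (rule has_derivative_quadratic)
    show "bounded_linear (D y)" using Dadd Dscale Dbound by (rule bounded_linear_intro)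
    fix h
    have "(\<integral>x. \<rho> (y + h - x) *\<^sub>R f x \<partial>lborel) - (\<integral>x. \<rho> (y - x) *\<^sub>R f x \<partial>lborel) - D y h
      = (\<integral>x. (\<rho> (y - x + h) - \<rho> (y - x) - G (y - x) \<bullet> h) *\<^sub>R f x \<partial>lborel)"
      using i1[of "y + h"] i1[of y] i2[of y h] by (simp add: D_def scaleR_diff_left algebra_simps)
    also have "norm \<dots> \<le> (\<integral>x. (L * (norm h)\<^sup>2) * norm (f x) \<partial>lborel)"
    proof (rule Bochner_Integration.integral_norm_bound_integral)
      show "integrable lborel (\<lambda>x. (\<rho> (y - x + h) - \<rho> (y - x) - G (y - x) \<bullet> h) *\<^sub>R f x)"
        using Bochner_Integration.integrable_diff[OF Bochner_Integration.integrable_diff[OF i1[of "y + h"] i1[of y]] i2[of y h]]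
        by (simp add: scaleR_diff_left algebra_simps)
      show "norm ((\<rho> (y - x + h) - \<rho> (y - x) - G (y - x) \<bullet> h) *\<^sub>R f x) \<le> (L * (norm h)\<^sup>2) * norm (f x)" for x
        using mollifier_taylor[OF mollifier_deriv[OF m] L(2), of "y - x" h] L(1) by (auto intro: mult_right_mono)
    qed (use f in auto)
    also have "\<dots> = (L * N) * (norm h)\<^sup>2" by (simp add: N_def mult_ac)
    finally show "norm ((\<integral>x. \<rho> (y + h - x) *\<^sub>R f x \<partial>lborel) - (\<integral>x. \<rho> (y - x) *\<^sub>R f x \<partial>lborel) - D y h) \<le> (L * N) * (norm h)\<^sup>2" .
  qed
qed

section \<open>Translation gaps are controlled by the perimeter\<close>

lemma sets_borel_ball [measurable]: "ball x r \<in> sets borel" "cball x r \<in> sets borel"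
  for x :: "'a::metric_space" by auto

lemma integrable_indicator_mollifier_grad:
  assumes m: "mollifier \<epsilon> \<rho> G" and [measurable]: "E \<in> sets borel" and fin: "emeasure lborel E < \<infinity>"
  shows "integrable lborel (\<lambda>y. indicator E y *\<^sub>R G (x - y))"
proof -
  note [measurable] = mollifier_measurable[OF m]
  obtain B where B: "B > 0" "\<And>w. \<rho> w \<le> B" "\<And>w. norm (G w) \<le> B"
    by (rule mollifier_bounded[OF m]) blast
  have "integrable lborel (\<lambda>y. B * indicator E y)"
    using fin by (intro integrable_mult_right integrable_real_indicator) auto
  then show ?thesis
    by (rule Bochner_Integration.integrable_bound) (use B in \<open>auto simp: indicator_def\<close>)
qed

text \<open>
  By duality: cutting off $-g/|g|$ to a ball and mollifying the result gives a test field, and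
  Fubini moves the mollification onto $E$.
\<close>

lemma mollified_gradient_total_variation:
  fixes E :: "(real^3) set"
  assumes m: "mollifier \<epsilon> \<rho> G" and E[measurable]: "E \<in> sets borel" and fin: "emeasure lborel E < \<infinity>"
  defines "g \<equiv> \<lambda>x. \<integral>y. indicator E y *\<^sub>R G (x - y) \<partial>lborel"
  shows "(\<integral>\<^sup>+x. ennreal (norm (g x)) \<partial>lborel) \<le> perimeter E"
proof -
  note [measurable] = mollifier_measurable[OF m]
  obtain B where B: "B > 0" "\<And>w. \<rho> w \<le> B" "\<And>w. norm (G w) \<le> B"
    by (rule mollifier_bounded[OF m]) blast
  have [measurable]: "g \<in> borel_measurable borel" unfolding g_def by measurable
  have iE: "integrable lborel (indicator E :: _ \<Rightarrow> real)" using fin by (intro integrable_real_indicator) auto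
  note iEG = integrable_indicator_mollifier_grad[OF m E fin]
  have g_bd: "norm (g x) \<le> B * measure lborel E" for x
  proof -
    have "norm (g x) \<le> (\<integral>y. B * indicator E y \<partial>lborel)"
      unfolding g_def by (rule Bochner_Integration.integral_norm_bound_integral[OF iEG integrable_mult_right[OF iE]])
        (use B in \<open>auto simp: indicator_def\<close>)
    then show ?thesis by simp
  qed
  \<comment> \<open>The ball makes the truncated direction field integrable and its mollification
    compactly supported; monotone convergence removes it at the end.\<close>
  have part: "(\<integral>\<^sup>+x. ennreal (norm (g x)) * indicator (cball 0 R) x \<partial>lborel) \<le> perimeter E" for R :: real
  proof -
    define \<phi> where "\<phi> x = (- indicator (cball 0 R) x) *\<^sub>R sgn (g x)" for x
    have [measurable]: "\<phi> \<in> borel_measurable borel" unfolding \<phi>_def sgn_div_norm by measurable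
    have \<phi>1: "norm (\<phi> x) \<le> indicator (cball 0 R) x" for x
      by (auto simp: \<phi>_def indicator_def norm_sgn)
    have iR: "integrable lborel (indicator (cball 0 R) :: real^3 \<Rightarrow> real)"
      by (rule integrable_indicator_ball)
    have i\<phi>: "integrable lborel \<phi>"
      by (rule Bochner_Integration.integrable_bound[OF iR]) (use \<phi>1 in auto)
    define \<Phi> where "\<Phi> y = (\<integral>x. \<rho> (y - x) *\<^sub>R \<phi> x \<partial>lborel)" for y
    define D where "D y h = (\<integral>x. (G (y - x) \<bullet> h) *\<^sub>R \<phi> x \<partial>lborel)" for y h
    have D: "(\<Phi> has_derivative D y) (at y)" "continuous_on UNIV (\<lambda>y. D y h)" for y h
      unfolding \<Phi>_def D_def using mollify_has_derivative[OF m i\<phi>] by auto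
    have test: "\<Phi> \<in> test_fields"
    proof (rule test_fieldsI[OF D])
      fix y :: "real^3" assume y: "norm y > R + \<epsilon>"
      have "\<rho> (y - x) *\<^sub>R \<phi> x = 0" for x
      proof (cases "norm x \<le> R")
        case True
        then have "norm (y - x) \<ge> \<epsilon>" using y norm_triangle_ineq2[of y x] by linarith
        then show ?thesis by (simp add: mollifier_support[OF m])
      qed (simp add: \<phi>_def)
      then show "\<Phi> y = 0" unfolding \<Phi>_def by (simp only: Bochner_Integration.integral_zero)
    next
      fix y
      have "ennreal (norm (\<Phi> y)) \<le> (\<integral>\<^sup>+x. ennreal (norm (\<rho> (y - x) *\<^sub>R \<phi> x)) \<partial>lborel)"
        unfolding \<Phi>_def by (rule integral_norm_bound_ennreal)
          (use B mollifier_nonneg[OF m] in \<open>auto intro!: integrable_bounded_scaleR[OF _ i\<phi>, of _ B]\<close>)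
      also have "\<dots> \<le> (\<integral>\<^sup>+x. ennreal (\<rho> (y - x)) \<partial>lborel)"
      proof (intro nn_integral_mono ennreal_leI)
        fix x
        have "norm (\<phi> x) \<le> 1" by (rule order_trans[OF \<phi>1]) (simp add: indicator_def)
        then show "norm (\<rho> (y - x) *\<^sub>R \<phi> x) \<le> \<rho> (y - x)"
          using mollifier_nonneg[OF m, of "y - x"] by (simp add: mult_left_le)
      qed
      also have "\<dots> = (\<integral>\<^sup>+x. ennreal (\<rho> x) \<partial>lborel)"
        by (rule nn_integral_lborel_reflect[where f="\<lambda>x. ennreal (\<rho> x)"]) measurable
      finally show "norm (\<Phi> y) \<le> 1" by (simp add: mollifier_mass[OF m])
    qed
    have iG\<phi>: "integrable lborel (\<lambda>x. (G (y - x) \<bullet> h) *\<^sub>R \<phi> x)" for y h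
    proof (intro integrable_bounded_scaleR[OF _ i\<phi>])
      show "\<bar>G (y - x) \<bullet> h\<bar> \<le> B * norm h" for x
        using Cauchy_Schwarz_ineq2[of "G (y - x)" h] mult_right_mono[OF B(3)[of "y - x"] norm_ge_zero[of h]] by linarith
    qed measurable
    have div: "divergence \<Phi> y = (\<integral>x. G (y - x) \<bullet> \<phi> x \<partial>lborel)" for y
    proof -
      have "divergence \<Phi> y = (\<Sum>i\<in>UNIV. D y (axis i 1) $ i)" by (rule divergence_eq[OF D(1)])
      also have "\<dots> = (\<Sum>i\<in>UNIV. \<integral>x. G (y - x) $ i * \<phi> x $ i \<partial>lborel)"
      proof (rule sum.cong)
        fix i :: 3
        have "D y (axis i 1) $ i = (\<integral>x. ((G (y - x) \<bullet> axis i 1) *\<^sub>R \<phi> x) $ i \<partial>lborel)"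
          unfolding D_def by (rule integral_bounded_linear[symmetric, OF bounded_linear_vec_nth iG\<phi>])
        then show "D y (axis i 1) $ i = (\<integral>x. G (y - x) $ i * \<phi> x $ i \<partial>lborel)"
          by (simp add: inner_axis)
      qed simp
      also have "\<dots> = (\<integral>x. (\<Sum>i\<in>UNIV. G (y - x) $ i * \<phi> x $ i) \<partial>lborel)"
      proof (rule Bochner_Integration.integral_sum[symmetric])
        fix i :: 3
        show "integrable lborel (\<lambda>x. G (y - x) $ i * \<phi> x $ i)"
          using integrable_bounded_linear[OF bounded_linear_vec_nth iG\<phi>[of y "axis i 1"], of i] by (simp add: inner_axis)
      qed
      finally show ?thesis by (simp add: inner_vec_def)
    qed
    have "(LINT y:E|lborel. divergence \<Phi> y) = (\<integral>y. \<integral>x. indicator E y * (G (y - x) \<bullet> \<phi> x) \<partial>lborel \<partial>lborel)"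
      by (simp add: set_lebesgue_integral_def div)
    also have "\<dots> = (\<integral>x. \<integral>y. indicator E y * (G (y - x) \<bullet> \<phi> x) \<partial>lborel \<partial>lborel)"
    proof (rule lborel_pair.Fubini_integral)
      have "integrable (lborel \<Otimes>\<^sub>M lborel) (\<lambda>p. B * indicator (cball (0::real^3) R \<times> E) p)"
      proof (intro integrable_mult_right integrable_real_indicator)
        have "emeasure (lborel \<Otimes>\<^sub>M lborel) (cball (0::real^3) R \<times> E) = emeasure lborel (cball (0::real^3) R) * emeasure lborel E"
          by (rule lborel.emeasure_pair_measure_Times) auto
        also have "\<dots> < \<infinity>" using fin emeasure_lborel_cball_finite[of "0::real^3" R] by (simp add: ennreal_mult_less_top)
        finally show "emeasure (lborel \<Otimes>\<^sub>M lborel) (cball (0::real^3) R \<times> E) < \<infinity>" .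
      qed auto
      then show "integrable (lborel \<Otimes>\<^sub>M lborel) (\<lambda>(x, y). indicator E y * (G (y - x) \<bullet> \<phi> x))"
      proof (rule Bochner_Integration.integrable_bound)
        have "\<bar>G (y - x) \<bullet> \<phi> x\<bar> \<le> B * indicator (cball 0 R) x" for x y
        proof -
          have "\<bar>G (y - x) \<bullet> \<phi> x\<bar> \<le> norm (G (y - x)) * norm (\<phi> x)" by (rule Cauchy_Schwarz_ineq2)
          also have "\<dots> \<le> B * indicator (cball 0 R) x" using B \<phi>1 by (intro mult_mono) (auto intro: less_imp_le)
          finally show ?thesis .
        qed
        then have "\<bar>indicator E y * (G (y - x) \<bullet> \<phi> x)\<bar> \<le> B * indicator (cball (0::real^3) R \<times> E) (x, y)" for x y
          by (cases "y \<in> E") (auto simp: indicator_times)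
        then show "AE p in lborel \<Otimes>\<^sub>M lborel. norm (case p of (x, y) \<Rightarrow> indicator E y * (G (y - x) \<bullet> \<phi> x))
            \<le> norm (B * indicator (cball (0::real^3) R \<times> E) p)"
          using B(1) by (intro AE_I2) (auto simp: abs_mult split: prod.split)
      qed measurable
    qed
    also have "\<dots> = (\<integral>x. indicator (cball 0 R) x * norm (g x) \<partial>lborel)"
    proof (intro Bochner_Integration.integral_cong refl)
      fix x
      \<comment> \<open>Oddness of \<open>G\<close> turns \<open>G (y - x)\<close> into -
        \<open>G (x - y)\<close>, and this sign cancels the minus sign built into
        \<open>\<phi>\<close>.\<close>
      have "(\<integral>y. indicator E y * (G (y - x) \<bullet> \<phi> x) \<partial>lborel) = (\<integral>y. (indicator E y *\<^sub>R G (x - y)) \<bullet> (- \<phi> x) \<partial>lborel)"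
      proof (intro Bochner_Integration.integral_cong refl)
        fix y show "indicator E y * (G (y - x) \<bullet> \<phi> x) = (indicator E y *\<^sub>R G (x - y)) \<bullet> (- \<phi> x)"
          using mollifier_grad_odd[OF m, of "x - y"] by simp
      qed
      also have "\<dots> = g x \<bullet> (- \<phi> x)"
        unfolding g_def by (rule integral_inner_left) (use iEG in auto)
      also have "\<dots> = indicator (cball 0 R) x * norm (g x)"
        by (cases "g x = 0") (simp_all add: \<phi>_def sgn_div_norm power2_norm_eq_inner[symmetric] power2_eq_square)
      finally show "(\<integral>y. indicator E y * (G (y - x) \<bullet> \<phi> x) \<partial>lborel) = indicator (cball 0 R) x * norm (g x)" .
    qed
    finally have eq: "(LINT y:E|lborel. divergence \<Phi> y) = (\<integral>x. indicator (cball 0 R) x * norm (g x) \<partial>lborel)" .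
    have "(\<integral>\<^sup>+x. ennreal (norm (g x)) * indicator (cball 0 R) x \<partial>lborel) = (\<integral>\<^sup>+x. ennreal (indicator (cball 0 R) x * norm (g x)) \<partial>lborel)"
      by (intro nn_integral_cong) (simp add: indicator_def)
    also have "\<dots> = ennreal (LINT y:E|lborel. divergence \<Phi> y)"
      unfolding eq
    proof (rule nn_integral_eq_integral)
      show "integrable lborel (\<lambda>x. indicator (cball 0 R) x * norm (g x))"
        by (rule Bochner_Integration.integrable_bound[OF integrable_mult_right[OF iR, of "B * measure lborel E"]])
           (use g_bd B in \<open>auto simp: indicator_def\<close>)
    qed simp
    also have "\<dots> \<le> perimeter E" by (rule perimeter_ge[OF E test])
    finally show ?thesis .
  qed
  have "(\<integral>\<^sup>+x. ennreal (norm (g x)) \<partial>lborel) = (\<integral>\<^sup>+x. (SUP n. ennreal (norm (g x)) * indicator (cball 0 (real n)) x) \<partial>lborel)"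
  proof (intro nn_integral_cong)
    fix x :: "real^3"
    obtain n where n: "norm x \<le> real n" using real_arch_simple by blast
    show "ennreal (norm (g x)) = (SUP n. ennreal (norm (g x)) * indicator (cball 0 (real n)) x)"
      by (rule antisym, rule SUP_upper2[of n], use n in \<open>auto intro!: SUP_least simp: indicator_def\<close>)
  qed
  also have "\<dots> = (SUP n. \<integral>\<^sup>+x. ennreal (norm (g x)) * indicator (cball 0 (real n)) x \<partial>lborel)"
    by (rule nn_integral_monotone_convergence_SUP) (auto simp: incseq_def le_fun_def indicator_def)
  also have "\<dots> \<le> perimeter E" by (rule SUP_least) (rule part)
  finally show ?thesis .
qed

text \<open>The difference u - 1_E is an average, with weights \<open>\<rho> w\<close> of total mass
  1, of the differences between E and its translates by w. By Fubini each of them contributes at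
  most twice the translation gap, and only |w| < \<epsilon> carries weight.\<close>

lemma mollify_L1_distance:
  fixes E :: "(real^3) set"
  assumes m: "mollifier \<epsilon> \<rho> G" and E[measurable]: "E \<in> sets borel" and fin: "emeasure lborel E < \<infinity>"
    and gap: "\<And>w. norm w < \<epsilon> \<Longrightarrow> translation_gap E w \<le> \<eta>"
  defines "u \<equiv> \<lambda>x. \<integral>y. \<rho> (x - y) * indicator E y \<partial>lborel"
  shows "(\<integral>\<^sup>+x. ennreal \<bar>u x - indicator E x\<bar> \<partial>lborel) \<le> 2 * \<eta>"
proof -
  note [measurable] = mollifier_measurable[OF m]
  have iE: "integrable lborel (indicator E :: _ \<Rightarrow> real)" using fin by (intro integrable_real_indicator) auto
  have i\<rho>: "integrable lborel \<rho>"
    using mollifier_mass[OF m] mollifier_nonneg[OF m] by (intro integrableI_nonneg) auto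
  have mass: "(\<integral>\<^sup>+y. ennreal (\<rho> (x - y)) \<partial>lborel) = 1" for x
    using nn_integral_lborel_reflect[of "\<lambda>w. ennreal (\<rho> w)" x] mollifier_mass[OF m] by simp
  have i\<rho>': "integrable lborel (\<lambda>y. \<rho> (x - y))" for x
    using mass mollifier_nonneg[OF m] by (intro integrableI_nonneg) auto
  have I1: "(\<integral>y. \<rho> (x - y) \<partial>lborel) = 1" for x
    using mass[of x] i\<rho>'[of x] mollifier_nonneg[OF m] by (simp add: nn_integral_eq_integral)
  have pt: "ennreal \<bar>u x - indicator E x\<bar> \<le> (\<integral>\<^sup>+w. ennreal (\<rho> w * \<bar>indicator E x - indicator E (x - w)\<bar>) \<partial>lborel)" for x
  proof -
    have i1: "integrable lborel (\<lambda>y. \<rho> (x - y) * indicator E y)"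
      using i\<rho>' by (intro integrable_real_mult_indicator) auto
    have i2: "integrable lborel (\<lambda>y. \<rho> (x - y) * (indicator E y - indicator E x))"
      using Bochner_Integration.integrable_diff[OF i1 integrable_mult_left[OF i\<rho>'[of x], of "indicator E x"]]
      by (simp add: algebra_simps)
    have "u x - indicator E x = (\<integral>y. \<rho> (x - y) * indicator E y \<partial>lborel) - (\<integral>y. \<rho> (x - y) * indicator E x \<partial>lborel)"
      using I1 by (simp add: u_def)
    also have "\<dots> = (\<integral>y. \<rho> (x - y) * (indicator E y - indicator E x) \<partial>lborel)"
      by (subst Bochner_Integration.integral_diff[symmetric]) (use i1 i\<rho>' in \<open>auto simp: algebra_simps\<close>)
    finally have "ennreal \<bar>u x - indicator E x\<bar> \<le> (\<integral>\<^sup>+y. ennreal (norm (\<rho> (x - y) * (indicator E y - indicator E x))) \<partial>lborel)"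
      using integral_norm_bound_ennreal[OF i2] by simp
    also have "\<dots> = (\<integral>\<^sup>+w. ennreal (norm (\<rho> (x - (x - w)) * (indicator E (x - w) - indicator E x))) \<partial>lborel)"
      by (rule nn_integral_lborel_reflect[symmetric]) measurable
    finally show ?thesis 
      using mollifier_nonneg[OF m] by (simp add: abs_mult abs_minus_commute)
  qed
  have "(\<integral>\<^sup>+x. ennreal \<bar>u x - indicator E x\<bar> \<partial>lborel)
    \<le> (\<integral>\<^sup>+x. (\<integral>\<^sup>+w. ennreal (\<rho> w * \<bar>indicator E x - indicator E (x - w)\<bar>) \<partial>lborel) \<partial>lborel)"
    by (intro nn_integral_mono pt)
  also have "\<dots> = (\<integral>\<^sup>+w. (\<integral>\<^sup>+x. ennreal (\<rho> w * \<bar>indicator E x - indicator E (x - w)\<bar>) \<partial>lborel) \<partial>lborel)"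
    by (rule lborel_pair.Fubini') measurable
  also have "\<dots> = (\<integral>\<^sup>+w. ennreal (\<rho> w) * (2 * translation_gap E w) \<partial>lborel)"
    using mollifier_nonneg[OF m] 
    by (intro nn_integral_cong)
       (simp add: ennreal_mult nn_integral_cmult nn_integral_translation_difference[OF E fin])
  also have "\<dots> \<le> (\<integral>\<^sup>+w. ennreal (\<rho> w) * (2 * \<eta>) \<partial>lborel)"
  proof (intro nn_integral_mono)
    fix w
    show "ennreal (\<rho> w) * (2 * translation_gap E w) \<le> ennreal (\<rho> w) * (2 * \<eta>)"
      using gap[of w] mollifier_support[OF m, of w] by (cases "norm w < \<epsilon>") (auto intro!: mult_left_mono)
  qed
  also have "\<dots> = 2 * \<eta>"
    using mollifier_mass[OF m] by (simp add: nn_integral_multc)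
  finally show ?thesis .
qed

text \<open>The fundamental theorem along the segment from x to x - h, followed by translation
  invariance at each point of the segment. The inner product with h is kept because the estimate is
  later averaged over directions.\<close>

lemma mollify_translation_difference:
  fixes E :: "(real^3) set"
  assumes m: "mollifier \<epsilon> \<rho> G" and E[measurable]: "E \<in> sets borel" and fin: "emeasure lborel E < \<infinity>"
  defines "u \<equiv> \<lambda>x. \<integral>y. \<rho> (x - y) * indicator E y \<partial>lborel"
    and "g \<equiv> \<lambda>x. \<integral>y. indicator E y *\<^sub>R G (x - y) \<partial>lborel"
  shows "(\<integral>\<^sup>+x. ennreal \<bar>u x - u (x - h)\<bar> \<partial>lborel) \<le> (\<integral>\<^sup>+x. ennreal \<bar>g x \<bullet> h\<bar> \<partial>lborel)"
proof -
  note [measurable] = mollifier_measurable[OF m]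
  have [measurable]: "g \<in> borel_measurable borel" unfolding g_def by measurable
  have iE: "integrable lborel (indicator E :: _ \<Rightarrow> real)" using fin by (intro integrable_real_indicator) auto
  note iEG = integrable_indicator_mollifier_grad[OF m E fin]
  have gh: "(\<integral>y. (G (x - y) \<bullet> k) *\<^sub>R indicator E y \<partial>lborel) = g x \<bullet> k" for x k
  proof -
    have "g x \<bullet> k = (\<integral>y. (indicator E y *\<^sub>R G (x - y)) \<bullet> k \<partial>lborel)"
      unfolding g_def by (rule integral_inner_left[symmetric]) (use iEG in auto)
    then show ?thesis by (simp add: mult.commute)
  qed
  have u_der: "(u has_derivative (\<lambda>k. g x \<bullet> k)) (at x)" for x
    using mollify_has_derivative(1)[OF m iE, of x] by (simp add: u_def gh flip: real_scaleR_def)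
  have g_cont: "continuous_on UNIV (\<lambda>x. g x \<bullet> h)"
    using mollify_has_derivative(2)[OF m iE, of h] by (simp only: gh)
  have pt: "ennreal \<bar>u x - u (x - h)\<bar> \<le> (\<integral>\<^sup>+s. ennreal \<bar>g (x - s *\<^sub>R h) \<bullet> h\<bar> * indicator {0..1} s \<partial>lborel)" for x
  proof -
    have cont: "continuous_on {0..1} (\<lambda>s. - (g (x - s *\<^sub>R h) \<bullet> h))"
      by (intro continuous_on_minus continuous_on_compose2[OF g_cont]) (auto intro!: continuous_intros)
    have der: "((\<lambda>s. u (x - s *\<^sub>R h)) has_vector_derivative - (g (x - s *\<^sub>R h) \<bullet> h)) (at s within {0..1})" for s
    proof -
      have "((\<lambda>s. u (x - s *\<^sub>R h)) has_derivative (\<lambda>t. g (x - s *\<^sub>R h) \<bullet> (- (t *\<^sub>R h)))) (at s within {0..1})"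
        by (rule has_derivative_compose[of "\<lambda>s. x - s *\<^sub>R h" "\<lambda>t. - (t *\<^sub>R h)", OF _ u_der])
           (auto intro!: derivative_eq_intros)
      then show ?thesis by (simp add: has_vector_derivative_def)
    qed
    have FTC: "has_bochner_integral lborel (\<lambda>s. indicator {0..1} s *\<^sub>R - (g (x - s *\<^sub>R h) \<bullet> h)) (u (x - 1 *\<^sub>R h) - u (x - 0 *\<^sub>R h))"
      by (rule has_bochner_integral_FTC_Icc) (use cont der in auto)
    have "ennreal \<bar>u x - u (x - h)\<bar> = ennreal (norm (\<integral>s. indicator {0..1} s *\<^sub>R - (g (x - s *\<^sub>R h) \<bullet> h) \<partial>lborel))"
      using has_bochner_integral_integral_eq[OF FTC] by (simp add: abs_minus_commute)
    also have "\<dots> \<le> (\<integral>\<^sup>+s. ennreal (norm (indicator {0..1} s *\<^sub>R - (g (x - s *\<^sub>R h) \<bullet> h))) \<partial>lborel)"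
      by (rule integral_norm_bound_ennreal) (use FTC in \<open>simp add: has_bochner_integral_iff\<close>)
    also have "\<dots> = (\<integral>\<^sup>+s. ennreal \<bar>g (x - s *\<^sub>R h) \<bullet> h\<bar> * indicator {0..1} s \<partial>lborel)"
      by (intro nn_integral_cong) (simp add: indicator_def)
    finally show ?thesis .
  qed
  have "(\<integral>\<^sup>+x. ennreal \<bar>u x - u (x - h)\<bar> \<partial>lborel)
     \<le> (\<integral>\<^sup>+x. (\<integral>\<^sup>+s. ennreal \<bar>g (x - s *\<^sub>R h) \<bullet> h\<bar> * indicator {0..1} s \<partial>lborel) \<partial>lborel)"
    by (intro nn_integral_mono pt)
  also have "\<dots> = (\<integral>\<^sup>+s. (\<integral>\<^sup>+x. ennreal \<bar>g (x - s *\<^sub>R h) \<bullet> h\<bar> * indicator {0..1} s \<partial>lborel) \<partial>lborel)"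
    by (rule lborel_pair.Fubini') measurable
  also have "\<dots> = (\<integral>\<^sup>+s. (\<integral>\<^sup>+x. ennreal \<bar>g x \<bullet> h\<bar> \<partial>lborel) * indicator {0..1::real} s \<partial>lborel)"
  proof (intro nn_integral_cong)
    fix s :: real
    have "(\<integral>\<^sup>+x. ennreal \<bar>g (x - s *\<^sub>R h) \<bullet> h\<bar> * indicator {0..1} s \<partial>lborel)
        = (\<integral>\<^sup>+x. ennreal \<bar>g (x - s *\<^sub>R h) \<bullet> h\<bar> \<partial>lborel) * indicator {0..1} s"
      by (rule nn_integral_multc) measurable
    also have "(\<integral>\<^sup>+x. ennreal \<bar>g (x - s *\<^sub>R h) \<bullet> h\<bar> \<partial>lborel) = (\<integral>\<^sup>+x. ennreal \<bar>g x \<bullet> h\<bar> \<partial>lborel)"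
      by (rule nn_integral_lborel_translate[where f="\<lambda>x. ennreal \<bar>g x \<bullet> h\<bar>"]) measurable
    finally show "(\<integral>\<^sup>+x. ennreal \<bar>g (x - s *\<^sub>R h) \<bullet> h\<bar> * indicator {0..1} s \<partial>lborel)
        = (\<integral>\<^sup>+x. ennreal \<bar>g x \<bullet> h\<bar> \<partial>lborel) * indicator {0..1} s" .
  qed
  also have "\<dots> = (\<integral>\<^sup>+x. ennreal \<bar>g x \<bullet> h\<bar> \<partial>lborel)"
    by (subst nn_integral_cmult_indicator) auto
  finally show ?thesis .
qed

text \<open>Replacing E by its mollification costs 2 \<eta> at each of the two ends of a
  translation, hence 4 \<eta> times the finite mass of k, and \<eta> is arbitrary. For the mollified
  set Fubini puts the z-integral inside; since the moment bound is the same in every direction, what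
  remains is |g x|, whose integral is at most the perimeter.\<close>

lemma nn_integral_kernel_translation_gap:
  fixes E :: "(real^3) set" and k :: "real^3 \<Rightarrow> ennreal"
  assumes [measurable]: "k \<in> borel_measurable borel" and kfin: "(\<integral>\<^sup>+z. k z \<partial>lborel) < \<infinity>"
    and mom: "\<And>u. norm u = 1 \<Longrightarrow> (\<integral>\<^sup>+z. k z * ennreal \<bar>z \<bullet> u\<bar> \<partial>lborel) \<le> ennreal c"
    and E[measurable]: "E \<in> sets borel" and fin: "emeasure lborel E < \<infinity>" and t: "t \<ge> 0"
  shows "(\<integral>\<^sup>+z. k z * (2 * translation_gap E (t *\<^sub>R z)) \<partial>lborel) \<le> ennreal (t * c) * perimeter E"
proof -
  define M where "M = (\<integral>\<^sup>+z. k z \<partial>lborel)"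
  have main: "(\<integral>\<^sup>+z. k z * (2 * translation_gap E (t *\<^sub>R z)) \<partial>lborel) \<le> ennreal (t * c) * perimeter E + 4 * ennreal \<eta> * M" 
    if \<eta>: "\<eta> > 0" for \<eta> :: real
  proof -
    obtain \<epsilon> where \<epsilon>: "\<epsilon> > 0" "\<And>w. norm w < \<epsilon> \<Longrightarrow> translation_gap E w \<le> ennreal \<eta>"
      using translation_gap_tendsto_0[OF E fin \<eta>] by blast
    obtain \<rho> G where m: "mollifier \<epsilon> \<rho> G" using mollifier_exists[OF \<epsilon>(1)] by blast
    note [measurable] = mollifier_measurable[OF m]
    define u where "u x = (\<integral>y. \<rho> (x - y) * indicator E y \<partial>lborel)" for x
    define g where "g x = (\<integral>y. indicator E y *\<^sub>R G (x - y) \<partial>lborel)" for x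
    have [measurable]: "u \<in> borel_measurable borel" "g \<in> borel_measurable borel" 
      unfolding u_def g_def by measurable
    have u1: "(\<integral>\<^sup>+x. ennreal \<bar>u x - indicator E x\<bar> \<partial>lborel) \<le> 2 * ennreal \<eta>"
      unfolding u_def by (rule mollify_L1_distance[OF m E fin \<epsilon>(2)])
    have g1: "(\<integral>\<^sup>+x. ennreal (norm (g x)) \<partial>lborel) \<le> perimeter E"
      unfolding g_def by (rule mollified_gradient_total_variation[OF m E fin])
    have gap: "2 * translation_gap E h \<le> (\<integral>\<^sup>+x. ennreal \<bar>g x \<bullet> h\<bar> \<partial>lborel) + 4 * ennreal \<eta>" for h
    proof -
      have "2 * translation_gap E h = (\<integral>\<^sup>+x. ennreal \<bar>indicator E x - indicator E (x - h)\<bar> \<partial>lborel)"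
        by (rule nn_integral_translation_difference[OF E fin, symmetric])
      also have "\<dots> \<le> (\<integral>\<^sup>+x. ennreal \<bar>u x - indicator E x\<bar> + (ennreal \<bar>u x - u (x - h)\<bar> + ennreal \<bar>u (x - h) - indicator E (x - h)\<bar>) \<partial>lborel)"
        by (intro nn_integral_mono) (simp flip: ennreal_plus)
      also have "\<dots> = (\<integral>\<^sup>+x. ennreal \<bar>u x - indicator E x\<bar> \<partial>lborel) + ((\<integral>\<^sup>+x. ennreal \<bar>u x - u (x - h)\<bar> \<partial>lborel)
           + (\<integral>\<^sup>+x. ennreal \<bar>u (x - h) - indicator E (x - h)\<bar> \<partial>lborel))"
        by (subst nn_integral_add, measurable, subst nn_integral_add, measurable)
      also have "(\<integral>\<^sup>+x. ennreal \<bar>u (x - h) - indicator E (x - h)\<bar> \<partial>lborel) = (\<integral>\<^sup>+x. ennreal \<bar>u x - indicator E x\<bar> \<partial>lborel)"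
        by (rule nn_integral_lborel_translate[where f="\<lambda>x. ennreal \<bar>u x - indicator E x\<bar>"]) measurable
      also have "(\<integral>\<^sup>+x. ennreal \<bar>u x - indicator E x\<bar> \<partial>lborel) + ((\<integral>\<^sup>+x. ennreal \<bar>u x - u (x - h)\<bar> \<partial>lborel)
           + (\<integral>\<^sup>+x. ennreal \<bar>u x - indicator E x\<bar> \<partial>lborel))
         \<le> 2 * ennreal \<eta> + ((\<integral>\<^sup>+x. ennreal \<bar>g x \<bullet> h\<bar> \<partial>lborel) + 2 * ennreal \<eta>)"
        using u1 mollify_translation_difference[OF m E fin, of h] by (intro add_mono) (auto simp: u_def g_def)
      also have "\<dots> = (\<integral>\<^sup>+x. ennreal \<bar>g x \<bullet> h\<bar> \<partial>lborel) + (2 * ennreal \<eta> + 2 * ennreal \<eta>)" by (simp add: add_ac)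
      also have "2 * ennreal \<eta> + 2 * ennreal \<eta> = 4 * ennreal \<eta>" by (simp flip: distrib_right)
      finally show ?thesis .
    qed
    \<comment> \<open>The moment hypothesis is for unit vectors and is applied to the direction of
      v; v = 0 is trivial.\<close>
    have dir: "(\<integral>\<^sup>+z. k z * ennreal \<bar>v \<bullet> z\<bar> \<partial>lborel) \<le> ennreal (norm v) * ennreal c" for v :: "real^3"
    proof (cases "v = 0")
      case False
      have "(\<integral>\<^sup>+z. k z * ennreal \<bar>v \<bullet> z\<bar> \<partial>lborel) = (\<integral>\<^sup>+z. ennreal (norm v) * (k z * ennreal \<bar>z \<bullet> sgn v\<bar>) \<partial>lborel)"
        using False by (intro nn_integral_cong)
          (simp add: sgn_div_norm abs_mult inner_commute mult_ac ennreal_mult[symmetric] mult.assoc[symmetric])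
      also have "\<dots> = ennreal (norm v) * (\<integral>\<^sup>+z. k z * ennreal \<bar>z \<bullet> sgn v\<bar> \<partial>lborel)"
        by (rule nn_integral_cmult) measurable
      also have "\<dots> \<le> ennreal (norm v) * ennreal c"
        using mom[of "sgn v"] False by (intro mult_left_mono) (auto simp: norm_sgn)
      finally show ?thesis .
    qed simp
    have "(\<integral>\<^sup>+z. k z * (2 * translation_gap E (t *\<^sub>R z)) \<partial>lborel)
      \<le> (\<integral>\<^sup>+z. k z * ((\<integral>\<^sup>+x. ennreal \<bar>g x \<bullet> (t *\<^sub>R z)\<bar> \<partial>lborel) + 4 * ennreal \<eta>) \<partial>lborel)"
      by (intro nn_integral_mono mult_left_mono gap) simp
    also have "\<dots> = (\<integral>\<^sup>+z. k z * (\<integral>\<^sup>+x. ennreal \<bar>g x \<bullet> (t *\<^sub>R z)\<bar> \<partial>lborel) + k z * (4 * ennreal \<eta>) \<partial>lborel)"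
      by (simp add: distrib_left)
    also have "\<dots> = (\<integral>\<^sup>+z. k z * (\<integral>\<^sup>+x. ennreal \<bar>g x \<bullet> (t *\<^sub>R z)\<bar> \<partial>lborel) \<partial>lborel) + M * (4 * ennreal \<eta>)"
      unfolding M_def by (subst nn_integral_add) (simp_all add: nn_integral_multc)
    also have "(\<integral>\<^sup>+z. k z * (\<integral>\<^sup>+x. ennreal \<bar>g x \<bullet> (t *\<^sub>R z)\<bar> \<partial>lborel) \<partial>lborel)
       = (\<integral>\<^sup>+z. (\<integral>\<^sup>+x. ennreal t * (k z * ennreal \<bar>g x \<bullet> z\<bar>) \<partial>lborel) \<partial>lborel)"
    proof (intro nn_integral_cong)
      fix z
      have "k z * (\<integral>\<^sup>+x. ennreal \<bar>g x \<bullet> (t *\<^sub>R z)\<bar> \<partial>lborel) = (\<integral>\<^sup>+x. k z * ennreal \<bar>g x \<bullet> (t *\<^sub>R z)\<bar> \<partial>lborel)"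
        by (rule nn_integral_cmult[symmetric]) measurable
      also have "\<dots> = (\<integral>\<^sup>+x. ennreal t * (k z * ennreal \<bar>g x \<bullet> z\<bar>) \<partial>lborel)"
        using t by (intro nn_integral_cong) (simp add: abs_mult ennreal_mult mult_ac)
      finally show "k z * (\<integral>\<^sup>+x. ennreal \<bar>g x \<bullet> (t *\<^sub>R z)\<bar> \<partial>lborel) = (\<integral>\<^sup>+x. ennreal t * (k z * ennreal \<bar>g x \<bullet> z\<bar>) \<partial>lborel)" .
    qed
    also have "\<dots> = (\<integral>\<^sup>+x. (\<integral>\<^sup>+z. ennreal t * (k z * ennreal \<bar>g x \<bullet> z\<bar>) \<partial>lborel) \<partial>lborel)"
      by (rule lborel_pair.Fubini') measurable
    also have "\<dots> = (\<integral>\<^sup>+x. ennreal t * (\<integral>\<^sup>+z. k z * ennreal \<bar>g x \<bullet> z\<bar> \<partial>lborel) \<partial>lborel)"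
      by (intro nn_integral_cong nn_integral_cmult) measurable
    also have "\<dots> \<le> (\<integral>\<^sup>+x. ennreal t * (ennreal (norm (g x)) * ennreal c) \<partial>lborel)"
      by (intro nn_integral_mono mult_left_mono dir) simp
    also have "\<dots> = ennreal t * ennreal c * (\<integral>\<^sup>+x. ennreal (norm (g x)) \<partial>lborel)"
      by (subst nn_integral_cmult[symmetric]) (auto simp: mult_ac)
    also have "\<dots> \<le> ennreal t * ennreal c * perimeter E" by (intro mult_left_mono g1) simp
    finally show ?thesis unfolding ennreal_mult'[OF t] by (simp add: mult_ac add_mono)
  qed
  show ?thesis
  proof (rule ennreal_le_epsilon)
    fix e :: real assume e: "e > 0"
    obtain M' where M': "M = ennreal M'" "M' \<ge> 0" using kfin unfolding M_def[symmetric] by (cases M) auto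
    \<comment> \<open>The added 1 keeps the denominator positive when the kernel has no
      mass.\<close>
    define \<eta> where "\<eta> = e / (4 * (M' + 1))"
    have \<eta>: "\<eta> > 0" using e M' by (simp add: \<eta>_def)
    have "4 * \<eta> * M' \<le> e" using e M' by (simp add: \<eta>_def field_simps)
    then have "4 * ennreal \<eta> * M \<le> ennreal e"
      using \<eta> M' by (simp add: ennreal_mult[symmetric] ennreal_numeral[symmetric] ennreal_leI del: ennreal_numeral)
    with main[OF \<eta>] show "(\<integral>\<^sup>+z. k z * (2 * translation_gap E (t *\<^sub>R z)) \<partial>lborel) \<le> ennreal (t * c) * perimeter E + ennreal e"
      by (meson add_left_mono order_trans)
  qed
qed

section \<open>Scaling and cutting\<close>

lemma integral_lborel_affine:
  fixes f :: "'a::euclidean_space \<Rightarrow> real" and t :: 'a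
  assumes [measurable]: "f \<in> borel_measurable borel" and c: "c > 0"
  shows "(\<integral>x. f x \<partial>lborel) = c ^ DIM('a) * (\<integral>x. f (t + c *\<^sub>R x) \<partial>lborel)"
  using c by (subst lborel_affine[of c t]) (simp_all add: integral_density integral_distr)

text \<open>Pulling a test field back along x -> a + l x gives a test field whose divergence carries
  one factor l. The Jacobian l^3 therefore leaves l^2.\<close>

lemma perimeter_affine_le:
  fixes E :: "(real^3) set"
  assumes E[measurable]: "E \<in> sets borel" and l: "l > 0"
  shows "perimeter {x. (x - a) /\<^sub>R l \<in> E} \<le> ennreal (l\<^sup>2) * perimeter E"
proof (rule perimeter_le)
  show "{x. (x - a) /\<^sub>R l \<in> E} \<in> sets borel" by measurable
  fix \<phi> assume \<phi>: "\<phi> \<in> test_fields"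
  obtain D R where D: "\<And>x. (\<phi> has_derivative D x) (at x)" "\<And>h. continuous_on UNIV (\<lambda>x. D x h)"
    and R: "R > 0" "\<And>x. norm x > R \<Longrightarrow> \<phi> x = 0" "\<And>x. norm (\<phi> x) \<le> 1"
    using \<phi> by (erule test_fieldsE)
  have [measurable]: "divergence \<phi> \<in> borel_measurable borel" by (rule divergence_measurable[OF \<phi>])
  define \<psi> where "\<psi> x = \<phi> (a + l *\<^sub>R x)" for x
  have d: "(\<psi> has_derivative (\<lambda>h. D (a + l *\<^sub>R x) (l *\<^sub>R h))) (at x)" for x
    unfolding \<psi>_def by (rule has_derivative_compose[of "\<lambda>x. a + l *\<^sub>R x" "\<lambda>h. l *\<^sub>R h", OF _ D(1)])
      (auto intro!: derivative_eq_intros)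
  have \<psi>: "\<psi> \<in> test_fields"
  proof (rule test_fieldsI[OF d])
    show "continuous_on UNIV (\<lambda>x. D (a + l *\<^sub>R x) (l *\<^sub>R h))" for h
      by (rule continuous_on_compose2[OF D(2)]) (auto intro!: continuous_intros)
    fix x :: "real^3" assume x: "norm x > (R + norm a) / l"
    then have "norm (l *\<^sub>R x) > R + norm a" using l by (simp add: field_simps)
    then have "norm (a + l *\<^sub>R x) > R" using norm_triangle_ineq2[of "l *\<^sub>R x" "- a"] by (simp add: add.commute)
    then show "\<psi> x = 0" by (simp add: \<psi>_def R)
  qed (simp add: \<psi>_def R)
  have div: "divergence \<psi> x = l * divergence \<phi> (a + l *\<^sub>R x)" for x
  proof -
    have "linear (D (a + l *\<^sub>R x))" using D(1) has_derivative_linear by blast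
    then show ?thesis by (simp add: divergence_eq[OF d] divergence_eq[OF D(1)] sum_distrib_left linear_cmul)
  qed
  have "(LINT x:{x. (x - a) /\<^sub>R l \<in> E}|lborel. divergence \<phi> x)
     = l ^ 3 * (\<integral>x. indicator {x. (x - a) /\<^sub>R l \<in> E} (a + l *\<^sub>R x) * divergence \<phi> (a + l *\<^sub>R x) \<partial>lborel)"
    unfolding set_lebesgue_integral_def using l by (subst integral_lborel_affine[of _ l a]) auto
  also have "\<dots> = l\<^sup>2 * (LINT x:E|lborel. divergence \<psi> x)"
    unfolding set_lebesgue_integral_def using l
    by (simp add: div indicator_def power2_eq_square power3_eq_cube mult_ac flip: Bochner_Integration.integral_mult_right_zero)
  finally have "ennreal (LINT x:{x. (x - a) /\<^sub>R l \<in> E}|lborel. divergence \<phi> x) = ennreal (l\<^sup>2) * ennreal (LINT x:E|lborel. divergence \<psi> x)"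
    by (simp add: ennreal_mult')
  also have "\<dots> \<le> ennreal (l\<^sup>2) * perimeter E" by (intro mult_left_mono perimeter_ge[OF E \<psi>]) simp
  finally show "ennreal (LINT x:{x. (x - a) /\<^sub>R l \<in> E}|lborel. divergence \<phi> x) \<le> ennreal (l\<^sup>2) * perimeter E" .
qed

text \<open>The profile is a function of $|x|^2$ rather than $|x|$, which keeps it smooth at the origin.\<close>

lemma radial_cutoff:
  fixes R d :: real
  assumes R: "R > 0" and d: "d > 0"
  obtains \<eta> :: "real^3 \<Rightarrow> real" and N where "\<And>x. (\<eta> has_derivative (\<lambda>h. N x \<bullet> h)) (at x)" "continuous_on UNIV N"
    "\<And>x. 0 \<le> \<eta> x" "\<And>x. \<eta> x \<le> 1" "\<And>x. norm x < R \<Longrightarrow> \<eta> x = 1 \<and> N x = 0" "\<And>x. norm x \<ge> R + d \<Longrightarrow> \<eta> x = 0 \<and> N x = 0"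
    "\<And>x. norm (N x) \<le> 8 / d"
proof -
  define s where "s = (R + d)\<^sup>2 - R\<^sup>2"
  have s: "s = d * (2 * R + d)" by (simp add: s_def power2_eq_square algebra_simps)
  have s0: "s > 0" using R d by (simp add: s)
  \<comment> \<open>Rises from 0 on the sphere of radius R to 1 on that of radius R + d. Squaring a
    positive part at each end makes the transition C^1 there.\<close>
  define q :: "real^3 \<Rightarrow> real" where "q x = (x \<bullet> x - R\<^sup>2) / s" for x
  define \<eta> where "\<eta> x = (max 0 (1 - (max 0 (q x))\<^sup>2))\<^sup>2" for x
  define N where "N x = (2 * max 0 (1 - (max 0 (q x))\<^sup>2) * (- (2 * max 0 (q x)))) *\<^sub>R ((2 / s) *\<^sub>R x)" for x
  have q: "(q has_derivative (\<lambda>h. ((2 / s) *\<^sub>R x) \<bullet> h)) (at x)" for x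
    unfolding q_def using s0 by (auto intro!: derivative_eq_intros simp: inner_commute fun_eq_iff divide_simps)
  show thesis
  proof
    fix x
    have "((\<lambda>x. 1 - (max 0 (q x))\<^sup>2) has_derivative (\<lambda>h. - (2 * max 0 (q x) * (((2 / s) *\<^sub>R x) \<bullet> h)))) (at x)"
      using has_derivative_diff[OF has_derivative_const
          has_derivative_compose[OF q DERIV_pos_part_square[THEN has_field_derivative_imp_has_derivative], of x], of 1]
      by simp
    from has_derivative_compose[OF this DERIV_pos_part_square[THEN has_field_derivative_imp_has_derivative]]
    show "(\<eta> has_derivative (\<lambda>h. N x \<bullet> h)) (at x)"
      unfolding \<eta>_def by (rule has_derivative_eq_rhs) (simp add: N_def fun_eq_iff)
    show "0 \<le> \<eta> x" by (simp add: \<eta>_def)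
    have m1: "0 \<le> max 0 (1 - (max 0 (q x))\<^sup>2)" "max 0 (1 - (max 0 (q x))\<^sup>2) \<le> 1" by auto
    then show "\<eta> x \<le> 1" by (simp add: \<eta>_def power_le_one)
    have in_q: "q x \<le> 0" if "norm x < R"
    proof -
      have "(norm x)\<^sup>2 \<le> R\<^sup>2" using that by (intro power_mono) auto
      then show ?thesis using s0 by (simp add: q_def power2_norm_eq_inner divide_nonpos_pos)
    qed
    show "\<eta> x = 1 \<and> N x = 0" if "norm x < R"
      using in_q[OF that] by (simp add: \<eta>_def N_def max_absorb1)
    have out_q: "max 0 (1 - (max 0 (q x))\<^sup>2) = 0" if "norm x \<ge> R + d"
    proof -
      have "(R + d)\<^sup>2 \<le> (norm x)\<^sup>2" using that R d by (intro power_mono) auto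
      then have "q x \<ge> 1" using s0 by (simp add: q_def power2_norm_eq_inner s_def)
      then have "1 \<le> (max 0 (q x))\<^sup>2" by (simp add: one_le_power)
      then show ?thesis by simp
    qed
    show "\<eta> x = 0 \<and> N x = 0" if "norm x \<ge> R + d"
      using out_q[OF that] by (simp add: \<eta>_def N_def)
    show "norm (N x) \<le> 8 / d"
    proof (cases "norm x \<ge> R + d")
      case True
      then show ?thesis using out_q[OF True] d by (simp add: N_def)
    next
      case False
      have "(norm x)\<^sup>2 \<le> (R + d)\<^sup>2" using False by (intro power_mono) auto
      then have "q x \<le> 1" using s0 by (simp add: q_def power2_norm_eq_inner s_def)
      then have m2: "0 \<le> max 0 (q x)" "max 0 (q x) \<le> 1" by auto
      have "norm (N x) = 2 * max 0 (1 - (max 0 (q x))\<^sup>2) * (2 * max 0 (q x)) * (2 / s * norm x)"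
        using m1 m2 s0 by (simp add: N_def abs_mult)
      also have "\<dots> \<le> 2 * 1 * (2 * 1) * (2 / s * (R + d))"
        using m1 m2 s0 R d False by (intro mult_mono) auto
      \<comment> \<open>Since s = d (2 R + d), the product equals 8 / d times a ratio at most 1. The
        gradient bound is therefore independent of R.\<close>
      also have "\<dots> = 8 / d * ((R + d) / (2 * R + d))" using R d by (simp add: s field_simps)
      also have "\<dots> \<le> 8 / d * 1" using R d by (intro mult_left_mono) auto
      finally show ?thesis by simp
    qed
  next
    show "continuous_on UNIV N" unfolding N_def q_def using s0 by (auto intro!: continuous_intros)
  qed
qed

section \<open>Cutting a set by a ball\<close>

lemma zero_test_field: "(\<lambda>x. 0) \<in> test_fields" and divergence_zero: "divergence (\<lambda>x. 0) = (\<lambda>x. 0)"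
proof -
  show "(\<lambda>x. 0) \<in> test_fields" by (rule test_fieldsI[of _ "\<lambda>x h. 0" 0]) auto
  have "divergence (\<lambda>x. 0) x = 0" for x
    by (subst divergence_eq[of _ "\<lambda>h. 0"]) auto
  then show "divergence (\<lambda>x. 0) = (\<lambda>x. 0)" by auto
qed

text \<open>Two competing fields, one for each piece, are glued by a cutoff across a shell of width
  d. Convexity keeps the norm at most 1, and the gradient of the cutoff costs at most (8 / d) times
  2 on a part of E of measure at most M d, hence 16 M. The slope M plays the role of the area of E
  on the sphere.\<close>

lemma perimeter_cut_ball:
  fixes E :: "(real^3) set"
  assumes E[measurable]: "E \<in> sets borel" and R: "R > 0" and M: "M \<ge> 0"
    and slope: "\<And>e. e > 0 \<Longrightarrow> \<exists>d>0. d < e \<and> emeasure lborel (E \<inter> (ball 0 (R + d) - ball 0 R)) \<le> ennreal (M * d)"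
  shows "perimeter (E \<inter> ball 0 R) + perimeter (E - ball 0 R) \<le> perimeter E + ennreal (16 * M)"
proof -
  let ?A = "\<lambda>\<phi>. LINT x:E \<inter> ball 0 R|lborel. divergence \<phi> x" and ?B = "\<lambda>\<phi>. LINT x:E - ball 0 R|lborel. divergence \<phi> x"
  have main: "ennreal (?A \<phi> + ?B \<psi>) \<le> perimeter E + ennreal (16 * M)"
    if \<phi>: "\<phi> \<in> test_fields" and \<psi>: "\<psi> \<in> test_fields" for \<phi> \<psi>
  proof (rule ennreal_le_epsilon)
    fix e :: real assume e: "e > 0"
    obtain D1 R1 where D1: "\<And>x. (\<phi> has_derivative D1 x) (at x)" "\<And>h. continuous_on UNIV (\<lambda>x. D1 x h)"
      and R1: "R1 > 0" "\<And>x. norm x > R1 \<Longrightarrow> \<phi> x = 0" "\<And>x. norm (\<phi> x) \<le> 1"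
      using \<phi> by (erule test_fieldsE)
    obtain D2 R2 where D2: "\<And>x. (\<psi> has_derivative D2 x) (at x)" "\<And>h. continuous_on UNIV (\<lambda>x. D2 x h)"
      and R2: "R2 > 0" "\<And>x. norm x > R2 \<Longrightarrow> \<psi> x = 0" "\<And>x. norm (\<psi> x) \<le> 1"
      using \<psi> by (erule test_fieldsE)
    obtain K1 where K1: "K1 > 0" "\<forall>x. \<bar>divergence \<phi> x\<bar> \<le> K1" using divergence_bounded[OF \<phi>] by auto
    obtain K2 where K2: "K2 > 0" "\<forall>x. \<bar>divergence \<psi> x\<bar> \<le> K2" using divergence_bounded[OF \<psi>] by auto
    define K where "K = K1 + K2"
    have K: "K > 0" using K1 K2 by (simp add: K_def)
    \<comment> \<open>Chosen so that the error from the divergences of the two fields on the shell,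
      K M d, stays below e; the added 1 covers M = 0.\<close>
    have "e / (K * (M + 1)) > 0" using e K M by simp
    then obtain d where d: "d > 0" "d < e / (K * (M + 1))"
      and dM: "emeasure lborel (E \<inter> (ball 0 (R + d) - ball 0 R)) \<le> ennreal (M * d)"
      using slope by meson
    have KMd: "K * M * d \<le> e"
    proof -
      have "d * (K * (M + 1)) < e" using d K M by (simp add: pos_less_divide_eq)
      moreover have "d * (K * (M + 1)) = K * M * d + d * K" by (simp add: algebra_simps)
      ultimately show ?thesis using mult_pos_pos[OF d(1) K] by linarith
    qed
    obtain \<eta> :: "real^3 \<Rightarrow> real" and N where \<eta>: "\<And>x. (\<eta> has_derivative (\<lambda>h. N x \<bullet> h)) (at x)" "continuous_on UNIV N"
      "\<And>x. 0 \<le> \<eta> x" "\<And>x. \<eta> x \<le> 1" "\<And>x. norm x < R \<Longrightarrow> \<eta> x = 1 \<and> N x = 0" "\<And>x. norm x \<ge> R + d \<Longrightarrow> \<eta> x = 0 \<and> N x = 0"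
      "\<And>x. norm (N x) \<le> 8 / d"
      by (rule radial_cutoff[OF R d(1)]) metis
    \<comment> \<open>Equal to \<open>\<phi>\<close> on the ball and to \<open>\<psi>\<close> beyond
      the shell.\<close>
    define \<xi> where "\<xi> x = \<eta> x *\<^sub>R \<phi> x + (1 - \<eta> x) *\<^sub>R \<psi> x" for x
    define D where "D x h = \<eta> x *\<^sub>R D1 x h + (1 - \<eta> x) *\<^sub>R D2 x h + (N x \<bullet> h) *\<^sub>R (\<phi> x - \<psi> x)" for x h
    have cont: "continuous_on UNIV \<eta>" "continuous_on UNIV \<phi>" "continuous_on UNIV \<psi>"
      using \<eta>(1) D1(1) D2(1) by (meson continuous_at_imp_continuous_on has_derivative_continuous)+
    have D: "(\<xi> has_derivative D x) (at x)" for x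
      unfolding \<xi>_def D_def
      by (auto intro!: derivative_eq_intros \<eta>(1) D1(1) D2(1) simp: fun_eq_iff algebra_simps)
    have \<xi>: "\<xi> \<in> test_fields"
    proof (rule test_fieldsI[OF D])
      show "continuous_on UNIV (\<lambda>x. D x h)" for h
        unfolding D_def by (intro continuous_intros cont \<eta>(2) D1(2) D2(2))
      show "\<xi> x = 0" if "norm x > max R1 R2" for x using that by (simp add: \<xi>_def R1 R2)
      show "norm (\<xi> x) \<le> 1" for x
      proof -
        have "norm (\<xi> x) \<le> \<eta> x * norm (\<phi> x) + (1 - \<eta> x) * norm (\<psi> x)"
          unfolding \<xi>_def using norm_triangle_ineq[of "\<eta> x *\<^sub>R \<phi> x" "(1 - \<eta> x) *\<^sub>R \<psi> x"] \<eta>(3,4)[of x] by simp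
        also have "\<dots> \<le> \<eta> x * 1 + (1 - \<eta> x) * 1"
          using R1(3) R2(3) \<eta>(3,4)[of x] by (intro add_mono mult_left_mono) auto
        finally show ?thesis by simp
      qed
    qed
    have div: "divergence \<xi> x = \<eta> x * divergence \<phi> x + (1 - \<eta> x) * divergence \<psi> x + N x \<bullet> (\<phi> x - \<psi> x)" for x
      by (simp add: divergence_eq[OF D] divergence_eq[OF D1(1)] divergence_eq[OF D2(1)] D_def inner_axis
          sum.distrib sum_distrib_left inner_vec_def[of "N x" "\<phi> x - \<psi> x"])
    let ?S = "E \<inter> (ball 0 (R + d) - ball 0 R)"
    \<comment> \<open>Off the shell both sides agree. On the shell K bounds the difference of the
      divergences, and 16 / d bounds the gradient of the cutoff paired with
      \<open>\<phi> x - \<psi> x\<close>.\<close>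
    have pt: "indicator (E \<inter> ball 0 R) x * divergence \<phi> x + indicator (E - ball 0 R) x * divergence \<psi> x
      \<le> indicator E x * divergence \<xi> x + (K + 16 / d) * indicator ?S x" for x
    proof -
      consider "x \<notin> E" | "x \<in> E" "norm x < R" | "x \<in> E" "R \<le> norm x" "norm x < R + d" | "x \<in> E" "R + d \<le> norm x" by linarith
      then show ?thesis
      proof cases
        case 3
        have "\<bar>N x \<bullet> (\<phi> x - \<psi> x)\<bar> \<le> norm (N x) * norm (\<phi> x - \<psi> x)" by (rule Cauchy_Schwarz_ineq2)
        also have "\<dots> \<le> 8 / d * 2"
          using \<eta>(7)[of x] norm_triangle_ineq4[of "\<phi> x" "\<psi> x"] R1(3)[of x] R2(3)[of x] d by (intro mult_mono) auto
        finally have 1: "- (16 / d) \<le> N x \<bullet> (\<phi> x - \<psi> x)" by simp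
        have "\<bar>\<eta> x * (divergence \<phi> x - divergence \<psi> x)\<bar> \<le> 1 * K"
          unfolding abs_mult using \<eta>(3,4)[of x] K1(2) K2(2)
          by (intro mult_mono) (auto simp: K_def intro: order_trans[OF abs_triangle_ineq4] add_mono)
        then have "- K \<le> \<eta> x * (divergence \<phi> x - divergence \<psi> x)" by simp
        with 1 3 show ?thesis by (simp add: div algebra_simps)
      next
        case 4
        then show ?thesis using \<eta>(6)[of x] R d by (simp add: div)
      qed (use \<eta>(5)[of x] in \<open>auto simp: div\<close>)
    qed
    have fS: "emeasure lborel ?S < \<infinity>" using dM by (rule le_less_trans) simp
    have mS: "measure lborel ?S \<le> M * d"
      using dM M d by (simp add: measure_def enn2real_leI)
    have int: "integrable lborel (\<lambda>x. indicator F x * divergence \<theta> x)" if "F \<in> sets borel" "\<theta> \<in> test_fields" for F \<theta>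
      using integrable_mult_indicator[of F lborel "divergence \<theta>"] divergence_integrable[OF that(2)] that(1) by simp
    have "?A \<phi> + ?B \<psi> = (\<integral>x. indicator (E \<inter> ball 0 R) x * divergence \<phi> x + indicator (E - ball 0 R) x * divergence \<psi> x \<partial>lborel)"
      unfolding set_lebesgue_integral_def using int \<phi> \<psi> by (subst Bochner_Integration.integral_add) auto
    also have "\<dots> \<le> (\<integral>x. indicator E x * divergence \<xi> x + (K + 16 / d) * indicator ?S x \<partial>lborel)"
    proof (rule Bochner_Integration.integral_mono)
      show "integrable lborel (\<lambda>x. indicator (E \<inter> ball 0 R) x * divergence \<phi> x + indicator (E - ball 0 R) x * divergence \<psi> x)"
        by (intro Bochner_Integration.integrable_add int \<phi> \<psi>) auto
      show "integrable lborel (\<lambda>x. indicator E x * divergence \<xi> x + (K + 16 / d) * indicator ?S x)"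
        using fS by (intro Bochner_Integration.integrable_add int \<xi> integrable_mult_right integrable_real_indicator) auto
    qed (rule pt)
    also have "\<dots> = (LINT x:E|lborel. divergence \<xi> x) + (K + 16 / d) * measure lborel ?S"
      unfolding set_lebesgue_integral_def
      using fS by (subst Bochner_Integration.integral_add)
        (auto intro!: int \<xi> integrable_mult_right integrable_real_indicator)
    also have "\<dots> \<le> (LINT x:E|lborel. divergence \<xi> x) + (K + 16 / d) * (M * d)"
      using mS K d by (intro add_left_mono mult_left_mono) auto
    also have "(K + 16 / d) * (M * d) = K * M * d + 16 * M" using d by (simp add: field_simps)
    also have "(LINT x:E|lborel. divergence \<xi> x) + (K * M * d + 16 * M) \<le> (LINT x:E|lborel. divergence \<xi> x) + (16 * M + e)"
      using KMd by simp
    finally have "ennreal (?A \<phi> + ?B \<psi>) \<le> ennreal ((LINT x:E|lborel. divergence \<xi> x) + (16 * M + e))" by (rule ennreal_leI)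
    also have "\<dots> \<le> ennreal (LINT x:E|lborel. divergence \<xi> x) + ennreal (16 * M + e)"
      using M e by (intro ennreal_add_le) simp
    also have "\<dots> \<le> perimeter E + (ennreal (16 * M) + ennreal e)"
      using M e by (intro add_mono perimeter_ge[OF E \<xi>]) (simp flip: ennreal_plus)
    finally show "ennreal (?A \<phi> + ?B \<psi>) \<le> perimeter E + ennreal (16 * M) + ennreal e" by (simp add: add.assoc)
  qed
  have main': "ennreal (?A \<phi>) + ennreal (?B \<psi>) \<le> perimeter E + ennreal (16 * M)"
    if \<phi>: "\<phi> \<in> test_fields" and \<psi>: "\<psi> \<in> test_fields" for \<phi> \<psi>
  proof -
    \<comment> \<open>The perimeters involve the positive parts of the two integrals separately,
      while \<open>main\<close> controls only their sum. If one integral is negative, its field is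
      exchanged for the zero field.\<close>
    have z: "?A (\<lambda>x. 0) = 0" "?B (\<lambda>x. 0) = 0" by (simp_all add: divergence_zero set_lebesgue_integral_def)
    consider "?A \<phi> \<ge> 0" "?B \<psi> \<ge> 0" | "?A \<phi> \<le> 0" | "?B \<psi> \<le> 0" by linarith
    then show ?thesis
    proof cases
      case 1
      then show ?thesis using main[OF \<phi> \<psi>] by simp
    next
      case 2
      then show ?thesis using main[OF zero_test_field \<psi>] by (simp add: z ennreal_neg)
    next
      case 3
      then show ?thesis using main[OF \<phi> zero_test_field] by (simp add: z ennreal_neg)
    qed
  qed
  have ne: "test_fields \<noteq> {}" using zero_test_field by auto
  have "perimeter (E \<inter> ball 0 R) + perimeter (E - ball 0 R)
     = (SUP \<phi>\<in>test_fields. ennreal (?A \<phi>) + perimeter (E - ball 0 R))"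
    by (subst perimeter_eq[of "E \<inter> ball 0 R"]) (auto intro!: ennreal_SUP_add_left[symmetric] ne)
  also have "\<dots> = (SUP \<phi>\<in>test_fields. SUP \<psi>\<in>test_fields. ennreal (?A \<phi>) + ennreal (?B \<psi>))"
    by (subst perimeter_eq[of "E - ball 0 R"]) (auto intro!: SUP_cong ennreal_SUP_add_right ne)
  also have "\<dots> \<le> perimeter E + ennreal (16 * M)" by (intro SUP_least main')
  finally show ?thesis .
qed


section \<open>Perimeter of the whole space and of balls\<close>

lemma integral_divergence_eq_0:
  assumes \<phi>: "\<phi> \<in> test_fields"
  shows "(\<integral>x. divergence \<phi> x \<partial>lborel) = 0"
proof -
  obtain D R where D: "\<And>x. (\<phi> has_derivative D x) (at x)" "\<And>h. continuous_on UNIV (\<lambda>x. D x h)"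
    and R: "R > 0" "\<And>x. norm x > R \<Longrightarrow> \<phi> x = 0" "\<And>x. norm (\<phi> x) \<le> 1"
    using \<phi> by (erule test_fieldsE)
  have lin: "linear (D x)" for x using D(1) has_derivative_linear by blast
  have comp: "integrable lborel (\<lambda>x. D x (axis i 1) $ i) \<and> (\<integral>x. D x (axis i 1) $ i \<partial>lborel) = 0" for i :: 3
  proof -
    define e :: "real^3" where "e = axis i 1"
    have ne: "norm e = 1" by (simp add: e_def)
    define f where "f x = \<phi> x $ i" for x
    define f' where "f' x = D x e $ i" for x
    have f: "(f has_derivative (\<lambda>h. D x h $ i)) (at x)" for x
      unfolding f_def by (rule bounded_linear.has_derivative[OF bounded_linear_vec_nth D(1)])
    have fc: "continuous_on UNIV f"
      using f by (meson continuous_at_imp_continuous_on has_derivative_continuous)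
    have [measurable]: "f \<in> borel_measurable borel" by (rule borel_measurable_continuous_onI[OF fc])
    have f'c: "continuous_on UNIV f'" unfolding f'_def by (intro continuous_intros D(2))
    have [measurable]: "f' \<in> borel_measurable borel" by (rule borel_measurable_continuous_onI[OF f'c])
    have line: "((\<lambda>t. f (x + t *\<^sub>R e)) has_derivative (\<lambda>t. t * f' (x + s *\<^sub>R e))) (at s)" for x s
    proof -
      have "((\<lambda>t. f (x + t *\<^sub>R e)) has_derivative (\<lambda>t. D (x + s *\<^sub>R e) (t *\<^sub>R e) $ i)) (at s)"
        by (rule has_derivative_compose[of "\<lambda>t. x + t *\<^sub>R e" "\<lambda>t. t *\<^sub>R e", OF _ f])
           (auto intro!: derivative_eq_intros)
      then show ?thesis by (simp add: f'_def linear_cmul[OF lin])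
    qed
    have "bounded (f' ` cball 0 (R + 1))"
      by (intro compact_imp_bounded compact_continuous_image continuous_on_subset[OF f'c]) auto
    then obtain B where B: "B > 0" "\<And>x. x \<in> cball 0 (R + 1) \<Longrightarrow> \<bar>f' x\<bar> \<le> B"
      unfolding bounded_pos by auto
    \<comment> \<open>Difference quotients of one component along its axis. Their integrals vanish
      by translation invariance, the mean value theorem bounds them by B on a fixed ball, and they
      converge to the partial derivative, so dominated convergence applies.\<close>
    define F where "F n x = real (Suc n) * (f (x + (1 / real (Suc n)) *\<^sub>R e) - f x)" for n x
    have Fbd: "\<bar>F n x\<bar> \<le> B * indicator (cball 0 (R + 2)) x" for n x
    proof -
      let ?h = "1 / real (Suc n)"
      have h: "0 < ?h" "?h \<le> 1" by auto
      have "\<exists>s\<in>{0<..<?h}. f (x + ?h *\<^sub>R e) - f (x + 0 *\<^sub>R e) = (\<lambda>t. t * f' (x + s *\<^sub>R e)) (?h - 0)"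
        by (rule mvt_simple) (use line h in \<open>auto intro: has_derivative_at_withinI\<close>)
      then obtain s where s: "0 < s" "s < ?h" "f (x + ?h *\<^sub>R e) - f x = ?h * f' (x + s *\<^sub>R e)" by auto
      then have F: "F n x = f' (x + s *\<^sub>R e)" by (simp add: F_def)
      have s1: "norm (s *\<^sub>R e) \<le> 1" using order.trans[OF less_imp_le[OF s(2)] h(2)] s(1) ne by simp
      have f'0: "f' y = 0" if "norm y > R" for y
        using has_derivative_zero_outside[OF D(1) R(2) that] by (simp add: f'_def)
      show ?thesis
      proof (cases "norm (x + s *\<^sub>R e) > R")
        case True
        then show ?thesis using f'0[OF True] B by (simp add: F)
      next
        case False
        then have "norm x \<le> R + 1" using norm_triangle_ineq2[of x "- (s *\<^sub>R e)"] s1 by simp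
        then show ?thesis using B(2)[of "x + s *\<^sub>R e"] False by (simp add: F)
      qed
    qed
    have iB: "integrable lborel (\<lambda>x. B * indicator (cball (0::real^3) (R + 2)) x)"
      by (intro integrable_mult_right integrable_indicator_ball)
    have lim: "(\<lambda>n. F n x) \<longlonglongrightarrow> f' x" for x
    proof -
      have "((\<lambda>t. f (x + t *\<^sub>R e)) has_real_derivative f' x) (at 0)"
        using line[of x 0] by (simp add: has_field_derivative_def mult_commute_abs)
      then have "((\<lambda>h. (f (x + h *\<^sub>R e) - f x) / h) \<longlongrightarrow> f' x) (at 0)"
        by (simp add: DERIV_def)
      moreover have "filterlim (\<lambda>n. 1 / real (Suc n)) (at 0) sequentially"
        by (rule filterlim_atI[OF LIMSEQ_Suc[OF lim_1_over_n]]) simp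
      ultimately have "(\<lambda>n. (f (x + (1 / real (Suc n)) *\<^sub>R e) - f x) / (1 / real (Suc n))) \<longlonglongrightarrow> f' x"
        by (rule filterlim_compose)
      then show ?thesis by (simp add: F_def mult.commute)
    qed
    have F_meas[measurable]: "F n \<in> borel_measurable borel" for n unfolding F_def by measurable
    have DCT: "integrable lborel f'" "(\<lambda>n. \<integral>x. F n x \<partial>lborel) \<longlonglongrightarrow> (\<integral>x. f' x \<partial>lborel)"
      using lim Fbd by (auto intro!: integrable_dominated_convergence[OF _ _ iB, of _ F] integral_dominated_convergence[OF _ _ iB, of _ F])
    have "(\<integral>x. F n x \<partial>lborel) = 0" for n
    proof -
      have "integrable lborel (\<lambda>x. 1 * indicator (cball (0::real^3) R) x :: real)"
        by (intro integrable_mult_right integrable_indicator_ball)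
      then have fi: "integrable lborel f"
      proof (rule Bochner_Integration.integrable_bound)
        show "AE x in lborel. norm (f x) \<le> norm (1 * indicator (cball (0::real^3) R) x :: real)"
        proof (rule AE_I2)
          fix x
          have "\<bar>f x\<bar> \<le> norm (\<phi> x)" unfolding f_def by (rule component_le_norm_cart)
          then show "norm (f x) \<le> norm (1 * indicator (cball (0::real^3) R) x :: real)"
            using R(2)[of x] R(3)[of x] by (cases "norm x > R") auto
        qed
      qed simp
      have tr: "(\<integral>x. f (x + (1 / real (Suc n)) *\<^sub>R e) \<partial>lborel) = (\<integral>x. f x \<partial>lborel)"
        using integral_lborel_affine[of f 1 "(1 / real (Suc n)) *\<^sub>R e"] by (simp add: add.commute)
      have fi': "integrable lborel (\<lambda>x. f (x + (1 / real (Suc n)) *\<^sub>R e))"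
      proof -
        have "integrable (distr lborel borel ((+) ((1 / real (Suc n)) *\<^sub>R e))) f"
          unfolding lborel_distr_plus by (rule fi)
        then have "integrable lborel (\<lambda>x. f ((1 / real (Suc n)) *\<^sub>R e + x))"
          by (subst (asm) integrable_distr_eq) auto
        then show ?thesis by (simp only: add.commute)
      qed
      show ?thesis unfolding F_def using fi fi' tr by simp
    qed
    with DCT(2) have "(\<integral>x. f' x \<partial>lborel) = 0" by (simp add: LIMSEQ_const_iff)
    moreover have "f' = (\<lambda>x. D x (axis i 1) $ i)" by (simp add: fun_eq_iff f'_def e_def)
    ultimately show ?thesis using DCT(1) by simp
  qed
  have "(\<integral>x. divergence \<phi> x \<partial>lborel) = (\<integral>x. (\<Sum>i\<in>UNIV. D x (axis i 1) $ i) \<partial>lborel)"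
    by (simp add: divergence_eq[OF D(1)])
  also have "\<dots> = 0" using comp by (subst Bochner_Integration.integral_sum) auto
  finally show ?thesis .
qed

lemma perimeter_UNIV: "perimeter UNIV = 0"
proof -
  have "perimeter UNIV \<le> 0"
    by (rule perimeter_le) (simp_all add: set_lebesgue_integral_def integral_divergence_eq_0)
  then show ?thesis by simp
qed

text \<open>The cutting estimate is applied to the whole space, whose perimeter is 0; the volume of
  a thin shell is at most linear in its width. Balls thus provide competitors of finite
  energy.\<close>

lemma perimeter_ball_finite:
  assumes R: "R > 0"
  shows "perimeter (ball 0 R) < \<infinity>"
proof -
  define c where "c = unit_ball_vol 3"
  have c: "c > 0" by (simp add: c_def unit_ball_vol_pos)
  \<comment> \<open>For d \<le> 1 the difference (R + d)^3 - R^3 is at most (3 R^2 + 3 R + 1)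
    d.\<close>
  define M where "M = c * (3 * R\<^sup>2 + 3 * R + 1)"
  have M: "M \<ge> 0" using c R by (simp add: M_def)
  have slope: "\<exists>d>0. d < e \<and> emeasure lborel (UNIV \<inter> (ball (0::real^3) (R + d) - ball 0 R)) \<le> ennreal (M * d)" if "e > 0" for e
  proof (intro exI[of _ "min 1 e / 2"] conjI)
    define d where "d = min 1 e / 2"
    have d: "0 < d" "d \<le> 1" using that by (auto simp: d_def)
    have vol: "emeasure lborel (ball (0::real^3) r) = ennreal (c * r ^ 3)" if "r \<ge> 0" for r
      using that by (simp add: emeasure_ball c_def)
    have "emeasure lborel (ball (0::real^3) (R + d) - ball 0 R) = ennreal (c * (R + d) ^ 3) - ennreal (c * R ^ 3)"
      using R d by (subst emeasure_Diff) (auto simp: vol)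
    also have "\<dots> = ennreal (c * (R + d) ^ 3 - c * R ^ 3)" using R c by (simp add: ennreal_minus)
    also have "\<dots> \<le> ennreal (M * d)"
    proof (rule ennreal_leI)
      have "3 * R * (d * d) + d * d * d \<le> 3 * R * (1 * d) + 1 * 1 * d"
        using R d by (intro add_mono mult_mono mult_left_mono) (auto simp: mult_le_one)
      then have "(R + d) ^ 3 - R ^ 3 \<le> (3 * R\<^sup>2 + 3 * R + 1) * d"
        by (simp add: power2_eq_square power3_eq_cube algebra_simps)
      then have "c * ((R + d) ^ 3 - R ^ 3) \<le> c * ((3 * R\<^sup>2 + 3 * R + 1) * d)" using c by (intro mult_left_mono) auto
      then show "c * (R + d) ^ 3 - c * R ^ 3 \<le> M * d" by (simp add: M_def right_diff_distrib mult.assoc)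
    qed
    finally show "emeasure lborel (UNIV \<inter> (ball (0::real^3) (R + min 1 e / 2) - ball 0 R)) \<le> ennreal (M * (min 1 e / 2))"
      by (simp add: d_def)
  qed (use that in auto)
  have "perimeter (ball 0 R) \<le> perimeter (UNIV \<inter> ball 0 R) + perimeter (UNIV - ball 0 R)" by simp
  also have "\<dots> \<le> perimeter UNIV + ennreal (16 * M)"
    by (rule perimeter_cut_ball[OF _ R M slope]) auto
  also have "\<dots> < \<infinity>" by (simp add: perimeter_UNIV)
  finally show ?thesis .
qed

text \<open>Otherwise v would increase faster than M to the right of every point of [R0, 2 R0], and
  continuous induction would give an increase of at least M R0 > m, more than the range of v
  allows.\<close>

lemma exists_small_slope:
  fixes v :: "real \<Rightarrow> real"
  assumes mono: "\<And>r s. r \<le> s \<Longrightarrow> v r \<le> v s" and bd: "\<And>r. 0 \<le> v r" "\<And>r. v r \<le> m" and R0: "R0 > 0" and M: "m < M * R0"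
  shows "\<exists>R. R0 \<le> R \<and> R \<le> 2 * R0 \<and> (\<forall>e>0. \<exists>d>0. d < e \<and> v (R + d) - v R \<le> M * d)"
proof (rule ccontr)
  assume "\<not> ?thesis"
  then have steep: "\<exists>e>0. \<forall>d>0. d < e \<longrightarrow> v (R + d) - v R > M * d" if "R0 \<le> R" "R \<le> 2 * R0" for R
    using that by (meson not_less)
  have M0: "M > 0" using bd(1)[of 0] bd(2)[of 0] M R0 zero_less_mult_pos2[of M R0] by linarith
  \<comment> \<open>Radii at which the average growth since R0 is still at least M; the
    contradiction comes from their supremum.\<close>
  define S where "S = {r. R0 \<le> r \<and> r \<le> 2 * R0 \<and> v R0 + M * (r - R0) \<le> v r}"
  have S0: "R0 \<in> S" using R0 by (simp add: S_def)
  have bdd: "bdd_above S" by (rule bdd_aboveI[of _ "2 * R0"]) (simp add: S_def)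
  define s where "s = Sup S"
  have s1: "R0 \<le> s" unfolding s_def by (rule cSup_upper[OF S0 bdd])
  have Sne: "S \<noteq> {}" using S0 by blast
  have s2: "s \<le> 2 * R0" unfolding s_def by (rule cSup_least[OF Sne]) (simp add: S_def)
  \<comment> \<open>No continuity of v is involved: by monotonicity v at the supremum dominates v at
    every r in \<open>S\<close>, so the growth inequality persists there.\<close>
  have "s \<le> R0 + (v s - v R0) / M"
    unfolding s_def
  proof (rule cSup_least[OF Sne])
    fix r assume r: "r \<in> S"
    then have "v r \<le> v (Sup S)" by (intro mono cSup_upper bdd)
    then have "M * (r - R0) \<le> v (Sup S) - v R0" using r by (simp add: S_def)
    then show "r \<le> R0 + (v (Sup S) - v R0) / M" using M0 by (simp add: field_simps)
  qed
  then have s3: "v R0 + M * (s - R0) \<le> v s" using M0 by (simp add: field_simps)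
  show False
  proof (cases "s < 2 * R0")
    case True
    obtain e where e: "e > 0" "\<And>d. 0 < d \<Longrightarrow> d < e \<Longrightarrow> v (s + d) - v s > M * d"
      using steep[OF s1 s2] by blast
    define d where "d = min (e / 2) (2 * R0 - s)"
    have d: "0 < d" "d < e" "s + d \<le> 2 * R0" using e True by (auto simp: d_def)
    have "s + d \<in> S" using e(2)[OF d(1,2)] s1 s3 d by (simp add: S_def algebra_simps)
    then have "s + d \<le> s" unfolding s_def by (intro cSup_upper bdd)
    then show False using d by simp
  next
    case False
    then have "s = 2 * R0" using s2 by simp
    then show False using s3 bd(1)[of R0] bd(2)[of s] M by simp
  qed
qed

section \<open>The Yukawa energy\<close>

text \<open>The covariogram of E, that is, the measure of E \<inter> (E + z).\<close>

definition overlap :: "(real^3) set \<Rightarrow> real^3 \<Rightarrow> ennreal" where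
  "overlap E z = emeasure lborel {x \<in> E. x - z \<in> E}"

lemma overlap_eq_nn_integral:
  assumes [measurable]: "E \<in> sets borel"
  shows "overlap E z = (\<integral>\<^sup>+x. indicator E x * indicator E (x - z) \<partial>lborel)"
proof -
  have [measurable]: "{x \<in> E. x - z \<in> E} \<in> sets borel" by measurable
  have "overlap E z = (\<integral>\<^sup>+x. indicator {x \<in> E. x - z \<in> E} x \<partial>lborel)" by (simp add: overlap_def)
  also have "\<dots> = (\<integral>\<^sup>+x. indicator E x * indicator E (x - z) \<partial>lborel)"
    by (intro nn_integral_cong) (simp add: indicator_def)
  finally show ?thesis .
qed

lemma overlap_measurable [measurable]:
  assumes [measurable]: "E \<in> sets borel"
  shows "overlap E \<in> borel_measurable borel"
  unfolding overlap_eq_nn_integral[OF assms, abs_def] by measurable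

lemma overlap_le: "E \<in> sets borel \<Longrightarrow> overlap E z \<le> emeasure lborel E"
  unfolding overlap_def by (rule emeasure_mono) auto

text \<open>Substituting z = x - y and exchanging integrals. Scaling, translating, cutting and
  passing to limits then become pointwise comparisons of covariograms.\<close>

lemma yukawa_energy_eq:
  assumes [measurable]: "E \<in> sets borel"
  shows "yukawa_energy \<alpha> E = (\<integral>\<^sup>+z. yukawa_kernel \<alpha> z * overlap E z \<partial>lborel)"
proof -
  have "yukawa_energy \<alpha> E = (\<integral>\<^sup>+x. (\<integral>\<^sup>+y. yukawa_kernel \<alpha> (x - y) * indicator E y \<partial>lborel) * indicator E x \<partial>lborel)"
    by (simp add: yukawa_energy_def nn_integral_completion yukawa_kernel_def)
  also have "\<dots> = (\<integral>\<^sup>+x. (\<integral>\<^sup>+z. yukawa_kernel \<alpha> z * (indicator E x * indicator E (x - z)) \<partial>lborel) \<partial>lborel)"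
  proof (intro nn_integral_cong)
    fix x
    have "(\<integral>\<^sup>+y. yukawa_kernel \<alpha> (x - y) * indicator E y \<partial>lborel)
       = (\<integral>\<^sup>+z. yukawa_kernel \<alpha> (x - (x - z)) * indicator E (x - z) \<partial>lborel)"
      by (rule nn_integral_lborel_reflect[symmetric]) measurable
    then show "(\<integral>\<^sup>+y. yukawa_kernel \<alpha> (x - y) * indicator E y \<partial>lborel) * indicator E x
      = (\<integral>\<^sup>+z. yukawa_kernel \<alpha> z * (indicator E x * indicator E (x - z)) \<partial>lborel)"
      by (cases "x \<in> E") simp_all
  qed
  also have "\<dots> = (\<integral>\<^sup>+z. (\<integral>\<^sup>+x. yukawa_kernel \<alpha> z * (indicator E x * indicator E (x - z)) \<partial>lborel) \<partial>lborel)"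
    by (rule lborel_pair.Fubini') measurable
  also have "\<dots> = (\<integral>\<^sup>+z. yukawa_kernel \<alpha> z * overlap E z \<partial>lborel)"
    by (intro nn_integral_cong) (simp add: nn_integral_cmult overlap_eq_nn_integral)
  finally show ?thesis .
qed

text \<open>Measure, perimeter and interaction energy ignore null sets. Admissible sets are Lebesgue
  measurable, whereas the arguments with \<open>lborel\<close> want Borel sets; this lemma bridges
  the two.\<close>

lemma borel_representative:
  assumes E: "E \<in> sets lebesgue"
  obtains E' where "E' \<in> sets borel" "emeasure lborel E' = emeasure lebesgue E"
    "perimeter E' = perimeter E" "yukawa_energy \<alpha> E' = yukawa_energy \<alpha> E"
proof
  let ?E = "main_part lborel E"
  show B: "?E \<in> sets borel" using main_part_sets[OF E] by simp
  have BL: "?E \<in> sets lebesgue" using B by simp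
  show "emeasure lborel ?E = emeasure lebesgue E" using E by (simp add: emeasure_completion)
  have AE: "AE x in lebesgue. x \<in> ?E \<longleftrightarrow> x \<in> E"
  proof -
    have eq: "E = ?E \<union> null_part lborel E" using main_part_null_part_Un[OF E] by simp
    \<comment> \<open>E and its Borel main part differ only by a null set.\<close>
    have "null_part lborel E \<in> null_sets lebesgue" 
      using null_part[OF E] by (metis null_sets_completion_iff2 subset_refl)
    then have "AE x in lebesgue. x \<notin> null_part lborel E" by (rule AE_not_in)
    then show ?thesis by eventually_elim (use eq in blast)
  qed
  show "perimeter ?E = perimeter E"
    unfolding perimeter_def set_lebesgue_integral_def
  proof (intro SUP_cong refl arg_cong[where f=ennreal] integral_cong_AE)
    fix \<phi> assume "\<phi> \<in> test_fields"
    then have "divergence \<phi> \<in> borel_measurable lebesgue"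
      using divergence_measurable by (simp add: measurable_completion)
    then show "(\<lambda>x. indicat_real ?E x *\<^sub>R divergence \<phi> x) \<in> borel_measurable lebesgue"
      "(\<lambda>x. indicat_real E x *\<^sub>R divergence \<phi> x) \<in> borel_measurable lebesgue"
      using E BL by measurable
    show "AE x in lebesgue. indicat_real ?E x *\<^sub>R divergence \<phi> x = indicat_real E x *\<^sub>R divergence \<phi> x"
      using AE by eventually_elim (simp add: indicator_def)
  qed
  have inner: "(\<integral>\<^sup>+y\<in>?E. f y \<partial>lebesgue) = (\<integral>\<^sup>+y\<in>E. f y \<partial>lebesgue)" for f
    by (rule nn_integral_cong_AE) (use AE in eventually_elim, simp add: indicator_def)
  show "yukawa_energy \<alpha> ?E = yukawa_energy \<alpha> E"
    unfolding yukawa_energy_def inner ..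
qed

text \<open>Infinite perimeter makes the right side infinite, so competitors can be used without
  checking that their perimeter is finite.\<close>

lemma min_energy_le:
  assumes "E \<in> sets borel" "emeasure lborel E = ennreal m"
  shows "min_energy \<alpha> m \<le> total_energy \<alpha> E"
proof (cases "perimeter E < \<infinity>")
  case True
  then have "E \<in> admissible m" using assms by (simp add: admissible_def finite_perimeter_def)
  then show ?thesis unfolding min_energy_def by (rule INF_lower)
next
  case False
  then show ?thesis by (simp add: total_energy_def not_less top_unique)
qed

lemma min_energy_approx:
  assumes "min_energy \<alpha> m < c"
  obtains E where "E \<in> sets borel" "emeasure lborel E = ennreal m" "total_energy \<alpha> E < c"
proof -
  obtain E where E: "E \<in> admissible m" "total_energy \<alpha> E < c"
    using assms unfolding min_energy_def INF_less_iff by blast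
  then have "E \<in> sets lebesgue" "emeasure lebesgue E = ennreal m" by (auto simp: admissible_def finite_perimeter_def)
  from borel_representative[OF this(1), of \<alpha>] this(2) E(2) show thesis
    using that unfolding total_energy_def by metis
qed

section \<open>Energy of dilated sets\<close>

lemma emeasure_scaled_set:
  fixes E :: "(real^3) set"
  assumes [measurable]: "E \<in> sets borel" and l: "l > 0"
  shows "emeasure lborel {x. x /\<^sub>R l \<in> E} = ennreal (l ^ 3) * emeasure lborel E"
proof -
  have [measurable]: "{x. x /\<^sub>R l \<in> E} \<in> sets borel" by measurable
  have "emeasure lborel {x. x /\<^sub>R l \<in> E} = (\<integral>\<^sup>+x. indicator {x. x /\<^sub>R l \<in> E} x \<partial>lborel)" by simp
  also have "\<dots> = ennreal (l ^ 3) * (\<integral>\<^sup>+x. indicator {x. x /\<^sub>R l \<in> E} (0 + l *\<^sub>R x) \<partial>lborel)"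
    using l by (subst nn_integral_lborel_affine[of _ l 0]) auto
  also have "(\<integral>\<^sup>+x. indicator {x. x /\<^sub>R l \<in> E} (0 + l *\<^sub>R x) \<partial>lborel) = (\<integral>\<^sup>+x. indicator E x \<partial>lborel)"
    using l by (intro nn_integral_cong) (simp add: indicator_def)
  finally show ?thesis by simp
qed

lemma overlap_scaled_set:
  assumes [measurable]: "E \<in> sets borel" and l: "l > 0"
  shows "overlap {x. x /\<^sub>R l \<in> E} z = ennreal (l ^ 3) * overlap E (z /\<^sub>R l)"
proof -
  have [measurable]: "{x. x \<in> E \<and> x - z /\<^sub>R l \<in> E} \<in> sets borel" by measurable
  have "{x \<in> {x. x /\<^sub>R l \<in> E}. x - z \<in> {x. x /\<^sub>R l \<in> E}} = {x. x /\<^sub>R l \<in> {x. x \<in> E \<and> x - z /\<^sub>R l \<in> E}}"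
    by (auto simp: scaleR_diff_right)
  then show ?thesis unfolding overlap_def using emeasure_scaled_set[of "{x. x \<in> E \<and> x - z /\<^sub>R l \<in> E}" l] l by simp
qed

text \<open>If x and x - w lie in E, then either x - (w + h) lies in E as well, or x - w belongs to
  the part of E outside E + h. Along a ray this compares the covariogram at z / l and at z.\<close>

lemma overlap_triangle:
  assumes [measurable]: "E \<in> sets borel"
  shows "overlap E w \<le> overlap E (w + h) + translation_gap E h"
proof -
  have [measurable]: "{x \<in> E. x - (w + h) \<in> E} \<in> sets borel" "{x. x - w \<in> {x \<in> E. x - h \<notin> E}} \<in> sets borel"
     "{x \<in> E. x - h \<notin> E} \<in> sets borel" by measurable
  have "overlap E w \<le> emeasure lborel ({x \<in> E. x - (w + h) \<in> E} \<union> {x. x - w \<in> {x \<in> E. x - h \<notin> E}})"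
    unfolding overlap_def by (intro emeasure_mono) (auto simp: algebra_simps)
  also have "\<dots> \<le> overlap E (w + h) + emeasure lborel {x. x - w \<in> {x \<in> E. x - h \<notin> E}}"
    unfolding overlap_def by (rule emeasure_subadditive) auto
  also have "emeasure lborel {x. x - w \<in> {x \<in> E. x - h \<notin> E}} = translation_gap E h"
    unfolding translation_gap_def by (rule emeasure_lborel_translate) measurable
  finally show ?thesis .
qed

text \<open>The general estimate bounds twice the gap, since an L1 distance counts both one-sided
  differences. The constant is therefore half of the directional moment 4 pi / \<alpha>^3.\<close>

lemma yukawa_kernel_translation_gap:
  assumes a: "\<alpha> > 0" and E[measurable]: "E \<in> sets borel" and fin: "emeasure lborel E < \<infinity>" and t: "t \<ge> 0"
  shows "(\<integral>\<^sup>+z. yukawa_kernel \<alpha> z * translation_gap E (t *\<^sub>R z) \<partial>lborel) \<le> ennreal (t * (2 * pi / \<alpha> ^ 3)) * perimeter E"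
proof -
  let ?I = "\<integral>\<^sup>+z. yukawa_kernel \<alpha> z * translation_gap E (t *\<^sub>R z) \<partial>lborel"
  have "2 * ?I = (\<integral>\<^sup>+z. yukawa_kernel \<alpha> z * (2 * translation_gap E (t *\<^sub>R z)) \<partial>lborel)"
    by (subst nn_integral_cmult[symmetric]) (auto simp: mult_ac)
  also have "\<dots> \<le> ennreal (t * (4 * pi / \<alpha> ^ 3)) * perimeter E"
    by (rule nn_integral_kernel_translation_gap)
       (use a fin t nn_integral_yukawa_kernel_finite[OF a] in \<open>auto simp: nn_integral_yukawa_kernel_abs_inner\<close>)
  also have "t * (4 * pi / \<alpha> ^ 3) = 2 * (t * (2 * pi / \<alpha> ^ 3))" by simp
  also have "ennreal \<dots> = 2 * ennreal (t * (2 * pi / \<alpha> ^ 3))" using t a by (subst ennreal_mult) auto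
  finally have "2 * ?I \<le> 2 * (ennreal (t * (2 * pi / \<alpha> ^ 3)) * perimeter E)" by (simp add: mult.assoc)
  then show ?thesis by (subst (asm) ennreal_mult_le_mult_iff) auto
qed

lemma total_energy_scaled_set:
  assumes a: "\<alpha> > 0" and E[measurable]: "E \<in> sets borel" and fin: "emeasure lborel E < \<infinity>" and l: "l \<ge> 1"
  shows "total_energy \<alpha> {x. x /\<^sub>R l \<in> E} \<le> ennreal (l ^ 3) *
     (yukawa_energy \<alpha> E + ennreal (1 / l + (1 - 1 / l) * (2 * pi / \<alpha> ^ 3)) * perimeter E)"
proof -
  \<comment> \<open>The shift t z leads from z / l back to z.\<close>
  define t where "t = 1 - 1 / l"
  have l0: "l > 0" and t: "t \<ge> 0" using l by (auto simp: t_def)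
  have [measurable]: "{x. x /\<^sub>R l \<in> E} \<in> sets borel" by measurable
  have "yukawa_energy \<alpha> {x. x /\<^sub>R l \<in> E} = (\<integral>\<^sup>+z. ennreal (l ^ 3) * (yukawa_kernel \<alpha> z * overlap E (z /\<^sub>R l)) \<partial>lborel)"
    using l0 by (simp add: yukawa_energy_eq overlap_scaled_set mult_ac)
  also have "\<dots> = ennreal (l ^ 3) * (\<integral>\<^sup>+z. yukawa_kernel \<alpha> z * overlap E (z /\<^sub>R l) \<partial>lborel)"
    by (rule nn_integral_cmult) measurable
  also have "(\<integral>\<^sup>+z. yukawa_kernel \<alpha> z * overlap E (z /\<^sub>R l) \<partial>lborel)
     \<le> (\<integral>\<^sup>+z. yukawa_kernel \<alpha> z * overlap E z + yukawa_kernel \<alpha> z * translation_gap E (t *\<^sub>R z) \<partial>lborel)"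
  proof (intro nn_integral_mono)
    fix z :: "real^3"
    have "z /\<^sub>R l + t *\<^sub>R z = z" using l0 by (simp add: t_def divide_inverse flip: scaleR_add_left)
    then have "overlap E (z /\<^sub>R l) \<le> overlap E z + translation_gap E (t *\<^sub>R z)"
      using overlap_triangle[OF E, of "z /\<^sub>R l" "t *\<^sub>R z"] by simp
    then show "yukawa_kernel \<alpha> z * overlap E (z /\<^sub>R l) \<le> yukawa_kernel \<alpha> z * overlap E z + yukawa_kernel \<alpha> z * translation_gap E (t *\<^sub>R z)"
      by (simp add: mult_left_mono flip: distrib_left)
  qed
  also have "\<dots> = yukawa_energy \<alpha> E + (\<integral>\<^sup>+z. yukawa_kernel \<alpha> z * translation_gap E (t *\<^sub>R z) \<partial>lborel)"
    by (subst nn_integral_add) (auto simp: yukawa_energy_eq)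
  also have "\<dots> \<le> yukawa_energy \<alpha> E + ennreal (t * (2 * pi / \<alpha> ^ 3)) * perimeter E"
    by (intro add_left_mono yukawa_kernel_translation_gap a E fin t)
  finally have N: "yukawa_energy \<alpha> {x. x /\<^sub>R l \<in> E}
     \<le> ennreal (l ^ 3) * (yukawa_energy \<alpha> E + ennreal (t * (2 * pi / \<alpha> ^ 3)) * perimeter E)"
    by (simp add: mult_left_mono)
  have "perimeter {x. x /\<^sub>R l \<in> E} \<le> ennreal (l\<^sup>2) * perimeter E"
    using perimeter_affine_le[OF E l0, of 0] by simp
  \<comment> \<open>Relative to volume the perimeter loses the factor 1 / l; this loss pays for the
    growth of the interaction energy.\<close>
  also have "l\<^sup>2 = l ^ 3 * (1 / l)" using l0 by (simp add: power2_eq_square power3_eq_cube)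
  also have "ennreal (l ^ 3 * (1 / l)) = ennreal (l ^ 3) * ennreal (1 / l)" using l0 by (subst ennreal_mult') auto
  finally have P: "perimeter {x. x /\<^sub>R l \<in> E} \<le> ennreal (l ^ 3) * (ennreal (1 / l) * perimeter E)" by (simp add: mult.assoc)
  have "total_energy \<alpha> {x. x /\<^sub>R l \<in> E} \<le> ennreal (l ^ 3) * (ennreal (1 / l) * perimeter E) +
     ennreal (l ^ 3) * (yukawa_energy \<alpha> E + ennreal (t * (2 * pi / \<alpha> ^ 3)) * perimeter E)"
    unfolding total_energy_def by (intro add_mono N P)
  also have "\<dots> = ennreal (l ^ 3) * (yukawa_energy \<alpha> E + (ennreal (1 / l) + ennreal (t * (2 * pi / \<alpha> ^ 3))) * perimeter E)"
    by (simp add: distrib_left distrib_right add_ac)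
  also have "ennreal (1 / l) + ennreal (t * (2 * pi / \<alpha> ^ 3)) = ennreal (1 / l + t * (2 * pi / \<alpha> ^ 3))"
    using t l0 a by (subst ennreal_plus) auto
  finally show ?thesis by (simp add: t_def)
qed

section \<open>Sparse sets and a weak isoperimetric inequality\<close>

lemma nn_integral_ball_translation_gap:
  fixes E :: "(real^3) set"
  assumes E[measurable]: "E \<in> sets borel" and fin: "emeasure lborel E < \<infinity>" and s: "s > 0"
  shows "(\<integral>\<^sup>+z. indicator (ball 0 s) z * (2 * translation_gap E z) \<partial>lborel)
     \<le> ennreal s * emeasure lborel (ball (0::real^3) s) * perimeter E"
proof -
  define b where "b = measure lborel (ball (0::real^3) s)"
  have b: "emeasure lborel (ball (0::real^3) s) = ennreal b"
    unfolding b_def using emeasure_lborel_ball_finite[of "0::real^3" s] by (intro emeasure_eq_ennreal_measure) auto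
  \<comment> \<open>The ball indicator serves as kernel: its directional moments are at most s times
    its mass, because |z . u| \<le> |z| < s.\<close>
  have "(\<integral>\<^sup>+z. indicator (ball 0 s) z * (2 * translation_gap E (1 *\<^sub>R z)) \<partial>lborel) \<le> ennreal (1 * (s * b)) * perimeter E"
  proof (rule nn_integral_kernel_translation_gap)
    show "(\<integral>\<^sup>+z. indicator (ball (0::real^3) s) z \<partial>lborel) < \<infinity>" using b by simp
    fix u :: "real^3" assume u: "norm u = 1"
    have "(\<integral>\<^sup>+z. indicator (ball 0 s) z * ennreal \<bar>z \<bullet> u\<bar> \<partial>lborel) \<le> (\<integral>\<^sup>+z. ennreal s * indicator (ball (0::real^3) s) z \<partial>lborel)"
    proof (intro nn_integral_mono)
      fix z :: "real^3"
      have "\<bar>z \<bullet> u\<bar> \<le> norm z" using Cauchy_Schwarz_ineq2[of z u] u by simp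
      then show "indicator (ball 0 s) z * ennreal \<bar>z \<bullet> u\<bar> \<le> ennreal s * indicator (ball 0 s) z"
        by (auto simp: indicator_def intro!: ennreal_leI)
    qed
    also have "\<dots> = ennreal (s * b)" using s b by (subst nn_integral_cmult_indicator) (auto simp: ennreal_mult')
    finally show "(\<integral>\<^sup>+z. indicator (ball 0 s) z * ennreal \<bar>z \<bullet> u\<bar> \<partial>lborel) \<le> ennreal (s * b)" .
  qed (use fin in auto)
  then show ?thesis using s by (simp add: b ennreal_mult')
qed

text \<open>From each point of E at least half of the surrounding ball lies outside E. Integrating
  over E gives that |B| |E| is at most the integral of twice the translation gap over the ball B,
  which the previous estimate bounds by s |B| P(E).\<close>

lemma perimeter_ge_if_sparse:
  fixes E :: "(real^3) set"
  assumes E[measurable]: "E \<in> sets borel" and fin: "emeasure lborel E < \<infinity>" and s: "s > 0"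
    and sparse: "\<And>x. 2 * emeasure lborel (E \<inter> ball x s) \<le> emeasure lborel (ball (0::real^3) s)"
  shows "emeasure lborel E \<le> ennreal s * perimeter E"
proof -
  let ?B = "emeasure lborel (ball (0::real^3) s)"
  have "unit_ball_vol 3 \<noteq> 0" using unit_ball_vol_pos[of 3] by linarith
  then have B: "?B < \<infinity>" "?B \<noteq> 0" using s
    by (auto simp: emeasure_lborel_ball_finite emeasure_ball)
  have ball_translate: "emeasure lborel (ball x s) = ?B" for x :: "real^3"
    using s by (simp add: emeasure_ball)
  have half: "?B \<le> 2 * emeasure lborel (ball x s - E)" for x
  proof -
    have "2 * ?B = 2 * (emeasure lborel (E \<inter> ball x s) + emeasure lborel (ball x s - E))"
    proof -
      have "E \<inter> ball x s \<union> (ball x s - E) = ball x s" by blast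
      then show ?thesis by (subst plus_emeasure) (auto simp: ball_translate[of x, symmetric])
    qed
    also have "\<dots> \<le> ?B + 2 * emeasure lborel (ball x s - E)"
      using sparse[of x] by (simp add: distrib_left add_right_mono)
    finally have "?B + ?B \<le> ?B + 2 * emeasure lborel (ball x s - E)" by (simp add: mult_2)
    then show ?thesis using B by (auto simp: ennreal_add_left_cancel_le)
  qed
  have "?B * emeasure lborel E = (\<integral>\<^sup>+x. ?B * indicator E x \<partial>lborel)" by (subst nn_integral_cmult_indicator) auto
  also have "\<dots> \<le> (\<integral>\<^sup>+x. 2 * (emeasure lborel (ball x s - E) * indicator E x) \<partial>lborel)"
    using half by (intro nn_integral_mono) (auto simp: indicator_def)
  also have "\<dots> = (\<integral>\<^sup>+x. (\<integral>\<^sup>+z. 2 * (indicator (ball 0 s) z * (indicator E x * indicator (- E) (x - z))) \<partial>lborel) \<partial>lborel)"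
  proof (intro nn_integral_cong)
    fix x
    have "emeasure lborel (ball x s - E) = (\<integral>\<^sup>+y. indicator (ball x s - E) y \<partial>lborel)" by simp
    also have "\<dots> = (\<integral>\<^sup>+z. indicator (ball x s - E) (x - z) \<partial>lborel)"
      by (rule nn_integral_lborel_reflect[symmetric]) measurable
    also have "\<dots> = (\<integral>\<^sup>+z. indicator (ball 0 s) z * indicator (- E) (x - z) \<partial>lborel)"
      by (intro nn_integral_cong) (simp add: indicator_def dist_norm)
    finally show "2 * (emeasure lborel (ball x s - E) * indicator E x) = 
       (\<integral>\<^sup>+z. 2 * (indicator (ball 0 s) z * (indicator E x * indicator (- E) (x - z))) \<partial>lborel)"
      by (cases "x \<in> E") (auto simp: nn_integral_cmult)
  qed
  also have "\<dots> = (\<integral>\<^sup>+z. (\<integral>\<^sup>+x. 2 * (indicator (ball 0 s) z * (indicator E x * indicator (- E) (x - z))) \<partial>lborel) \<partial>lborel)"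
    by (rule lborel_pair.Fubini') measurable
  also have "\<dots> = (\<integral>\<^sup>+z. indicator (ball 0 s) z * (2 * translation_gap E z) \<partial>lborel)"
  proof (intro nn_integral_cong)
    fix z :: "real^3"
    have "(\<integral>\<^sup>+x. 2 * (indicator (ball 0 s) z * (indicator E x * indicator (- E) (x - z))) \<partial>lborel)
      = 2 * (indicator (ball 0 s) z * translation_gap E z)"
      by (simp add: nn_integral_cmult translation_gap_eq_nn_integral)
    then show "(\<integral>\<^sup>+x. 2 * (indicator (ball 0 s) z * (indicator E x * indicator (- E) (x - z))) \<partial>lborel)
      = indicator (ball 0 s) z * (2 * translation_gap E z)"
      by (simp add: mult_ac)
  qed
  also have "\<dots> \<le> ennreal s * ?B * perimeter E" by (rule nn_integral_ball_translation_gap[OF E fin s])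
  finally have "?B * emeasure lborel E \<le> ?B * (ennreal s * perimeter E)" by (simp add: mult_ac)
  then show ?thesis using B by (subst (asm) ennreal_mult_le_mult_iff) auto
qed

section \<open>Mass dependence of the minimal energy\<close>

lemma emeasure_ball3:
  assumes "r \<ge> 0"
  shows "emeasure lborel (ball (x::real^3) r) = ennreal (unit_ball_vol 3 * r ^ 3)"
  using assms by (simp add: emeasure_ball)

lemma exists_ball_of_volume:
  assumes m: "m > 0"
  obtains r where "r > 0" "\<And>x. emeasure lborel (ball (x::real^3) r) = ennreal m"
proof -
  have c: "unit_ball_vol 3 > 0" by (rule unit_ball_vol_pos) simp
  then have c0: "unit_ball_vol 3 \<noteq> 0" by linarith
  define r where "r = root 3 (m / unit_ball_vol 3)"
  have r: "r > 0" using m c by (simp add: r_def)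
  have "r ^ 3 = m / unit_ball_vol 3" unfolding r_def using m c by (intro real_root_pow_pos) auto
  then have "emeasure lborel (ball x r) = ennreal m" for x :: "real^3"
    using r c0 by (simp add: emeasure_ball3)
  with r that show thesis by blast
qed

text \<open>A set of mass m fills at most half of any ball of volume 2 m, so the sparse-set estimate
  applies at that radius and gives p = m / s. This is all that is used of the isoperimetric
  inequality in the strict monotonicity.\<close>

lemma perimeter_lower_bound:
  assumes m: "m > 0"
  obtains p where "p > 0" "\<And>E. E \<in> sets borel \<Longrightarrow> emeasure lborel E = ennreal m \<Longrightarrow> ennreal p \<le> perimeter E"
proof -
  obtain s where s: "s > 0" "\<And>x. emeasure lborel (ball (x::real^3) s) = ennreal (2 * m)"
    using exists_ball_of_volume[of "2 * m"] m by auto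
  have "ennreal (m / s) \<le> perimeter E" if E: "E \<in> sets borel" "emeasure lborel E = ennreal m" for E
  proof -
    have "emeasure lborel E \<le> ennreal s * perimeter E"
    proof (rule perimeter_ge_if_sparse)
      fix x
      have "emeasure lborel (E \<inter> ball x s) \<le> emeasure lborel E" using E by (intro emeasure_mono) auto
      then have "2 * emeasure lborel (E \<inter> ball x s) \<le> 2 * ennreal m" using E by (intro mult_left_mono) auto
      also have "\<dots> = ennreal (2 * m)" using m by (subst ennreal_mult) auto
      finally show "2 * emeasure lborel (E \<inter> ball x s) \<le> emeasure lborel (ball (0::real^3) s)" by (simp add: s)
    qed (use E s in auto)
    moreover have "ennreal s * ennreal (m / s) = ennreal m" using s(1) m by (subst ennreal_mult[symmetric]) auto
    ultimately have "ennreal s * ennreal (m / s) \<le> ennreal s * perimeter E" using E by simp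
    then show ?thesis using s(1) by (subst (asm) ennreal_mult_le_mult_iff) auto
  qed
  with m s(1) show thesis by (intro that[of "m / s"]) auto
qed

lemma yukawa_energy_finite:
  assumes a: "\<alpha> > 0" and E[measurable]: "E \<in> sets borel" and fin: "emeasure lborel E < \<infinity>"
  shows "yukawa_energy \<alpha> E < \<infinity>"
proof -
  have "yukawa_energy \<alpha> E \<le> (\<integral>\<^sup>+z. yukawa_kernel \<alpha> z * emeasure lborel E \<partial>lborel)"
    unfolding yukawa_energy_eq[OF E] by (intro nn_integral_mono mult_left_mono overlap_le E) simp
  also have "\<dots> = (\<integral>\<^sup>+z. yukawa_kernel \<alpha> z \<partial>lborel) * emeasure lborel E"
    by (rule nn_integral_multc) measurable
  also have "\<dots> < \<infinity>" using nn_integral_yukawa_kernel_finite[OF a] fin by (simp add: ennreal_mult_less_top)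
  finally show ?thesis .
qed

lemma min_energy_finite:
  assumes a: "\<alpha> > 0" and m: "m > 0"
  shows "min_energy \<alpha> m < \<infinity>"
proof -
  obtain r where r: "r > 0" "\<And>x. emeasure lborel (ball (x::real^3) r) = ennreal m"
    using exists_ball_of_volume[OF m] by auto
  have "min_energy \<alpha> m \<le> total_energy \<alpha> (ball 0 r)" by (rule min_energy_le) (auto simp: r)
  also have "\<dots> < \<infinity>"
    unfolding total_energy_def using perimeter_ball_finite[OF r(1)] yukawa_energy_finite[OF a, of "ball 0 r"] r(2) by simp
  finally show ?thesis .
qed

text \<open>A real-valued copy, so that energies can be subtracted and compared by linear
  arithmetic.\<close>

definition min_energy_real :: "real \<Rightarrow> real \<Rightarrow> real" where
  "min_energy_real \<alpha> m = enn2real (min_energy \<alpha> m)"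

lemma min_energy_real_nonneg [simp]: "0 \<le> min_energy_real \<alpha> m"
  by (simp add: min_energy_real_def)

lemma min_energy_eq_real: "\<alpha> > 0 \<Longrightarrow> m > 0 \<Longrightarrow> min_energy \<alpha> m = ennreal (min_energy_real \<alpha> m)"
  unfolding min_energy_real_def using min_energy_finite by simp

text \<open>A near-minimizer of mass m is dilated to mass m'. The gain in energy is a fixed fraction
  of its perimeter, which is at least p for every set of mass m; hence the gain does not disappear
  when the near-minimizers approach the infimum.\<close>

lemma min_energy_per_mass_strict_antimono:
  assumes a: "\<alpha> > 0" and a3: "\<alpha> ^ 3 > 2 * pi" and m: "0 < m" "m < m'"
  shows "min_energy_real \<alpha> m' / m' < min_energy_real \<alpha> m / m"
proof -
  define k where "k = 2 * pi / \<alpha> ^ 3"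
  have k: "0 < k" "k < 1" using a a3 by (auto simp: k_def)
  define l where "l = root 3 (m' / m)"
  have "m' / m > 1" using m by simp
  then have l1: "l > 1" unfolding l_def by simp
  have l3: "l ^ 3 = m' / m" unfolding l_def using m by (intro real_root_pow_pos) auto
  obtain p where p: "p > 0" "\<And>E. E \<in> sets borel \<Longrightarrow> emeasure lborel E = ennreal m \<Longrightarrow> ennreal p \<le> perimeter E"
    using perimeter_lower_bound[OF m(1)] by auto
  let ?e = "min_energy_real \<alpha>"
  have m': "m' > 0" using m by simp
  \<comment> \<open>The fraction of the perimeter that is gained, per unit of l^3: dilation saves (1
    - 1 / l) P, and the interaction takes back at most k times that.\<close>
  define c where "c = (1 - 1 / l) * (1 - k)"
  have c: "c > 0" using l1 k by (simp add: c_def)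
  have "?e m' \<le> l ^ 3 * (?e m - c * p)"
  proof (rule field_le_epsilon)
    fix d :: real assume d: "d > 0"
    \<comment> \<open>The error is multiplied by l^3 under dilation.\<close>
    define d' where "d' = d / l ^ 3"
    have d': "d' > 0" using d l1 by (simp add: d'_def)
    have e0: "?e m \<ge> 0" by (simp add: min_energy_real_def)
    have "min_energy \<alpha> m < ennreal (?e m + d')"
      using d' e0 by (simp add: min_energy_eq_real[OF a m(1)] ennreal_less_iff)
    then obtain E where E: "E \<in> sets borel" "emeasure lborel E = ennreal m" "total_energy \<alpha> E < ennreal (?e m + d')"
      by (rule min_energy_approx)
    obtain P where P: "perimeter E = ennreal P" "P \<ge> 0"
      using E(3) unfolding total_energy_def by (cases "perimeter E") auto
    obtain N where N: "yukawa_energy \<alpha> E = ennreal N" "N \<ge> 0"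
      using E(3) unfolding total_energy_def by (cases "yukawa_energy \<alpha> E") auto
    have PN: "P + N < ?e m + d'"
      using E(3) P(2) N(2) unfolding total_energy_def P N by (simp add: ennreal_less_iff flip: ennreal_plus)
    have pP: "p \<le> P" using p(2)[OF E(1,2)] P p(1) by simp
    have "ennreal (?e m') = min_energy \<alpha> m'" using min_energy_eq_real[OF a m'] by simp
    also have "\<dots> \<le> total_energy \<alpha> {x. x /\<^sub>R l \<in> E}"
    proof (rule min_energy_le)
      show "{x. x /\<^sub>R l \<in> E} \<in> sets borel" using E(1) by measurable
      have "emeasure lborel {x. x /\<^sub>R l \<in> E} = ennreal (l ^ 3) * ennreal m"
        using emeasure_scaled_set[OF E(1), of l] l1 E(2) by simp
      also have "\<dots> = ennreal m'" using m l1 by (subst ennreal_mult[symmetric]) (auto simp: l3)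
      finally show "emeasure lborel {x. x /\<^sub>R l \<in> E} = ennreal m'" .
    qed
    also have "\<dots> \<le> ennreal (l ^ 3) * (yukawa_energy \<alpha> E + ennreal (1 / l + (1 - 1 / l) * k) * perimeter E)"
      unfolding k_def by (rule total_energy_scaled_set[OF a E(1)]) (use E(2) l1 in auto)
    also have "\<dots> = ennreal (l ^ 3 * (N + (1 / l + (1 - 1 / l) * k) * P))"
      using l1 k P N by (simp add: P N ennreal_mult ennreal_plus)
    finally have "?e m' \<le> l ^ 3 * (N + (1 / l + (1 - 1 / l) * k) * P)"
      using l1 k P N by (subst (asm) ennreal_le_iff) auto
    also have "N + (1 / l + (1 - 1 / l) * k) * P = P + N - c * P" by (simp add: c_def algebra_simps diff_divide_distrib)
    also have "l ^ 3 * (P + N - c * P) \<le> l ^ 3 * (?e m + d' - c * p)"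
    proof (rule mult_left_mono)
      have "c * p \<le> c * P" using pP c by (intro mult_left_mono) auto
      then show "P + N - c * P \<le> ?e m + d' - c * p" using PN by linarith
    qed (use l1 in simp)
    also have "\<dots> = l ^ 3 * (?e m - c * p) + d" using l1 by (simp add: d'_def algebra_simps)
    finally show "?e m' \<le> l ^ 3 * (?e m - c * p) + d" .
  qed
  also have "\<dots> < l ^ 3 * ?e m" using c p l1 by (intro mult_strict_left_mono) auto
  finally show ?thesis using m m' by (simp add: l3 field_simps)
qed

section \<open>Tightness of minimizing sequences\<close>

lemma total_energy_translate_le:
  assumes E[measurable]: "E \<in> sets borel"
  shows "total_energy \<alpha> {x. x - a \<in> E} \<le> total_energy \<alpha> E"
proof -
  have [measurable]: "{x. x - a \<in> E} \<in> sets borel" by measurable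
  have "overlap {x. x - a \<in> E} z = overlap E z" for z
  proof -
    have [measurable]: "{y \<in> E. y - z \<in> E} \<in> sets borel" by measurable
    have "{x \<in> {x. x - a \<in> E}. x - z \<in> {x. x - a \<in> E}} = {x. x - a \<in> {y \<in> E. y - z \<in> E}}"
      by (auto simp: algebra_simps)
    then show ?thesis unfolding overlap_def by (simp add: emeasure_lborel_translate[of "{y \<in> E. y - z \<in> E}" a, simplified])
  qed
  then have "yukawa_energy \<alpha> {x. x - a \<in> E} = yukawa_energy \<alpha> E" by (simp add: yukawa_energy_eq)
  moreover have "perimeter {x. x - a \<in> E} \<le> perimeter E"
    using perimeter_affine_le[OF E, of 1 a] by simp
  ultimately show ?thesis unfolding total_energy_def by (simp add: add_right_mono)
qed

text \<open>Excludes vanishing: if every ball of radius s were at most half full, the sparse-set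
  estimate would give m \<le> s C, which the choice of s makes impossible. Both constants depend on
  m and C only, so they serve a whole minimizing sequence.\<close>

lemma concentration:
  assumes m: "m > 0" and C: "C \<ge> 0"
  obtains s c where "s > 0" "c > 0" "\<And>E. E \<in> sets borel \<Longrightarrow> emeasure lborel E = ennreal m \<Longrightarrow> perimeter E \<le> ennreal C
     \<Longrightarrow> \<exists>x. ennreal c \<le> emeasure lborel (E \<inter> ball (x::real^3) s)"
proof -
  \<comment> \<open>Makes s C at most m / 2; the added 1 covers C = 0.\<close>
  define s where "s = m / (2 * (C + 1))"
  have s: "s > 0" using m C by (simp add: s_def)
  define b where "b = unit_ball_vol 3 * s ^ 3"
  have "unit_ball_vol 3 > 0" by (rule unit_ball_vol_pos) simp
  then have b: "b > 0" unfolding b_def using s by (intro mult_pos_pos) auto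
  have "\<exists>x. ennreal (b / 2) \<le> emeasure lborel (E \<inter> ball (x::real^3) s)"
    if E: "E \<in> sets borel" "emeasure lborel E = ennreal m" "perimeter E \<le> ennreal C" for E
  proof (rule ccontr)
    assume "\<not> ?thesis"
    then have small: "emeasure lborel (E \<inter> ball x s) \<le> ennreal (b / 2)" for x by (meson le_cases)
    have "emeasure lborel E \<le> ennreal s * perimeter E"
    proof (rule perimeter_ge_if_sparse)
      fix x
      have "2 * emeasure lborel (E \<inter> ball x s) \<le> 2 * ennreal (b / 2)" by (intro mult_left_mono small) simp
      also have "\<dots> = ennreal (2 * (b / 2))" using b by (subst ennreal_mult) auto
      finally show "2 * emeasure lborel (E \<inter> ball x s) \<le> emeasure lborel (ball (0::real^3) s)"
        using s by (simp add: emeasure_ball3 b_def)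
    qed (use E s in auto)
    also have "\<dots> \<le> ennreal s * ennreal C" using E by (intro mult_left_mono) auto
    also have "\<dots> = ennreal (s * C)" using s C by (simp add: ennreal_mult)
    finally have "m \<le> s * C" using E(2) s C by simp
    also have "s * C \<le> m / 2"
    proof -
      have "m * C \<le> m * (C + 1)" using m by simp
      then show ?thesis using C by (simp add: s_def field_simps)
    qed
    finally show False using m by simp
  qed
  with s b show thesis by (intro that[of s "b / 2"]) auto
qed

text \<open>Read geometrically, the energy at a smaller mass lies on or above the chord from the
  origin to the point of the energy curve at m'. Splitting the mass is penalized by comparing the
  pieces with such chords.\<close>

lemma min_energy_per_mass_antimono:
  assumes a: "\<alpha> > 0" and a3: "\<alpha> ^ 3 > 2 * pi" and m: "0 < m" "m \<le> m'"
  shows "m * (min_energy_real \<alpha> m' / m') \<le> min_energy_real \<alpha> m"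
proof -
  have "min_energy_real \<alpha> m' / m' \<le> min_energy_real \<alpha> m / m"
    using min_energy_per_mass_strict_antimono[OF a a3 m(1), of m'] m by (cases "m = m'") auto
  then have "m * (min_energy_real \<alpha> m' / m') \<le> m * (min_energy_real \<alpha> m / m)" using m by (intro mult_left_mono) auto
  then show ?thesis using m by simp
qed

text \<open>The covariograms of the two pieces measure disjoint subsets of the one of E, so dropping
  the interaction between the pieces cannot raise the energy; only the perimeter of the cut
  costs.\<close>

lemma total_energy_cut_ball:
  assumes a: "\<alpha> > 0" and E[measurable]: "E \<in> sets borel" and R: "R > 0" and M: "M \<ge> 0"
    and slope: "\<And>e. e > 0 \<Longrightarrow> \<exists>d>0. d < e \<and> emeasure lborel (E \<inter> (ball 0 (R + d) - ball 0 R)) \<le> ennreal (M * d)"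
  shows "total_energy \<alpha> (E \<inter> ball 0 R) + total_energy \<alpha> (E - ball 0 R) \<le> total_energy \<alpha> E + ennreal (16 * M)"
proof -
  let ?A = "E \<inter> ball 0 R" and ?C = "E - ball 0 R"
  have AC: "?A \<in> sets borel" "?C \<in> sets borel" by auto
  have "overlap ?A z + overlap ?C z \<le> overlap E z" for z
  proof -
    have [measurable]: "{x \<in> ?A. x - z \<in> ?A} \<in> sets borel" "{x \<in> ?C. x - z \<in> ?C} \<in> sets borel" "{x \<in> E. x - z \<in> E} \<in> sets borel"
      by measurable
    have "overlap ?A z + overlap ?C z = emeasure lborel ({x \<in> ?A. x - z \<in> ?A} \<union> {x \<in> ?C. x - z \<in> ?C})"
      unfolding overlap_def by (rule plus_emeasure) auto
    also have "\<dots> \<le> overlap E z" unfolding overlap_def by (rule emeasure_mono) auto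
    finally show ?thesis .
  qed
  then have "(\<integral>\<^sup>+z. yukawa_kernel \<alpha> z * (overlap ?A z + overlap ?C z) \<partial>lborel) \<le> yukawa_energy \<alpha> E"
    unfolding yukawa_energy_eq[OF E] by (intro nn_integral_mono mult_left_mono) auto
  also have "(\<integral>\<^sup>+z. yukawa_kernel \<alpha> z * (overlap ?A z + overlap ?C z) \<partial>lborel) = yukawa_energy \<alpha> ?A + yukawa_energy \<alpha> ?C"
    unfolding yukawa_energy_eq[OF AC(1)] yukawa_energy_eq[OF AC(2)] using overlap_measurable[OF AC(1)] overlap_measurable[OF AC(2)]
    by (subst nn_integral_add[symmetric]) (auto simp: distrib_left)
  finally have N: "yukawa_energy \<alpha> ?A + yukawa_energy \<alpha> ?C \<le> yukawa_energy \<alpha> E" .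
  have "total_energy \<alpha> ?A + total_energy \<alpha> ?C = (perimeter ?A + perimeter ?C) + (yukawa_energy \<alpha> ?A + yukawa_energy \<alpha> ?C)"
    by (simp add: total_energy_def add_ac)
  also have "\<dots> \<le> (perimeter E + ennreal (16 * M)) + yukawa_energy \<alpha> E"
    by (intro add_mono N perimeter_cut_ball[OF E R M slope])
  finally show ?thesis by (simp add: total_energy_def add_ac)
qed

text \<open>Excludes dichotomy. If mass \<epsilon> stayed outside the ball of radius 2 R0, a cheap
  cut at some radius between R0 and 2 R0 would leave at least c inside and at least \<epsilon>
  outside. Strict monotonicity makes the two pieces cost at least \<open>\<delta>\<close> more than
  the infimum, beyond what a near-minimal energy and the price of the cut allow.\<close>

lemma tightness:
  assumes a: "\<alpha> > 0" and a3: "\<alpha> ^ 3 > 2 * pi" and m: "m > 0" and s: "s > 0" and c: "c > 0" and \<epsilon>: "0 < \<epsilon>" "\<epsilon> < m"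
  obtains R \<eta> where "\<eta> > 0" "\<And>E. E \<in> sets borel \<Longrightarrow> emeasure lborel E = ennreal m \<Longrightarrow> ennreal c \<le> emeasure lborel (E \<inter> ball 0 s)
     \<Longrightarrow> total_energy \<alpha> E \<le> ennreal (min_energy_real \<alpha> m + \<eta>) \<Longrightarrow> emeasure lborel (E - ball 0 R) < ennreal \<epsilon>"
proof -
  let ?e = "min_energy_real \<alpha>"
  \<comment> \<open>The minimal penalty for splitting: at least c of mass pays the energy per mass
    of m - \<epsilon> instead of that of m.\<close>
  define \<delta> where "\<delta> = c * (?e (m - \<epsilon>) / (m - \<epsilon>) - ?e m / m)"
  have diff: "?e (m - \<epsilon>) / (m - \<epsilon>) - ?e m / m > 0"
    using min_energy_per_mass_strict_antimono[OF a a3, of "m - \<epsilon>" m] \<epsilon> by simp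
  then have \<delta>: "\<delta> > 0" using c by (simp add: \<delta>_def)
  \<comment> \<open>With slope M = 2 m / R0 the cut costs 16 M = 32 m / R0, so 128 m /
    \<open>\<delta>\<close> makes it at most \<open>\<delta>\<close> / 4. The maximum with s keeps
    the concentrated mass inside the cut.\<close>
  define R0 where "R0 = max s (128 * m / \<delta>)"
  have R0: "R0 > 0" "R0 \<ge> s" "R0 \<ge> 128 * m / \<delta>" using s by (auto simp: R0_def)
  \<comment> \<open>The factor 2 gives the strict inequality m < M R0 required for a radius of small
    slope.\<close>
  define M where "M = 2 * m / R0"
  have M: "M \<ge> 0" using m R0 by (simp add: M_def)
  have M\<delta>: "16 * M \<le> \<delta> / 4"
  proof -
    have "128 * m \<le> R0 * \<delta>" using R0(3) \<delta> by (simp add: pos_divide_le_eq)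
    then show ?thesis using R0(1) by (simp add: M_def field_simps)
  qed
  have "emeasure lborel (E - ball 0 (2 * R0)) < ennreal \<epsilon>"
    if E[measurable]: "E \<in> sets borel" and Em: "emeasure lborel E = ennreal m" and Ec: "ennreal c \<le> emeasure lborel (E \<inter> ball 0 s)"
      and Ee: "total_energy \<alpha> E \<le> ennreal (?e m + \<delta> / 4)" for E
  proof (rule ccontr)
    assume "\<not> ?thesis"
    then have far: "ennreal \<epsilon> \<le> emeasure lborel (E - ball 0 (2 * R0))" by simp
    have Efm: "F \<in> fmeasurable lborel" if "F \<subseteq> E" "F \<in> sets borel" for F
      using that Em emeasure_mono[of F E lborel] by (intro fmeasurableI) (auto intro: le_less_trans)
    have em: "emeasure lborel F = ennreal (measure lborel F)" if "F \<subseteq> E" "F \<in> sets borel" for F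
      using Efm[OF that] by (rule emeasure_eq_measure2)
    have mE: "measure lborel E = m" using Em m by (simp add: measure_def)
    define v where "v r = measure lborel (E \<inter> ball 0 r)" for r
    have split: "v r + measure lborel (E - ball 0 r) = m" for r
    proof -
      have disj: "(E \<inter> ball 0 r) \<inter> (E - ball 0 r) = {}" by blast
      have "measure lborel ((E \<inter> ball 0 r) \<union> (E - ball 0 r)) = v r + measure lborel (E - ball 0 r)"
        unfolding v_def by (subst measure_Un3) (simp_all add: Efm disj)
      moreover have "(E \<inter> ball 0 r) \<union> (E - ball 0 r) = E" by blast
      ultimately show ?thesis using mE by simp
    qed
    have mono: "v r \<le> v t" if "r \<le> t" for r t
      unfolding v_def by (rule measure_mono_fmeasurable) (use that in \<open>auto intro!: Efm\<close>)
    have "\<exists>R. R0 \<le> R \<and> R \<le> 2 * R0 \<and> (\<forall>e>0. \<exists>d>0. d < e \<and> v (R + d) - v R \<le> M * d)"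
    proof (rule exists_small_slope[where m=m])
      show "0 \<le> v r" for r by (simp add: v_def)
      show "v r \<le> m" for r using split[of r] measure_nonneg[of lborel "E - ball 0 r"] by linarith
    qed (use R0 m mono in \<open>auto simp: M_def\<close>)
    then obtain R where R: "R0 \<le> R" "R \<le> 2 * R0" "\<And>e. e > 0 \<Longrightarrow> \<exists>d>0. d < e \<and> v (R + d) - v R \<le> M * d" by blast
    have Rpos: "R > 0" using R R0 by linarith
    have slope: "\<exists>d>0. d < e \<and> emeasure lborel (E \<inter> (ball 0 (R + d) - ball 0 R)) \<le> ennreal (M * d)" if "e > 0" for e
    proof -
      obtain d where d: "d > 0" "d < e" "v (R + d) - v R \<le> M * d" using R(3)[OF \<open>e > 0\<close>] by blast
      have "E \<inter> (ball 0 (R + d) - ball 0 R) = (E \<inter> ball 0 (R + d)) - (E \<inter> ball 0 R)" by blast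
      moreover have "measure lborel ((E \<inter> ball 0 (R + d)) - (E \<inter> ball 0 R)) = v (R + d) - v R"
        unfolding v_def using d by (intro measurable_measure_Diff) (auto intro!: Efm)
      ultimately have "emeasure lborel (E \<inter> (ball 0 (R + d) - ball 0 R)) = ennreal (v (R + d) - v R)"
        by (subst em) auto
      with d show ?thesis by (intro exI[of _ d]) (auto intro!: ennreal_leI)
    qed
    let ?A = "E \<inter> ball 0 R" and ?C = "E - ball 0 R"
    have cut: "total_energy \<alpha> ?A + total_energy \<alpha> ?C \<le> total_energy \<alpha> E + ennreal (16 * M)"
      by (rule total_energy_cut_ball[OF a E Rpos M slope])
    define x where "x = v R"
    have A: "emeasure lborel ?A = ennreal x" unfolding x_def v_def by (rule em) auto
    have C: "emeasure lborel ?C = ennreal (m - x)" using split[of R] by (subst em) (auto simp: x_def algebra_simps)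
    have "c \<le> v s" using Ec by (subst (asm) em) (auto simp: v_def c)
    then have xc: "c \<le> x" using mono[of s R] R R0 by (simp add: x_def)
    have "\<epsilon> \<le> measure lborel (E - ball 0 (2 * R0))" using far by (subst (asm) em) auto
    then have "v (2 * R0) \<le> m - \<epsilon>" using split[of "2 * R0"] by linarith
    then have x\<epsilon>: "x \<le> m - \<epsilon>" using mono[of R "2 * R0"] R by (simp add: x_def)
    have x: "0 < x" "0 < m - x" using xc c x\<epsilon> \<epsilon> by auto
    have "ennreal (?e x + ?e (m - x)) = min_energy \<alpha> x + min_energy \<alpha> (m - x)"
      using x by (simp add: min_energy_eq_real[OF a])
    also have "\<dots> \<le> total_energy \<alpha> ?A + total_energy \<alpha> ?C"
      by (intro add_mono min_energy_le A C) auto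
    also have "\<dots> \<le> total_energy \<alpha> E + ennreal (16 * M)" by (rule cut)
    also have "\<dots> \<le> ennreal (?e m + \<delta> / 4) + ennreal (\<delta> / 4)"
      using M\<delta> by (intro add_mono Ee ennreal_leI)
    also have "\<dots> = ennreal (?e m + \<delta> / 2)"
      using \<delta> by (subst ennreal_plus[symmetric]) auto
    finally have "?e x + ?e (m - x) \<le> ?e m + \<delta> / 2"
      using \<delta> by (subst (asm) ennreal_le_iff) auto
    \<comment> \<open>The inner piece has mass at most m - \<epsilon> and is compared with the
      steeper chord at m - \<epsilon>; the outer piece is compared with the chord at m.\<close>
    moreover have "x * (?e (m - \<epsilon>) / (m - \<epsilon>)) \<le> ?e x" by (rule min_energy_per_mass_antimono[OF a a3 x(1) x\<epsilon>])
    moreover have "(m - x) * (?e m / m) \<le> ?e (m - x)" by (rule min_energy_per_mass_antimono[OF a a3 x(2)]) (use x in simp)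
    moreover have "x * (?e (m - \<epsilon>) / (m - \<epsilon>)) + (m - x) * (?e m / m) = x * (?e (m - \<epsilon>) / (m - \<epsilon>) - ?e m / m) + ?e m"
      using m by (simp add: field_simps)
    moreover have "\<delta> \<le> x * (?e (m - \<epsilon>) / (m - \<epsilon>) - ?e m / m)"
      unfolding \<delta>_def using xc diff by (intro mult_right_mono) auto
    ultimately show False using \<delta> by linarith
  qed
  then show thesis using \<delta> by (intro that[of "\<delta> / 4" "2 * R0"]) auto
qed

section \<open>Extraction of a diagonal subsequence\<close>

lemma diagonal_convergent_subsequence:
  fixes f :: "nat \<Rightarrow> nat \<Rightarrow> real"
  assumes bd: "\<And>n j. \<bar>f n j\<bar> \<le> B"
  obtains r where "strict_mono r" "\<And>j. convergent (\<lambda>n. f (r n) j)"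
proof -
  interpret d: subseqs "\<lambda>j s. convergent (\<lambda>n. f (s n) j)"
  proof
    fix j :: nat and s :: "nat \<Rightarrow> nat" assume "strict_mono s"
    have "\<And>k. f (s k) j \<in> {-B..B}" using bd by (simp add: abs_le_iff minus_le_iff)
    then obtain l s' where "strict_mono s'" "((\<lambda>k. f (s k) j) \<circ> s') \<longlonglongrightarrow> l"
      using compact_Icc compact_imp_seq_compact seq_compactE by metis
    then show "\<exists>r'. strict_mono r' \<and> convergent (\<lambda>n. f ((s \<circ> r') n) j)"
      by (auto simp: comp_def convergent_def)
  qed
  have "convergent (\<lambda>n. f (d.diagseq n) j)" for j
  proof -
    \<comment> \<open>The property for index j is obtained from the diagonal sequence shifted by
      \<open>Suc j\<close>, where it runs through the j-th subsequence; convergence ignores the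
      initial segment.\<close>
    have "convergent (\<lambda>n. f ((d.diagseq \<circ> (+) (Suc j)) n) j)"
    proof (rule d.diagseq_holds)
      fix r s :: "nat \<Rightarrow> nat" and n assume "strict_mono r" "convergent (\<lambda>k. f (s k) n)"
      then show "convergent (\<lambda>k. f ((s \<circ> r) k) n)"
        using convergent_subseq_convergent[of "\<lambda>k. f (s k) n" r] by (simp add: comp_def)
    qed
    then have "convergent (\<lambda>n. f (d.diagseq (n + Suc j)) j)" by (simp add: comp_def add.commute)
    then show ?thesis by (subst (asm) convergent_ignore_initial_segment[of "\<lambda>n. f (d.diagseq n) j"])
  qed
  with d.subseq_diagseq show thesis by (rule that)
qed

section \<open>Compactness and lower semicontinuity\<close>

lemma measure_Int_ball_measurable:
  fixes E :: "(real^3) set"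
  assumes [measurable]: "E \<in> sets borel"
  shows "(\<lambda>x. measure lborel (E \<inter> ball x s)) \<in> borel_measurable borel"
proof -
  have "emeasure lborel (E \<inter> ball x s) = (\<integral>\<^sup>+y. indicator E y * indicator (ball 0 s) (x - y) \<partial>lborel)" for x
  proof -
    have "emeasure lborel (E \<inter> ball x s) = (\<integral>\<^sup>+y. indicator (E \<inter> ball x s) y \<partial>lborel)" by simp
    also have "\<dots> = (\<integral>\<^sup>+y. indicator E y * indicator (ball 0 s) (x - y) \<partial>lborel)"
      by (intro nn_integral_cong) (simp add: indicator_def dist_norm norm_minus_commute)
    finally show ?thesis .
  qed
  then show ?thesis unfolding measure_def by simp
qed

text \<open>A Poincare inequality for indicators: the deviation from the ball average, times the
  volume of the ball, equals the integral of |1_E(x) - 1_E(x - z)| over z in the ball, because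
  1_E(x) is 0 or 1 and the integrand has one sign. Fubini turns this into translation gaps.\<close>

lemma poincare_ball_average:
  fixes E :: "(real^3) set"
  assumes E[measurable]: "E \<in> sets borel" and fin: "emeasure lborel E < \<infinity>" and s: "s > 0"
  shows "(\<integral>\<^sup>+x. ennreal \<bar>indicator E x - measure lborel (E \<inter> ball x s) / measure lborel (ball (0::real^3) s)\<bar> \<partial>lborel)
     \<le> ennreal s * perimeter E"
proof -
  define b where "b = measure lborel (ball (0::real^3) s)"
  have eb: "emeasure lborel (ball x s) = ennreal b" for x :: "real^3"
  proof -
    have "emeasure lborel (ball (0::real^3) s) = ennreal b"
      unfolding b_def using emeasure_lborel_ball_finite[of "0::real^3" s] by (intro emeasure_eq_ennreal_measure) auto
    then show ?thesis using s by (simp add: emeasure_ball3)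
  qed
  have "unit_ball_vol 3 > 0" by (rule unit_ball_vol_pos) simp
  then have "ennreal 0 < ennreal b" using s by (simp add: emeasure_ball3 flip: eb[of 0])
  then have b: "b > 0" by (simp only: ennreal_less_zero_iff ennreal_0)
  have fB: "ball x s \<in> fmeasurable lborel" for x :: "real^3" using eb by (intro fmeasurableI) auto
  have mb: "measure lborel (ball x s) = b" for x :: "real^3" using eb b by (simp add: measure_def)
  let ?h = "\<lambda>x. measure lborel (E \<inter> ball x s)"
  have pt: "ennreal (b * \<bar>indicator E x - ?h x / b\<bar>) = (\<integral>\<^sup>+z. indicator (ball 0 s) z * ennreal \<bar>indicator E x - indicator E (x - z)\<bar> \<partial>lborel)" for x
  proof -
    \<comment> \<open>The part of the ball around x where membership in E differs from that of
      x.\<close>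
    define F where "F = (if x \<in> E then ball x s - E else E \<inter> ball x s)"
    have F[measurable]: "F \<in> sets borel" by (simp add: F_def)
    have Ff: "F \<in> fmeasurable lborel" by (rule fmeasurableI2[OF fB[of x]]) (auto simp: F_def)
    have disj: "(E \<inter> ball x s) \<inter> (ball x s - E) = {}" by blast
    have "?h x + measure lborel (ball x s - E) = measure lborel ((E \<inter> ball x s) \<union> (ball x s - E))"
      by (subst measure_Un3) (auto simp: disj intro!: fmeasurableI2[OF fB[of x]])
    also have "(E \<inter> ball x s) \<union> (ball x s - E) = ball x s" by blast
    finally have sum: "?h x + measure lborel (ball x s - E) = b" by (simp add: mb)
    have "b * \<bar>indicator E x - ?h x / b\<bar> = \<bar>b * (indicator E x - ?h x / b)\<bar>" using b by (simp add: abs_mult)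
    also have "b * (indicator E x - ?h x / b) = b * indicator E x - ?h x" using b by (simp add: right_diff_distrib)
    also have "\<bar>b * indicator E x - ?h x\<bar> = measure lborel F" using sum by (auto simp: F_def)
    finally have "ennreal (b * \<bar>indicator E x - ?h x / b\<bar>) = emeasure lborel F" using Ff by (simp add: emeasure_eq_measure2)
    also have "\<dots> = (\<integral>\<^sup>+y. indicator F y \<partial>lborel)" by simp
    also have "\<dots> = (\<integral>\<^sup>+z. indicator F (x - z) \<partial>lborel)" by (rule nn_integral_lborel_reflect[symmetric]) measurable
    also have "\<dots> = (\<integral>\<^sup>+z. indicator (ball 0 s) z * ennreal \<bar>indicator E x - indicator E (x - z)\<bar> \<partial>lborel)"
      by (intro nn_integral_cong) (auto simp: indicator_def F_def dist_norm)
    finally show ?thesis .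
  qed
  have [measurable]: "?h \<in> borel_measurable borel" by (rule measure_Int_ball_measurable[OF E])
  have "ennreal b * (\<integral>\<^sup>+x. ennreal \<bar>indicator E x - ?h x / b\<bar> \<partial>lborel) = (\<integral>\<^sup>+x. ennreal (b * \<bar>indicator E x - ?h x / b\<bar>) \<partial>lborel)"
    using b by (subst nn_integral_cmult[symmetric]) (auto simp: ennreal_mult)
  also have "\<dots> = (\<integral>\<^sup>+x. (\<integral>\<^sup>+z. indicator (ball 0 s) z * ennreal \<bar>indicator E x - indicator E (x - z)\<bar> \<partial>lborel) \<partial>lborel)"
    by (simp only: pt)
  also have "\<dots> = (\<integral>\<^sup>+z. (\<integral>\<^sup>+x. indicator (ball 0 s) z * ennreal \<bar>indicator E x - indicator E (x - z)\<bar> \<partial>lborel) \<partial>lborel)"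
    by (rule lborel_pair.Fubini') measurable
  also have "\<dots> = (\<integral>\<^sup>+z. indicator (ball 0 s) z * (2 * translation_gap E z) \<partial>lborel)"
    by (intro nn_integral_cong) (simp add: nn_integral_cmult nn_integral_translation_difference[OF E fin])
  also have "\<dots> \<le> ennreal s * ennreal b * perimeter E"
    using nn_integral_ball_translation_gap[OF E fin s] by (simp add: eb)
  finally have "ennreal b * (\<integral>\<^sup>+x. ennreal \<bar>indicator E x - ?h x / b\<bar> \<partial>lborel) \<le> ennreal b * (ennreal s * perimeter E)"
    by (simp add: mult_ac)
  then show ?thesis using b unfolding b_def[symmetric] by (subst (asm) ennreal_mult_le_mult_iff) auto
qed

text \<open>Moving the centre changes the mass inside by at most the measure of a difference of two
  balls, which does not involve E. Thus \<open>d\<close> is chosen before E, as needed for a whole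
  sequence of sets.\<close>

lemma measure_Int_ball_equicontinuous:
  fixes x :: "real^3"
  assumes \<eta>: "\<eta> > 0"
  obtains d where "d > 0" "\<And>E y. E \<in> sets borel \<Longrightarrow> dist x y < d \<Longrightarrow>
     \<bar>measure lborel (E \<inter> ball x s) - measure lborel (E \<inter> ball y s)\<bar> \<le> \<eta>"
proof -
  have fB: "ball x s \<in> fmeasurable lborel" for x :: "real^3"
    using emeasure_lborel_ball_finite[of x s] by (intro fmeasurableI) auto
  have fin: "emeasure lborel (ball x s) < \<infinity>" using emeasure_lborel_ball_finite[of x s] by simp
  obtain d where d: "d > 0" "\<And>h. norm h < d \<Longrightarrow> translation_gap (ball x s) h \<le> ennreal \<eta>"
    using translation_gap_tendsto_0[of "ball x s" \<eta>] fin \<eta> by auto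
  have "\<bar>measure lborel (E \<inter> ball x s) - measure lborel (E \<inter> ball y s)\<bar> \<le> \<eta>" if E[measurable]: "E \<in> sets borel" and y: "dist x y < d" for E y
  proof -
    have gap: "translation_gap (ball x s) (y - x) \<le> ennreal \<eta>" using d(2)[of "y - x"] y by (simp add: dist_norm norm_minus_commute)
    have e1: "{z \<in> ball x s. z - (y - x) \<notin> ball x s} = ball x s - ball y s"
      by (auto simp: dist_norm algebra_simps)
    have e2: "{z. z \<notin> ball x s \<and> z - (y - x) \<in> ball x s} = ball y s - ball x s"
      by (auto simp: dist_norm algebra_simps)
    have g1: "emeasure lborel (ball x s - ball y s) \<le> ennreal \<eta>" using gap unfolding translation_gap_def e1 .
    have g2: "emeasure lborel (ball y s - ball x s) \<le> ennreal \<eta>"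
      using gap translation_gap_uminus[of "ball x s" "y - x"] fin unfolding e2 by simp
    have *: "measure lborel (E \<inter> ball u s) \<le> measure lborel (E \<inter> ball w s) + \<eta>"
      if "emeasure lborel (ball u s - ball w s) \<le> ennreal \<eta>" for u w
    proof -
      have "measure lborel (E \<inter> ball u s) \<le> measure lborel ((E \<inter> ball w s) \<union> (ball u s - ball w s))"
        by (rule measure_mono_fmeasurable) (auto intro!: fmeasurable.Un fmeasurableI2[OF fB[of w], of "E \<inter> ball w s"] fmeasurableI2[OF fB[of u], of "ball u s - ball w s"])
      also have "\<dots> \<le> measure lborel (E \<inter> ball w s) + measure lborel (ball u s - ball w s)"
        by (rule measure_Un_le) auto
      also have "measure lborel (ball u s - ball w s) \<le> \<eta>" using that \<eta> unfolding measure_def by (intro enn2real_leI) auto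
      finally show ?thesis by simp
    qed
    show ?thesis using *[OF g1] *[OF g2] by linarith
  qed
  with d(1) show thesis by (rule that)
qed

text \<open>A diagonal subsequence treats the countably many pairs of a centre in a dense set and a
  radius 1 / (k + 1); equicontinuity in the centre extends the convergence to all centres.\<close>

lemma convergent_local_masses:
  fixes E :: "nat \<Rightarrow> (real^3) set"
  assumes E: "\<And>n. E n \<in> sets borel" and m: "\<And>n. emeasure lborel (E n) \<le> ennreal m" "m \<ge> 0"
  obtains r where "strict_mono r" "\<And>x k. convergent (\<lambda>n. measure lborel (E (r n) \<inter> ball x (1 / real (Suc k))))"
proof -
  obtain D :: "(real^3) set" where D: "countable D" "\<And>X. open X \<Longrightarrow> X \<noteq> {} \<Longrightarrow> \<exists>d\<in>D. d \<in> X"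
    by (rule countable_dense_setE) blast
  have cD: "countable (D \<times> (UNIV :: nat set))" using D(1) by simp
  have neD: "D \<times> (UNIV :: nat set) \<noteq> {}" using D(2)[of UNIV] by auto
  define q where "q = from_nat_into (D \<times> (UNIV :: nat set))"
  have q: "range q = D \<times> UNIV" unfolding q_def by (rule range_from_nat_into[OF neD cD])
  have bd: "\<bar>measure lborel (E n \<inter> ball (fst (q j)) (1 / real (Suc (snd (q j)))))\<bar> \<le> m" for n j
  proof -
    have "emeasure lborel (E n \<inter> ball (fst (q j)) (1 / real (Suc (snd (q j))))) \<le> emeasure lborel (E n)"
      using E by (intro emeasure_mono) auto
    then have "emeasure lborel (E n \<inter> ball (fst (q j)) (1 / real (Suc (snd (q j))))) \<le> ennreal m" using m(1) order_trans by blast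
    then show ?thesis using m(2) unfolding measure_def by (simp add: enn2real_leI)
  qed
  obtain r where r: "strict_mono r" "\<And>j. convergent (\<lambda>n. measure lborel (E (r n) \<inter> ball (fst (q j)) (1 / real (Suc (snd (q j))))))"
    using diagonal_convergent_subsequence[of "\<lambda>n j. measure lborel (E n \<inter> ball (fst (q j)) (1 / real (Suc (snd (q j)))))" m] bd by blast
  have "convergent (\<lambda>n. measure lborel (E (r n) \<inter> ball x (1 / real (Suc k))))" for x k
  proof (rule Cauchy_convergent, rule metric_CauchyI)
    fix e :: real assume e: "e > 0"
    let ?s = "1 / real (Suc k)"
    obtain d where d: "d > 0" "\<And>E y. E \<in> sets borel \<Longrightarrow> dist x y < d \<Longrightarrow>
       \<bar>measure lborel (E \<inter> ball x ?s) - measure lborel (E \<inter> ball y ?s)\<bar> \<le> e / 4"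
      by (rule measure_Int_ball_equicontinuous[of "e / 4" x ?s]) (use e in auto)
    obtain y where y: "y \<in> D" "y \<in> ball x d" using D(2)[of "ball x d"] d(1) by auto
    then have "(y, k) \<in> range q" using q by auto
    then obtain j where j: "q j = (y, k)" by (metis rangeE)
    have "Cauchy (\<lambda>n. measure lborel (E (r n) \<inter> ball y ?s))"
      using r(2)[of j] by (simp add: j convergent_Cauchy)
    then obtain N where N: "\<And>i n. i \<ge> N \<Longrightarrow> n \<ge> N \<Longrightarrow>
        dist (measure lborel (E (r i) \<inter> ball y ?s)) (measure lborel (E (r n) \<inter> ball y ?s)) < e / 4"
      using e metric_CauchyD[of _ "e / 4"] by (metis zero_less_divide_iff zero_less_numeral)
    show "\<exists>M. \<forall>i\<ge>M. \<forall>n\<ge>M. dist (measure lborel (E (r i) \<inter> ball x ?s)) (measure lborel (E (r n) \<inter> ball x ?s)) < e"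
    proof (intro exI[of _ N] allI impI)
      fix i n assume "i \<ge> N" "n \<ge> N"
      then show "dist (measure lborel (E (r i) \<inter> ball x ?s)) (measure lborel (E (r n) \<inter> ball x ?s)) < e"
        using N[of i n, unfolded dist_real_def] d(2)[OF E, of y "r i"] d(2)[OF E, of y "r n"] y(2) e
        unfolding dist_real_def mem_ball by linarith
    qed
  qed
  with r(1) show thesis by (rule that)
qed

lemma emeasure_sym_diff_eq:
  assumes [measurable]: "A \<in> sets borel" "B \<in> sets borel"
  shows "(\<integral>\<^sup>+x. ennreal \<bar>indicator A x - indicator B x\<bar> \<partial>lborel) = emeasure lborel (sym_diff A B)"
proof -
  have "(\<integral>\<^sup>+x. ennreal \<bar>indicator A x - indicator B x\<bar> \<partial>lborel) = (\<integral>\<^sup>+x. indicator (sym_diff A B) x \<partial>lborel)"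
    by (intro nn_integral_cong) (auto simp: indicator_def)
  then show ?thesis by simp
qed

text \<open>Ball averages at a small fixed radius approximate all the sets in L1, uniformly because
  the perimeters are bounded. Along the subsequence these averages converge pointwise and are at
  most 1, so they converge in L1 on any fixed ball; tightness deals with the rest of space.\<close>

lemma L1_Cauchy_subsequence:
  fixes E :: "nat \<Rightarrow> (real^3) set"
  assumes E[measurable]: "\<And>n. E n \<in> sets borel" and m: "\<And>n. emeasure lborel (E n) \<le> ennreal m" "m \<ge> 0"
    and C: "\<And>n. perimeter (E n) \<le> ennreal C" "C \<ge> 0"
    and tight: "\<And>\<epsilon>. \<epsilon> > 0 \<Longrightarrow> \<exists>R N. \<forall>n\<ge>N. emeasure lborel (E n - ball 0 R) \<le> ennreal \<epsilon>"
  obtains r :: "nat \<Rightarrow> nat" where "strict_mono r" "\<And>e. e > 0 \<Longrightarrow> \<exists>N. \<forall>i\<ge>N. \<forall>j\<ge>N. emeasure lborel (sym_diff (E (r i)) (E (r j))) \<le> ennreal e"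
proof -
  obtain r where r: "strict_mono r" "\<And>x k. convergent (\<lambda>n. measure lborel (E (r n) \<inter> ball x (1 / real (Suc k))))"
    by (rule convergent_local_masses[of E m, OF E m]) blast
  have fin: "emeasure lborel (E n) < \<infinity>" for n using m(1)[of n] by (rule le_less_trans) simp
  have main: "\<exists>N. \<forall>i\<ge>N. \<forall>j\<ge>N. emeasure lborel (sym_diff (E (r i)) (E (r j))) \<le> ennreal e" if e: "e > 0" for e
  proof -
    \<comment> \<open>Six error terms of size d arise below: for each of the two sets one from
      averaging, one from convergence of the averages and one from the mass far away.\<close>
    define d where "d = e / 8"
    have d: "d > 0" using e by (simp add: d_def)
    obtain R N1 where R: "\<And>n. n \<ge> N1 \<Longrightarrow> emeasure lborel (E n - ball 0 R) \<le> ennreal d"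
      using tight[OF d] by blast
    \<comment> \<open>Makes the averaging error s C at most d, with s among the radii 1 / (k + 1)
      for which local masses converge.\<close>
    obtain k where k: "C / d < real (Suc k)" using reals_Archimedean2 less_trans[of _ "real _" "real (Suc _)"] by (metis lessI of_nat_less_iff)
    define s where "s = 1 / real (Suc k)"
    have s: "s > 0" by (simp add: s_def)
    have sC: "s * C \<le> d" using k d by (simp add: s_def field_simps)
    define b where "b = measure lborel (ball (0::real^3) s)"
    have b_eq: "measure lborel (ball x s) = b" for x :: "real^3" using s by (simp add: b_def measure_def emeasure_ball3)
    define h where "h n x = measure lborel (E n \<inter> ball x s) / b" for n x
    have [measurable]: "h n \<in> borel_measurable borel" for n
      unfolding h_def using measure_Int_ball_measurable[OF E] by measurable
    have h_bd: "\<bar>h n x\<bar> \<le> 1" for n x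
    proof -
      have "measure lborel (E n \<inter> ball x s) \<le> measure lborel (ball x s)"
        using emeasure_lborel_ball_finite[of x s] by (intro measure_mono_fmeasurable) (auto intro!: fmeasurableI)
      then show ?thesis unfolding h_def b_eq[of x] by (simp add: divide_le_eq_1 b_def zero_less_measure_iff)
    qed
    have "\<exists>l. (\<lambda>n. h (r n) x) \<longlonglongrightarrow> l" for x
    proof -
      obtain l where "(\<lambda>n. measure lborel (E (r n) \<inter> ball x s)) \<longlonglongrightarrow> l"
        using r(2)[of x k] by (auto simp: s_def convergent_def)
      then have "(\<lambda>n. h (r n) x) \<longlonglongrightarrow> l / b" unfolding h_def by (simp add: divide_inverse tendsto_mult_right)
      then show ?thesis by blast
    qed
    then obtain H where H: "\<And>x. (\<lambda>n. h (r n) x) \<longlonglongrightarrow> H x" by metis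
    have [measurable]: "H \<in> borel_measurable borel"
      by (rule borel_measurable_LIMSEQ_real[OF H]) simp
    have bb: "\<bar>h (r n) x - H x\<bar> \<le> 2" for n x
    proof -
      have "\<bar>H x\<bar> \<le> 1" by (rule LIMSEQ_le_const2[OF tendsto_rabs[OF H]]) (use h_bd in auto)
      then show ?thesis using h_bd[of "r n" x] by linarith
    qed
    let ?I = "indicator (ball (0::real^3) R) :: real^3 \<Rightarrow> real"
    have "(\<lambda>n. \<integral>x. ?I x * \<bar>h (r n) x - H x\<bar> \<partial>lborel) \<longlonglongrightarrow> (\<integral>x. 0 \<partial>(lborel :: (real^3) measure))"
    proof (rule integral_dominated_convergence[where w="\<lambda>x. 2 * ?I x"])
      show "integrable lborel (\<lambda>x. 2 * ?I x)"
        by (intro integrable_mult_right integrable_indicator_ball)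
      show "AE x in lborel. (\<lambda>n. ?I x * \<bar>h (r n) x - H x\<bar>) \<longlonglongrightarrow> 0"
      proof (rule AE_I2)
        fix x
        have "(\<lambda>n. ?I x * \<bar>h (r n) x - H x\<bar>) \<longlonglongrightarrow> ?I x * \<bar>H x - H x\<bar>" by (intro tendsto_intros H)
        then show "(\<lambda>n. ?I x * \<bar>h (r n) x - H x\<bar>) \<longlonglongrightarrow> 0" by simp
      qed
      show "AE x in lborel. norm (?I x * \<bar>h (r n) x - H x\<bar>) \<le> 2 * ?I x" for n
        using bb by (intro AE_I2) (auto simp: indicator_def)
    qed simp_all
    then have "(\<lambda>n. \<integral>x. ?I x * \<bar>h (r n) x - H x\<bar> \<partial>lborel) \<longlonglongrightarrow> 0" by simp
    from LIMSEQ_D[OF this d] obtain N2 where N2': "\<And>n. n \<ge> N2 \<Longrightarrow> norm ((\<integral>x. ?I x * \<bar>h (r n) x - H x\<bar> \<partial>lborel) - 0) < d"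
      by blast
    have N2: "(\<integral>\<^sup>+x. ennreal (?I x * \<bar>h (r n) x - H x\<bar>) \<partial>lborel) \<le> ennreal d" if "n \<ge> N2" for n
    proof -
      have "integrable lborel (\<lambda>x. 2 * ?I x)"
        by (intro integrable_mult_right integrable_indicator_ball)
      then have "integrable lborel (\<lambda>x. ?I x * \<bar>h (r n) x - H x\<bar>)"
        by (rule Bochner_Integration.integrable_bound) (use bb in \<open>auto simp: indicator_def\<close>)
      then have "(\<integral>\<^sup>+x. ennreal (?I x * \<bar>h (r n) x - H x\<bar>) \<partial>lborel) = ennreal (\<integral>x. ?I x * \<bar>h (r n) x - H x\<bar> \<partial>lborel)"
        by (rule nn_integral_eq_integral) simp
      also have "\<dots> \<le> ennreal d" using N2'[OF that] by (intro ennreal_leI) simp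
      finally show ?thesis .
    qed
    have poin: "(\<integral>\<^sup>+x. ennreal \<bar>indicator (E n) x - h n x\<bar> \<partial>lborel) \<le> ennreal d" for n
    proof -
      have "(\<integral>\<^sup>+x. ennreal \<bar>indicator (E n) x - h n x\<bar> \<partial>lborel) \<le> ennreal s * perimeter (E n)"
        unfolding h_def b_def by (rule poincare_ball_average[OF E fin s])
      also have "\<dots> \<le> ennreal s * ennreal C" by (intro mult_left_mono C) simp
      also have "\<dots> = ennreal (s * C)" using s C by (simp add: ennreal_mult)
      also have "\<dots> \<le> ennreal d" by (intro ennreal_leI sC)
      finally show ?thesis .
    qed
    have rN: "r n \<ge> N1" if "n \<ge> N1" for n using seq_suble[OF r(1), of n] that by linarith
    show ?thesis
    proof (intro exI[of _ "max N1 N2"] allI impI)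
      fix i j assume "i \<ge> max N1 N2" "j \<ge> max N1 N2"
      then have ij: "i \<ge> N1" "i \<ge> N2" "j \<ge> N1" "j \<ge> N2" by auto
      define A where "A n x = ennreal \<bar>indicator (E (r n)) x - h (r n) x\<bar>" for n x
      define B where "B n x = ennreal (?I x * \<bar>h (r n) x - H x\<bar>)" for n x
      define D where "D n x = (indicator (E (r n) - ball 0 R) x :: ennreal)" for n x
      have [measurable]: "A n \<in> borel_measurable borel" "B n \<in> borel_measurable borel" "D n \<in> borel_measurable borel" for n
        unfolding A_def B_def D_def by measurable
      have iA: "(\<integral>\<^sup>+x. A n x \<partial>lborel) \<le> ennreal d" for n unfolding A_def by (rule poin)
      have iB: "(\<integral>\<^sup>+x. B n x \<partial>lborel) \<le> ennreal d" if "n \<ge> N2" for n unfolding B_def by (rule N2[OF that])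
      have iD: "(\<integral>\<^sup>+x. D n x \<partial>lborel) \<le> ennreal d" if "n \<ge> N1" for n unfolding D_def using R[OF rN[OF that]] by simp
      have "emeasure lborel (sym_diff (E (r i)) (E (r j))) = (\<integral>\<^sup>+x. ennreal \<bar>indicator (E (r i)) x - indicator (E (r j)) x\<bar> \<partial>lborel)"
        by (rule emeasure_sym_diff_eq[symmetric]) auto
      also have "\<dots> \<le> (\<integral>\<^sup>+x. ((A i x + A j x) + (B i x + B j x)) + (D i x + D j x) \<partial>lborel)"
      proof (intro nn_integral_mono)
        fix x :: "real^3"
        show "ennreal \<bar>indicator (E (r i)) x - indicator (E (r j)) x\<bar> \<le> ((A i x + A j x) + (B i x + B j x)) + (D i x + D j x)"
        proof (cases "x \<in> ball 0 R")
          case True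
          then have I1: "?I x = 1" by (rule indicator_simps)
          have "ennreal \<bar>indicator (E (r i)) x - indicator (E (r j)) x\<bar> \<le> (A i x + A j x) + (B i x + B j x)"
            unfolding A_def B_def I1 by (simp flip: ennreal_plus)
          then show ?thesis by (rule order_trans) simp
        next
          case False
          then have "ennreal \<bar>indicator (E (r i)) x - indicator (E (r j)) x\<bar> \<le> D i x + D j x"
            unfolding D_def by (auto simp: indicator_def)
          then show ?thesis by (rule order_trans) simp
        qed
      qed
      also have "\<dots> = (((\<integral>\<^sup>+x. A i x \<partial>lborel) + (\<integral>\<^sup>+x. A j x \<partial>lborel)) + ((\<integral>\<^sup>+x. B i x \<partial>lborel) + (\<integral>\<^sup>+x. B j x \<partial>lborel)))
          + ((\<integral>\<^sup>+x. D i x \<partial>lborel) + (\<integral>\<^sup>+x. D j x \<partial>lborel))"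
        by (simp add: nn_integral_add)
      also have "\<dots> \<le> ((ennreal d + ennreal d) + (ennreal d + ennreal d)) + (ennreal d + ennreal d)"
        by (intro add_mono iA iB iD ij)
      also have "\<dots> = ennreal (6 * d)" using d by (simp flip: ennreal_plus)
      also have "\<dots> \<le> ennreal e" using e by (intro ennreal_leI) (simp add: d_def)
      finally show "emeasure lborel (sym_diff (E (r i)) (E (r j))) \<le> ennreal e" .
    qed
  qed
  show thesis by (rule that[OF r(1) main])
qed

text \<open>Along a subsequence the indicators are Cauchy almost everywhere, and Cauchy sequences of
  zeros and ones are eventually constant, so the limit is again an indicator, that of the limit
  inferior of the sets. Fatou transfers the Cauchy estimate to this limit, for the full
  sequence.\<close>

lemma L1_complete_sets:
  fixes E :: "nat \<Rightarrow> (real^3) set"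
  assumes E[measurable]: "\<And>n. E n \<in> sets borel" and fin: "\<And>n. emeasure lborel (E n) < \<infinity>"
    and cauchy: "\<And>e. e > 0 \<Longrightarrow> \<exists>N. \<forall>i\<ge>N. \<forall>j\<ge>N. emeasure lborel (sym_diff (E i) (E j)) \<le> ennreal e"
  obtains F where "F \<in> sets borel" "\<And>e. e > 0 \<Longrightarrow> \<exists>N. \<forall>i\<ge>N. emeasure lborel (sym_diff F (E i)) \<le> ennreal e"
proof -
  have int: "integrable lborel (indicator (E n) :: _ \<Rightarrow> real)" for n
    using fin by (intro integrable_real_indicator) auto
  have "\<exists>N. \<forall>i\<ge>N. \<forall>j\<ge>N. (LINT x|lborel. norm (indicator (E i) x - indicator (E j) x :: real)) < e" if e: "e > 0" for e
  proof -
    obtain N where N: "\<And>i j. i \<ge> N \<Longrightarrow> j \<ge> N \<Longrightarrow> emeasure lborel (sym_diff (E i) (E j)) \<le> ennreal (e / 2)"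
      using cauchy[of "e / 2"] e by auto
    have "(LINT x|lborel. norm (indicator (E i) x - indicator (E j) x :: real)) < e" if "i \<ge> N" "j \<ge> N" for i j
    proof -
      have "ennreal (LINT x|lborel. norm (indicator (E i) x - indicator (E j) x :: real)) = (\<integral>\<^sup>+x. ennreal \<bar>indicator (E i) x - indicator (E j) x\<bar> \<partial>lborel)"
        using int by (subst nn_integral_eq_integral) auto
      also have "\<dots> \<le> ennreal (e / 2)" using N[OF that] by (simp add: emeasure_sym_diff_eq)
      finally have "(LINT x|lborel. norm (indicator (E i) x - indicator (E j) x :: real)) \<le> e / 2" using e by simp
      then show ?thesis using e by linarith
    qed
    then show ?thesis by blast
  qed
  then obtain r where r: "strict_mono r" "AE x in lborel. Cauchy (\<lambda>i. indicator (E (r i)) x :: real)"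
    by (rule cauchy_L1_AE_cauchy_subseq[of lborel "\<lambda>n x. indicator (E n) x :: real", OF int]) blast+
  define F where "F = {x. \<exists>N. \<forall>n\<ge>N. x \<in> E (r n)}"
  have F[measurable]: "F \<in> sets borel" unfolding F_def by measurable
  have lim: "AE x in lborel. (\<lambda>i. indicator (E (r i)) x :: real) \<longlonglongrightarrow> indicator F x"
    using r(2)
  proof eventually_elim
    fix x assume c: "Cauchy (\<lambda>i. indicator (E (r i)) x :: real)"
    obtain N where N: "\<And>i j. i \<ge> N \<Longrightarrow> j \<ge> N \<Longrightarrow> dist (indicator (E (r i)) x :: real) (indicator (E (r j)) x) < 1"
      using metric_CauchyD[OF c, of 1] by auto
    \<comment> \<open>Indicator values at distance below 1 coincide.\<close>
    have same: "x \<in> E (r i) \<longleftrightarrow> x \<in> E (r N)" if "i \<ge> N" for i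
      using N[OF that order_refl] by (cases "x \<in> E (r i)"; cases "x \<in> E (r N)") (auto simp: dist_real_def)
    have "x \<in> F \<longleftrightarrow> x \<in> E (r N)"
    proof
      assume "x \<in> F"
      then obtain M where "\<And>n. n \<ge> M \<Longrightarrow> x \<in> E (r n)" unfolding F_def by blast
      then show "x \<in> E (r N)" using same[of "max M N"] by (meson max.cobounded1 max.cobounded2)
    next
      assume "x \<in> E (r N)"
      then have "\<forall>n\<ge>N. x \<in> E (r n)" using same by blast
      then show "x \<in> F" unfolding F_def by blast
    qed
    then have "eventually (\<lambda>i. indicator (E (r i)) x = (indicator F x :: real)) sequentially"
      unfolding eventually_sequentially 
    proof (intro exI[of _ N] allI impI)
      fix i assume "N \<le> i"
      then have "x \<in> E (r i) \<longleftrightarrow> x \<in> F" using same[of i] \<open>x \<in> F \<longleftrightarrow> x \<in> E (r N)\<close> by blast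
      then show "indicator (E (r i)) x = (indicator F x :: real)" by (simp add: indicator_def)
    qed
    then show "(\<lambda>i. indicator (E (r i)) x :: real) \<longlonglongrightarrow> indicator F x" by (rule tendsto_eventually)
  qed
  have main: "\<exists>N. \<forall>i\<ge>N. emeasure lborel (sym_diff F (E i)) \<le> ennreal e" if e: "e > 0" for e
  proof -
    obtain N where N: "\<And>i j. i \<ge> N \<Longrightarrow> j \<ge> N \<Longrightarrow> emeasure lborel (sym_diff (E i) (E j)) \<le> ennreal e"
      using cauchy[OF e] by blast
    have "emeasure lborel (sym_diff F (E i)) \<le> ennreal e" if i: "i \<ge> N" for i
    proof -
      have "emeasure lborel (sym_diff F (E i)) = (\<integral>\<^sup>+x. ennreal \<bar>indicator F x - indicator (E i) x\<bar> \<partial>lborel)"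
        by (rule emeasure_sym_diff_eq[symmetric]) auto
      \<comment> \<open>With the index i fixed, F is the almost everywhere limit of
        \<open>E (r n)\<close>; Fatou then needs only the bound between \<open>E (r n)\<close> and
        \<open>E i\<close> for large n.\<close>
      also have "\<dots> = (\<integral>\<^sup>+x. liminf (\<lambda>n. ennreal \<bar>indicator (E (r n)) x - indicator (E i) x\<bar>) \<partial>lborel)"
      proof (rule nn_integral_cong_AE)
        show "AE x in lborel. ennreal \<bar>indicator F x - indicator (E i) x\<bar> = liminf (\<lambda>n. ennreal \<bar>indicator (E (r n)) x - indicator (E i) x\<bar>)"
          using lim
        proof eventually_elim
          fix x assume "(\<lambda>n. indicator (E (r n)) x :: real) \<longlonglongrightarrow> indicator F x"
          then have "(\<lambda>n. ennreal \<bar>indicator (E (r n)) x - indicator (E i) x\<bar>) \<longlonglongrightarrow> ennreal \<bar>indicator F x - indicator (E i) x\<bar>"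
            by (intro tendsto_ennrealI tendsto_rabs tendsto_diff tendsto_const)
          then show "ennreal \<bar>indicator F x - indicator (E i) x\<bar> = liminf (\<lambda>n. ennreal \<bar>indicator (E (r n)) x - indicator (E i) x\<bar>)"
            by (intro lim_imp_Liminf[symmetric]) auto
        qed
      qed
      also have "\<dots> \<le> liminf (\<lambda>n. \<integral>\<^sup>+x. ennreal \<bar>indicator (E (r n)) x - indicator (E i) x\<bar> \<partial>lborel)"
        by (rule nn_integral_liminf) measurable
      also have "\<dots> \<le> limsup (\<lambda>n. \<integral>\<^sup>+x. ennreal \<bar>indicator (E (r n)) x - indicator (E i) x\<bar> \<partial>lborel)"
        by (rule Liminf_le_Limsup) simp
      also have "\<dots> \<le> ennreal e"
      proof (rule Limsup_bounded)
        show "eventually (\<lambda>n. (\<integral>\<^sup>+x. ennreal \<bar>indicator (E (r n)) x - indicator (E i) x\<bar> \<partial>lborel) \<le> ennreal e) sequentially"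
          unfolding eventually_sequentially
        proof (intro exI[of _ N] allI impI)
          fix n assume "n \<ge> N"
          then have "r n \<ge> N" using seq_suble[OF r(1), of n] by linarith
          then show "(\<integral>\<^sup>+x. ennreal \<bar>indicator (E (r n)) x - indicator (E i) x\<bar> \<partial>lborel) \<le> ennreal e"
            using N[OF _ i, of "r n"] by (simp add: emeasure_sym_diff_eq)
        qed
      qed
      finally show ?thesis .
    qed
    then show ?thesis by blast
  qed
  show thesis by (rule that[OF F main])
qed

text \<open>For a fixed test field the divergence is bounded, so its integral is continuous in L1;
  the interaction energy is even L1-Lipschitz because the kernel has finite mass. Taking the
  supremum over test fields last leaves semicontinuity of the sum.\<close>

lemma total_energy_lower_semicontinuous:
  assumes a: "\<alpha> > 0" and F[measurable]: "F \<in> sets borel" and E: "\<And>n. E n \<in> sets borel" and e: "e \<ge> 0"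
    and conv: "\<And>\<epsilon>. \<epsilon> > 0 \<Longrightarrow> \<exists>n. emeasure lborel (sym_diff F (E n)) \<le> ennreal \<epsilon> \<and> total_energy \<alpha> (E n) \<le> ennreal (e + \<epsilon>)"
  shows "total_energy \<alpha> F \<le> ennreal e"
proof -
  define K where "K = enn2real (\<integral>\<^sup>+z. yukawa_kernel \<alpha> z \<partial>lborel)"
  have K: "(\<integral>\<^sup>+z. yukawa_kernel \<alpha> z \<partial>lborel) = ennreal K" "K \<ge> 0"
    unfolding K_def using nn_integral_yukawa_kernel_finite[OF a] by auto
  have main: "ennreal (LINT x:F|lborel. divergence \<phi> x) + yukawa_energy \<alpha> F \<le> ennreal e" if \<phi>: "\<phi> \<in> test_fields" for \<phi>
  proof (rule ennreal_le_epsilon)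
    fix t :: real assume t: "t > 0"
    obtain B where B: "B > 0" "\<forall>x. \<bar>divergence \<phi> x\<bar> \<le> B" using divergence_bounded[OF \<phi>] by auto
    \<comment> \<open>Balances the three errors: \<epsilon> from the energy bound, B \<epsilon> from
      the divergence integral and 2 K \<epsilon> from the interaction.\<close>
    define \<epsilon> where "\<epsilon> = t / (1 + B + 2 * K)"
    have den: "1 + B + 2 * K > 0" using B K by simp
    have \<epsilon>: "\<epsilon> > 0" using t den by (simp add: \<epsilon>_def)
    have \<epsilon>t: "\<epsilon> + B * \<epsilon> + 2 * K * \<epsilon> = t"
    proof -
      have "\<epsilon> * (1 + B + 2 * K) = t" using den by (simp add: \<epsilon>_def)
      then show ?thesis by (simp add: algebra_simps)
    qed
    obtain n where n: "emeasure lborel (sym_diff F (E n)) \<le> ennreal \<epsilon>" "total_energy \<alpha> (E n) \<le> ennreal (e + \<epsilon>)"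
      using conv[OF \<epsilon>] by blast
    let ?E = "E n" and ?S = "sym_diff F (E n)"
    have [measurable]: "?E \<in> sets borel" by (rule E)
    have S: "?S \<in> sets borel" by measurable
    have int: "integrable lborel (\<lambda>x. indicator G x * divergence \<phi> x)" if "G \<in> sets borel" for G
      using integrable_mult_indicator[of G lborel "divergence \<phi>"] divergence_integrable[OF \<phi>] that by simp
    have Sf: "emeasure lborel ?S < \<infinity>" using n(1) by (rule le_less_trans) simp
    have "(LINT x:F|lborel. divergence \<phi> x) \<le> (\<integral>x. indicator ?E x * divergence \<phi> x + B * indicator ?S x \<partial>lborel)"
      unfolding set_lebesgue_integral_def real_scaleR_def
    proof (rule Bochner_Integration.integral_mono)
      show "integrable lborel (\<lambda>x. indicator ?E x * divergence \<phi> x + B * indicator ?S x)"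
        using Sf S by (intro Bochner_Integration.integrable_add int integrable_mult_right integrable_real_indicator) auto
      show "indicator F x * divergence \<phi> x \<le> indicator ?E x * divergence \<phi> x + B * indicator ?S x" for x
        using B(2)[rule_format, of x] by (auto simp: indicator_def)
    qed (rule int, measurable)
    also have "\<dots> = (LINT x:?E|lborel. divergence \<phi> x) + B * measure lborel ?S"
      unfolding set_lebesgue_integral_def using Sf S
      by (subst Bochner_Integration.integral_add) (auto intro!: int integrable_mult_right integrable_real_indicator)
    also have "measure lborel ?S \<le> \<epsilon>" using n(1) \<epsilon> unfolding measure_def by (intro enn2real_leI) auto
    finally have "(LINT x:F|lborel. divergence \<phi> x) \<le> (LINT x:?E|lborel. divergence \<phi> x) + B * \<epsilon>"
      using B by (simp add: mult_left_mono)
    then have "ennreal (LINT x:F|lborel. divergence \<phi> x) \<le> ennreal ((LINT x:?E|lborel. divergence \<phi> x) + B * \<epsilon>)" by (rule ennreal_leI)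
    also have "\<dots> \<le> ennreal (LINT x:?E|lborel. divergence \<phi> x) + ennreal (B * \<epsilon>)"
      using B \<epsilon> by (intro ennreal_add_le) simp
    also have "\<dots> \<le> perimeter ?E + ennreal (B * \<epsilon>)" by (intro add_right_mono perimeter_ge E \<phi>)
    finally have P: "ennreal (LINT x:F|lborel. divergence \<phi> x) \<le> perimeter ?E + ennreal (B * \<epsilon>)" .
    \<comment> \<open>If x and x - z lie in F, then both lie in \<open>E n\<close>, or one of them
      lies in the symmetric difference; each alternative exception has measure at most
      \<epsilon>.\<close>
    have ov: "overlap F z \<le> overlap ?E z + 2 * ennreal \<epsilon>" for z
    proof -
      have [measurable]: "{x \<in> ?E. x - z \<in> ?E} \<in> sets borel" "{x. x - z \<in> ?S} \<in> sets borel" by measurable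
      have "overlap F z \<le> emeasure lborel ({x \<in> ?E. x - z \<in> ?E} \<union> (?S \<union> {x. x - z \<in> ?S}))"
        unfolding overlap_def by (rule emeasure_mono) auto
      also have "\<dots> \<le> overlap ?E z + emeasure lborel (?S \<union> {x. x - z \<in> ?S})"
        unfolding overlap_def by (rule emeasure_subadditive) auto
      also have "\<dots> \<le> overlap ?E z + (emeasure lborel ?S + emeasure lborel {x. x - z \<in> ?S})"
        by (intro add_left_mono emeasure_subadditive) auto
      also have "emeasure lborel {x. x - z \<in> ?S} = emeasure lborel ?S" by (rule emeasure_lborel_translate[OF S])
      also have "overlap ?E z + (emeasure lborel ?S + emeasure lborel ?S) \<le> overlap ?E z + (ennreal \<epsilon> + ennreal \<epsilon>)"
        by (intro add_mono n order_refl)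
      finally show ?thesis by (simp add: mult_2)
    qed
    have "yukawa_energy \<alpha> F \<le> (\<integral>\<^sup>+z. yukawa_kernel \<alpha> z * overlap ?E z + yukawa_kernel \<alpha> z * (2 * ennreal \<epsilon>) \<partial>lborel)"
      unfolding yukawa_energy_eq[OF F]
      by (intro nn_integral_mono) (simp add: ov mult_left_mono flip: distrib_left)
    also have "\<dots> = yukawa_energy \<alpha> ?E + ennreal K * (2 * ennreal \<epsilon>)"
      by (subst nn_integral_add) (auto simp: yukawa_energy_eq nn_integral_multc K)
    also have "ennreal K * (2 * ennreal \<epsilon>) = ennreal (2 * K * \<epsilon>)"
      using K \<epsilon> by (simp add: ennreal_mult mult_ac)
    finally have N: "yukawa_energy \<alpha> F \<le> yukawa_energy \<alpha> ?E + ennreal (2 * K * \<epsilon>)" .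
    have "ennreal (LINT x:F|lborel. divergence \<phi> x) + yukawa_energy \<alpha> F
      \<le> (perimeter ?E + ennreal (B * \<epsilon>)) + (yukawa_energy \<alpha> ?E + ennreal (2 * K * \<epsilon>))" by (intro add_mono P N)
    also have "\<dots> = total_energy \<alpha> ?E + (ennreal (B * \<epsilon>) + ennreal (2 * K * \<epsilon>))" by (simp add: total_energy_def add_ac)
    also have "\<dots> \<le> ennreal (e + \<epsilon>) + (ennreal (B * \<epsilon>) + ennreal (2 * K * \<epsilon>))" by (intro add_right_mono n)
    also have "\<dots> = ennreal (e + (\<epsilon> + B * \<epsilon> + 2 * K * \<epsilon>))" using e \<epsilon> B K by (simp add: add_ac flip: ennreal_plus)
    also have "\<dots> = ennreal e + ennreal t" unfolding \<epsilon>t using e t by simp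
    finally show "ennreal (LINT x:F|lborel. divergence \<phi> x) + yukawa_energy \<alpha> F \<le> ennreal e + ennreal t" .
  qed
  have "total_energy \<alpha> F = (SUP \<phi>\<in>test_fields. ennreal (LINT x:F|lborel. divergence \<phi> x) + yukawa_energy \<alpha> F)"
    unfolding total_energy_def perimeter_eq[OF F] using zero_test_field by (intro ennreal_SUP_add_left[symmetric]) auto
  also have "\<dots> \<le> ennreal e" by (rule SUP_least) (rule main)
  finally show ?thesis .
qed

section \<open>Existence of minimizers\<close>

lemma minimizer_exists:
  assumes a: "\<alpha> > 0" and a3: "\<alpha> ^ 3 > 2 * pi" and m: "m > 0"
  shows "\<exists>E\<in>admissible m. total_energy \<alpha> E = min_energy \<alpha> m"
proof -
  define e where "e = min_energy_real \<alpha> m"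
  have e: "min_energy \<alpha> m = ennreal e" "e \<ge> 0" using min_energy_eq_real[OF a m] by (auto simp: e_def)
  \<comment> \<open>All members of the minimizing sequence have perimeter at most e + 1, so one
    radius and one mass serve for all of them.\<close>
  obtain s c where s: "s > 0" and c: "c > 0" and conc: "\<And>E. E \<in> sets borel \<Longrightarrow> emeasure lborel E = ennreal m \<Longrightarrow> perimeter E \<le> ennreal (e + 1)
     \<Longrightarrow> \<exists>x. ennreal c \<le> emeasure lborel (E \<inter> ball (x::real^3) s)"
    by (rule concentration[OF m, of "e + 1"]) (use e in auto)
  have ex: "\<exists>E. E \<in> sets borel \<and> emeasure lborel E = ennreal m \<and> total_energy \<alpha> E \<le> ennreal (e + 1 / real (Suc n))
     \<and> ennreal c \<le> emeasure lborel (E \<inter> ball 0 s)" for n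
  proof -
    have "min_energy \<alpha> m < ennreal (e + 1 / real (Suc n))" using e by (simp add: ennreal_less_iff)
    then obtain E where E: "E \<in> sets borel" "emeasure lborel E = ennreal m" "total_energy \<alpha> E < ennreal (e + 1 / real (Suc n))"
      by (rule min_energy_approx)
    have "perimeter E \<le> total_energy \<alpha> E" by (simp add: total_energy_def)
    also have "\<dots> \<le> ennreal (e + 1 / real (Suc n))" using E by simp
    also have "\<dots> \<le> ennreal (e + 1)" by (intro ennreal_leI) simp
    finally obtain x where x: "ennreal c \<le> emeasure lborel (E \<inter> ball x s)" using conc[OF E(1,2)] by auto
    \<comment> \<open>The translate E - x moves the ball carrying mass at least c to the origin;
      without this recentring the mass could escape by translations alone.\<close>
    let ?E = "{y. y - (- x) \<in> E}"
    have B: "?E \<in> sets borel" using E(1) by measurable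
    have "?E \<inter> ball 0 s = {y. y - (- x) \<in> E \<inter> ball x s}" by (auto simp: dist_norm)
    then have "emeasure lborel (?E \<inter> ball 0 s) = emeasure lborel (E \<inter> ball x s)"
      using emeasure_lborel_translate[of "E \<inter> ball x s" "- x"] E(1) by simp
    with x have "ennreal c \<le> emeasure lborel (?E \<inter> ball 0 s)" by simp
    moreover have "emeasure lborel ?E = ennreal m" using emeasure_lborel_translate[OF E(1), of "- x"] E(2) by simp
    moreover have "total_energy \<alpha> ?E \<le> ennreal (e + 1 / real (Suc n))"
      using total_energy_translate_le[OF E(1), of \<alpha> "- x"] E(3) by (rule order_trans[OF _ less_imp_le])
    ultimately show ?thesis using B by blast
  qed
  obtain E where E: "\<And>n. E n \<in> sets borel" "\<And>n. emeasure lborel (E n) = ennreal m"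
    "\<And>n. total_energy \<alpha> (E n) \<le> ennreal (e + 1 / real (Suc n))" "\<And>n. ennreal c \<le> emeasure lborel (E n \<inter> ball 0 s)"
    using ex by metis
  have small: "\<exists>N. \<forall>n\<ge>N. 1 / real (Suc n) \<le> t" if t: "t > 0" for t
  proof -
    obtain N where N: "1 / real (Suc N) < t" by (rule nat_approx_posE[OF t])
    have "1 / real (Suc n) \<le> t" if "n \<ge> N" for n
      using N that by (intro order_trans[OF _ less_imp_le[OF N]] divide_left_mono) auto
    then show ?thesis by blast
  qed
  have P: "perimeter (E n) \<le> ennreal (e + 1)" for n
  proof -
    have "perimeter (E n) \<le> total_energy \<alpha> (E n)" by (simp add: total_energy_def)
    also have "\<dots> \<le> ennreal (e + 1 / real (Suc n))" by (rule E)
    also have "\<dots> \<le> ennreal (e + 1)" by (intro ennreal_leI) simp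
    finally show ?thesis .
  qed
  have tight: "\<exists>R N. \<forall>n\<ge>N. emeasure lborel (E n - ball 0 R) \<le> ennreal \<epsilon>" if \<epsilon>: "\<epsilon> > 0" for \<epsilon>
  proof -
    \<comment> \<open>Tightness is available only below the total mass.\<close>
    define \<epsilon>' where "\<epsilon>' = min \<epsilon> (m / 2)"
    have \<epsilon>': "0 < \<epsilon>'" "\<epsilon>' < m" "\<epsilon>' \<le> \<epsilon>" using \<epsilon> m by (auto simp: \<epsilon>'_def)
    obtain R \<eta> where \<eta>: "\<eta> > 0" and R: "\<And>E. E \<in> sets borel \<Longrightarrow> emeasure lborel E = ennreal m \<Longrightarrow> ennreal c \<le> emeasure lborel (E \<inter> ball 0 s)
       \<Longrightarrow> total_energy \<alpha> E \<le> ennreal (e + \<eta>) \<Longrightarrow> emeasure lborel (E - ball 0 R) < ennreal \<epsilon>'"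
      unfolding e_def by (rule tightness[OF a a3 m s c \<epsilon>'(1,2)]) blast
    obtain N where N: "\<And>n. n \<ge> N \<Longrightarrow> 1 / real (Suc n) \<le> \<eta>" using small[OF \<eta>] by blast
    have "emeasure lborel (E n - ball 0 R) \<le> ennreal \<epsilon>" if n: "n \<ge> N" for n
    proof -
      have "total_energy \<alpha> (E n) \<le> ennreal (e + \<eta>)"
        by (rule order_trans[OF E(3)[of n]]) (use N[OF n] in \<open>intro ennreal_leI, simp\<close>)
      from R[OF E(1,2,4) this] have "emeasure lborel (E n - ball 0 R) \<le> ennreal \<epsilon>'" by simp
      also have "\<dots> \<le> ennreal \<epsilon>" using \<epsilon>'(3) by (rule ennreal_leI)
      finally show ?thesis .
    qed
    then show ?thesis by blast
  qed
  obtain r :: "nat \<Rightarrow> nat" where r: "strict_mono r"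
    "\<And>t. t > 0 \<Longrightarrow> \<exists>N. \<forall>i\<ge>N. \<forall>j\<ge>N. emeasure lborel (sym_diff (E (r i)) (E (r j))) \<le> ennreal t"
    by (rule L1_Cauchy_subsequence[of E m "e + 1", OF E(1) _ _ P _ tight]) (use E(2) m e in auto)
  have fin: "emeasure lborel (E (r n)) < \<infinity>" for n using E(2) by simp
  obtain F where F: "F \<in> sets borel" "\<And>t. t > 0 \<Longrightarrow> \<exists>N. \<forall>i\<ge>N. emeasure lborel (sym_diff F (E (r i))) \<le> ennreal t"
    using L1_complete_sets[of "\<lambda>n. E (r n)", OF E(1) fin r(2)] by metis
  \<comment> \<open>No mass is lost in the limit: by tightness the convergence is in L1 on all of
    space, not merely on bounded sets.\<close>
  have FE: "emeasure lborel F = ennreal m"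
  proof (rule antisym; rule ennreal_le_epsilon)
    fix t :: real assume "t > 0"
    then obtain i where i: "emeasure lborel (sym_diff F (E (r i))) \<le> ennreal t" using F(2) by blast
    have S: "sym_diff F (E (r i)) \<in> sets lborel" using F(1) E(1) by auto
    have "emeasure lborel F \<le> emeasure lborel (E (r i) \<union> sym_diff F (E (r i)))"
      using F(1) E(1) by (intro emeasure_mono) auto
    also have "\<dots> \<le> emeasure lborel (E (r i)) + emeasure lborel (sym_diff F (E (r i)))"
      using E(1) S by (intro emeasure_subadditive) auto
    also have "\<dots> \<le> ennreal m + ennreal t" using i E(2) by (intro add_mono) auto
    finally show "emeasure lborel F \<le> ennreal m + ennreal t" .
    have "emeasure lborel (E (r i)) \<le> emeasure lborel (F \<union> sym_diff F (E (r i)))"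
      using F(1) E(1) by (intro emeasure_mono) auto
    also have "\<dots> \<le> emeasure lborel F + emeasure lborel (sym_diff F (E (r i)))"
      using F(1) S by (intro emeasure_subadditive) auto
    also have "\<dots> \<le> emeasure lborel F + ennreal t" using i by (intro add_left_mono)
    finally show "ennreal m \<le> emeasure lborel F + ennreal t" by (simp add: E(2))
  qed
  have FT: "total_energy \<alpha> F \<le> ennreal e"
  proof (rule total_energy_lower_semicontinuous[OF a F(1), of "\<lambda>n. E (r n)"])
    fix t :: real assume t: "t > 0"
    obtain N1 where N1: "\<And>i. i \<ge> N1 \<Longrightarrow> emeasure lborel (sym_diff F (E (r i))) \<le> ennreal t" using F(2)[OF t] by blast
    obtain N2 where N2: "\<And>n. n \<ge> N2 \<Longrightarrow> 1 / real (Suc n) \<le> t" using small[OF t] by blast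
    let ?n = "max N1 N2"
    \<comment> \<open>A strictly increasing sequence of indices satisfies r n \<ge> n, so the energy
      bound of the original sequence carries over.\<close>
    have "r ?n \<ge> N2" using seq_suble[OF r(1), of ?n] by linarith
    then have "total_energy \<alpha> (E (r ?n)) \<le> ennreal (e + t)"
      by (intro order_trans[OF E(3)] ennreal_leI) (use N2 in simp)
    then show "\<exists>n. emeasure lborel (sym_diff F (E (r n))) \<le> ennreal t \<and> total_energy \<alpha> (E (r n)) \<le> ennreal (e + t)"
      using N1[of ?n] by (intro exI[of _ ?n]) simp
  qed (use E(1) e in auto)
  have "perimeter F \<le> total_energy \<alpha> F" by (simp add: total_energy_def)
  also have "\<dots> < \<infinity>" using FT by (rule le_less_trans) simp
  finally have "F \<in> admissible m" using F(1) FE by (simp add: admissible_def finite_perimeter_def)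
  moreover have "total_energy \<alpha> F = min_energy \<alpha> m"
    using FT min_energy_le[OF F(1) FE, of \<alpha>] e(1) by (intro antisym) auto
  ultimately show ?thesis by blast
qed

theorem theorem1p1:
  fixes \<alpha> :: real
  assumes "\<alpha> > (2 * pi) powr (1/3)"
  shows "(\<forall>m>0. \<exists>E\<in>admissible m. total_energy \<alpha> E = min_energy \<alpha> m) \<and>
         strict_antimono_on {0<..} (\<lambda>m::real. min_energy \<alpha> m / ennreal m)"
proof -
  have p: "(2 * pi) powr (1/3) > 0" by simp
  then have a: "\<alpha> > 0" using assms by linarith
  have "((2 * pi) powr (1/3)) ^ 3 = 2 * pi" by (simp add: powr_power)
  then have a3: "\<alpha> ^ 3 > 2 * pi" using power_strict_mono[OF assms, of 3] p by simp
  have "strict_antimono_on {0<..} (\<lambda>m::real. min_energy \<alpha> m / ennreal m)"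
  proof (rule monotone_onI)
    fix m m' :: real assume "m \<in> {0<..}" "m' \<in> {0<..}" "m < m'"
    then have m: "0 < m" "0 < m'" "m < m'" by auto
    \<comment> \<open>Both energy and mass are finite and the mass is positive, so the extended
      quotient is the real one and strict inequality transfers.\<close>
    have "min_energy \<alpha> t / ennreal t = ennreal (min_energy_real \<alpha> t / t)" if "t > 0" for t
      using that by (simp add: min_energy_eq_real[OF a] divide_ennreal)
    then show "min_energy \<alpha> m / ennreal m > min_energy \<alpha> m' / ennreal m'"
      using min_energy_per_mass_strict_antimono[OF a a3 m(1,3)] m by (simp add: ennreal_less_iff)
  qed
  then show ?thesis using minimizer_exists[OF a a3] by blast
qed

end
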